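(* Let $\Omega$ be a compact metric space and $\varphi:\Omega\to\Omega$ a continuous map such that $(\Omega,\varphi)$ is tame. Then there exists an ergodic operator sequence in $\mathcal{L}(X^* )$ converging in the $\mathrm{W^*O}$-topology, and the following are equivalent: (a) every ergodic operator net in $\mathcal{L}(X^* )$ converges in the $\mathrm{W^*O}$-topology; (b) for every $\omega\in\Omega$ the subsystem $(\overline{o}(\omega),\varphi)$ is uniquely ergodic; (c) every ergodic operator sequence in $\mathcal{L}(X^* )$ converges in the $\mathrm{W^*O}$-topology; (d) for every $\omega\in\Omega$ the orbit closure $\overline{o}(\omega)$ contains exactly one minimal set.
   Context: $X=C(\Omega)$ with sup norm, $X^*$ the space of Radon measures, pairing $(x,\mu)$. $Ux=x\circ\varphi$, $V=U^*$. The $\mathrm{W^*O}$-topology on $\mathcal{L}(X^* )$: $T_\alpha\to T$ iff $(x,T_\alpha\mu)\to(x,T\mu)$ for all $x,\mu$. A net (or sequence) $\{V_\alpha\}\subseteq\operatorname{co}\{V^n:n\in\mathbb{N}_0\}$ is ergodic if $(x,(\operatorname{Id}-V)V_\alpha\mu)\to0$ for all $x\in X,\mu\in X^*$. $\overline{o}(\omega)$ is the closure of $\{\varphi^n\omega:n\ge0\}$; a minimal set is a nonempty closed $\varphi$-invariant set with no proper such subset. The system $(\Omega,\varphi)$ is tame if for every $x\in X$ and every strictly increasing sequence $\{n(k)\}\subseteq\mathbb{N}_0$, $\inf_a\|\sum_k a_k\,x\circ\varphi^{n(k)}\|_X=0$, the infimum over finitely supported scalar sequences with $\sum_k|a_k|=1$.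 *)

theory Defs
  imports "HOL-Analysis.Analysis" "HOL-Probability.Probability"
begin

text \<open>X = C(Omega) (real scalars, sup norm) is the type of bounded continuous functions
  (bounded continuous real functions); on a compact Omega these are all continuous functions.
  X^* is the dual space of bounded linear functionals (Radon measures via Riesz);
  the pairing (x, mu) is mu applied to x.\<close>

type_synonym 'a CX = "'a \<Rightarrow>\<^sub>C real"
type_synonym 'a CXd = "'a CX \<Rightarrow>\<^sub>L real"
type_synonym 'a LXd = "'a CXd \<Rightarrow>\<^sub>L 'a CXd"

definition koopU :: "('a::metric_space \<Rightarrow> 'a) \<Rightarrow> 'a CX \<Rightarrow>\<^sub>L 'a CX" where
  "koopU \<phi> = Blinfun (\<lambda>x. Bcontfun (\<lambda>\<omega>. apply_bcontfun x (\<phi> \<omega>)))"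

definition koopV :: "('a::metric_space \<Rightarrow> 'a) \<Rightarrow> 'a LXd" where
  "koopV \<phi> = Blinfun (\<lambda>\<mu>. \<mu> o\<^sub>L koopU \<phi>)"

definition Vpow :: "('a::metric_space \<Rightarrow> 'a) \<Rightarrow> nat \<Rightarrow> 'a LXd" where
  "Vpow \<phi> n = ((\<lambda>T. koopV \<phi> o\<^sub>L T) ^^ n) id_blinfun"

definition coV :: "('a::metric_space \<Rightarrow> 'a) \<Rightarrow> 'a LXd set" where
  "coV \<phi> = convex hull (range (Vpow \<phi>))"

text \<open>An operator net is represented by a filter F on L(X^*) (the filter of tails of the net).\<close>
definition ergodic_filter :: "('a::metric_space \<Rightarrow> 'a) \<Rightarrow> 'a LXd filter \<Rightarrow> bool" where
  "ergodic_filter \<phi> F \<longleftrightarrow>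
     (\<forall>x \<mu>. ((\<lambda>T. blinfun_apply (blinfun_apply (id_blinfun - koopV \<phi>) (blinfun_apply T \<mu>)) x) \<longlongrightarrow> 0) F)"

definition WsO_converges :: "'a::metric_space LXd filter \<Rightarrow> bool" where
  "WsO_converges F \<longleftrightarrow>
     (\<exists>T::'a LXd. \<forall>x \<mu>. ((\<lambda>S. blinfun_apply (blinfun_apply S \<mu>) x) \<longlongrightarrow> blinfun_apply (blinfun_apply T \<mu>) x) F)"

definition ergodic_net :: "('a::metric_space \<Rightarrow> 'a) \<Rightarrow> 'a LXd filter \<Rightarrow> bool" where
  "ergodic_net \<phi> F \<longleftrightarrow> F \<noteq> bot \<and> eventually (\<lambda>T. T \<in> coV \<phi>) F \<and> ergodic_filter \<phi> F"

definition ergodic_seq :: "('a::metric_space \<Rightarrow> 'a) \<Rightarrow> (nat \<Rightarrow> 'a LXd) \<Rightarrow> bool" where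
  "ergodic_seq \<phi> Vs \<longleftrightarrow> (\<forall>n. Vs n \<in> coV \<phi>) \<and>
     (\<forall>x \<mu>. (\<lambda>n. blinfun_apply (blinfun_apply (id_blinfun - koopV \<phi>) (blinfun_apply (Vs n) \<mu>)) x) \<longlonglongrightarrow> 0)"

definition WsO_converges_seq :: "(nat \<Rightarrow> 'a::metric_space LXd) \<Rightarrow> bool" where
  "WsO_converges_seq Vs \<longleftrightarrow>
     (\<exists>T. \<forall>x \<mu>. (\<lambda>n. blinfun_apply (blinfun_apply (Vs n) \<mu>) x) \<longlonglongrightarrow> blinfun_apply (blinfun_apply T \<mu>) x)"

definition tame :: "('a::metric_space \<Rightarrow> 'a) \<Rightarrow> bool" where
  "tame \<phi> \<longleftrightarrow> (\<forall>(x::'a CX) (n::nat \<Rightarrow> nat). strict_mono n \<longrightarrow>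
     Inf {norm (\<Sum>k\<in>K. a k *\<^sub>R Bcontfun (\<lambda>\<omega>. apply_bcontfun x ((\<phi> ^^ n k) \<omega>)))
          | K (a::nat \<Rightarrow> real). finite K \<and> (\<Sum>k\<in>K. \<bar>a k\<bar>) = 1} = 0)"

definition orbit_closure :: "('a::metric_space \<Rightarrow> 'a) \<Rightarrow> 'a \<Rightarrow> 'a set" where
  "orbit_closure \<phi> \<omega> = closure (range (\<lambda>n. (\<phi> ^^ n) \<omega>))"

definition minimal_set :: "('a::metric_space \<Rightarrow> 'a) \<Rightarrow> 'a set \<Rightarrow> bool" where
  "minimal_set \<phi> M \<longleftrightarrow> M \<noteq> {} \<and> closed M \<and> \<phi> ` M \<subseteq> M \<and>
     (\<forall>N. N \<noteq> {} \<and> closed N \<and> \<phi> ` N \<subseteq> N \<and> N \<subseteq> M \<longrightarrow> N = M)"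

text \<open>phi-invariant Borel probability measure on Omega concentrated on K
  (= invariant Borel probability measure of the subsystem (K, phi)).\<close>
definition invariant_prob_on :: "('a::metric_space \<Rightarrow> 'a) \<Rightarrow> 'a set \<Rightarrow> 'a measure \<Rightarrow> bool" where
  "invariant_prob_on \<phi> K M \<longleftrightarrow> prob_space M \<and> sets M = sets borel \<and>
     emeasure M (UNIV - K) = 0 \<and> (\<forall>A\<in>sets borel. emeasure M (\<phi> -` A) = emeasure M A)"

definition uniquely_ergodic_on :: "('a::metric_space \<Rightarrow> 'a) \<Rightarrow> 'a set \<Rightarrow> bool" where
  "uniquely_ergodic_on \<phi> K \<longleftrightarrow> (\<exists>!M. invariant_prob_on \<phi> K M)"

end

theory Submission
  imports Defs "HOL-Library.Diagonal_Subsequence"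
begin

text \<open>Tameness says that no subsequence of \<open>x \<circ> \<phi>\<^sup>n\<close> spans \<open>\<ell>\<^sup>1\<close>, so by Rosenthal's
  dichotomy every sequence in this orbit has a pointwise convergent subsequence. The same holds for
  its convex hull: otherwise the hull would contain an independent sequence, which is uniformly
  separated in \<open>L\<^sup>1(M)\<close> for some probability measure \<open>M\<close>, whereas by dominated convergence the
  orbit, hence its convex hull, is totally bounded in \<open>L\<^sup>1(M)\<close>. A diagonal argument now yields a
  W*O-convergent subsequence of the Cesaro means.

  For nets, the pointwise limit of continuous functions along a filter need not commute with
  integration. It does for nets from a pointwise sequentially precompact set with a limit of the
  first Baire class: otherwise a cluster point in \<open>L\<^sup>1(M)\<close> differs from the pointwise limit on a
  set of positive measure, and a suitable sequence of the net would have a limit of the first Baire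
  class without continuity points on some closed set. This gives (b) to (a): under (b) the pointwise
  limit at \<open>\<omega>\<close> is the integral against the unique invariant measure on the orbit closure.

  For (c) to (d), Cesaro means along blocks of time that the orbit of \<open>\<omega>\<close> spends near one or the
  other of two minimal sets form a divergent ergodic sequence. For (d) to (b), finitely many points
  can be brought near the unique minimal set \<open>Y\<close> simultaneously, so the convergence theorem for
  filters shows that every invariant measure lives on \<open>Y\<close>; and the limit of an ergodic sequence is
  an invariant function of the first Baire class, hence constant on \<open>Y\<close>.\<close>

section \<open>Rosenthal's dichotomy\<close>

text \<open>The recurring obstacle is that dominated convergence concerns sequences while the
  theorem speaks of nets. A sequence extracted from a net can be made to meet countably many
  conditions, and the proof is arranged so that countably many suffice: C(\<Omega>) is separable, so
  asymptotic invariance is tested on a dense sequence; a pointwise precompact set is totally bounded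
  in L^1(M), so a cluster point is pinned down by errors of order 2^-n; and a closed set has a
  countable dense subset on which the extracted sequence can be steered to the values of the
  pointwise limit. A functional \<mu> enters through a finite measure M such that |\<mu>(x)| is at
  most the integral of |x| against M; this turns convergence against \<mu> into convergence in
  L^1(M). The Riesz construction works with functionals on the cone of nonnegative continuous
  functions, because the supremum that defines the total variation of \<mu> lives on that
  cone.\<close>

definition separates_finitely ::
  "(nat \<Rightarrow> 't set) \<Rightarrow> (nat \<Rightarrow> 't set) \<Rightarrow> 't set \<Rightarrow> nat set \<Rightarrow> bool" where
  "separates_finitely A B T M \<longleftrightarrow> (\<forall>t\<in>T. finite {n\<in>M. t \<in> A n} \<or> finite {n\<in>M. t \<in> B n})"

lemma separates_finitely_mono:
  assumes "separates_finitely A B T M" "M' \<subseteq> M"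
  shows "separates_finitely A B T M'"
  unfolding separates_finitely_def
proof
  fix t assume "t \<in> T"
  then have "finite {n\<in>M. t \<in> A n} \<or> finite {n\<in>M. t \<in> B n}"
    using assms(1) unfolding separates_finitely_def by blast
  moreover have "{n\<in>M'. t \<in> D n} \<subseteq> {n\<in>M. t \<in> D n}" for D using assms(2) by blast
  ultimately show "finite {n\<in>M'. t \<in> A n} \<or> finite {n\<in>M'. t \<in> B n}"
    by (meson finite_subset)
qed

text \<open>With A n = {f n > s} and B n = {f n < r}, \<open>separates_finitely\<close> says that
  along M no point of T crosses the gap between r and s infinitely often. The hereditary negation is
  the form of failure that survives passing to infinite subsets, on which the tree construction
  relies.\<close>

definition nowhere_separated ::
  "(nat \<Rightarrow> 't set) \<Rightarrow> (nat \<Rightarrow> 't set) \<Rightarrow> 't set \<Rightarrow> nat set \<Rightarrow> bool" where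
  "nowhere_separated A B T M \<longleftrightarrow> (\<forall>M'\<subseteq>M. infinite M' \<longrightarrow> \<not> separates_finitely A B T M')"

lemma nowhere_separated_mono:
  "nowhere_separated A B T M \<Longrightarrow> M' \<subseteq> M \<Longrightarrow> nowhere_separated A B T M'"
  unfolding nowhere_separated_def by blast

text \<open>If no j worked, every infinite subset of M, with its least element as j, would yield
  some T in \<S> and a side (A or B) such that this half of T is separated along a smaller infinite
  set. Under iteration one pair (T, side) recurs infinitely often, and the recurring indices form a
  set along which all of T is separated.\<close>

lemma nowhere_separated_split:
  fixes A B :: "nat \<Rightarrow> 't set"
  assumes fin: "finite \<S>" and inf: "infinite M" and bad: "\<And>T. T \<in> \<S> \<Longrightarrow> nowhere_separated A B T M"
  shows "\<exists>j\<in>M. \<exists>M'\<subseteq>M. infinite M' \<and>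
           (\<forall>T\<in>\<S>. nowhere_separated A B (T \<inter> A j) M' \<and> nowhere_separated A B (T \<inter> B j) M')"
proof (rule ccontr)
  assume neg: "\<not> ?thesis"
  define C where "C b = (if b then A else B)" for b :: bool
  define R where "R M' p M'' \<longleftrightarrow> M'' \<subseteq> M' \<inter> {Inf M'<..} \<and> infinite M'' \<and> fst p \<in> \<S> \<and>
      separates_finitely A B (fst p \<inter> C (snd p) (Inf M')) M''" for M' p M''
  have step: "\<exists>M'' p. R M' p M''" if M': "M' \<subseteq> M" "infinite M'" for M'
  proof -
    have "M' \<noteq> {}" using M' by auto
    then have "Inf M' \<in> M" using M' Inf_nat_def1 by blast
    moreover have "infinite (M' \<inter> {Inf M'<..})"
      using M'(2) by (metis Compl_eq Diff_eq finite_Diff2 finite_atMost Compl_atMost)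
    ultimately obtain T where T: "T \<in> \<S>" "\<not> nowhere_separated A B (T \<inter> A (Inf M'))
        (M' \<inter> {Inf M'<..}) \<or>
        \<not> nowhere_separated A B (T \<inter> B (Inf M')) (M' \<inter> {Inf M'<..})"
      using neg M' by (metis inf.coboundedI1)
    then obtain b M'' where "M'' \<subseteq> M' \<inter> {Inf M'<..}" "infinite M''"
        "separates_finitely A B (T \<inter> C b (Inf M')) M''"
      unfolding nowhere_separated_def C_def by metis
    with T(1) have "R M' (T, b) M''" unfolding R_def by auto
    then show ?thesis by blast
  qed
  have "\<exists>m. \<forall>n. (m n \<subseteq> M \<and> infinite (m n)) \<and> (\<exists>p. R (m n) p (m (Suc n)))"
  proof (rule dependent_nat_choice)
    show "\<exists>x. x \<subseteq> M \<and> infinite x" using inf by auto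
    show "\<exists>y. (y \<subseteq> M \<and> infinite y) \<and> (\<exists>p. R x p y)" if "x \<subseteq> M \<and> infinite x" for x n
      using step[of x] that unfolding R_def by (metis le_inf_iff order_trans)
  qed
  then obtain m where m: "\<And>n. m n \<subseteq> M" "\<And>n. infinite (m n)" and "\<And>n. \<exists>p. R (m n) p (m (Suc n))"
    by blast
  then obtain p where p: "\<And>n. R (m n) (p n) (m (Suc n))" by metis
  define j where "j n = Inf (m n)" for n
  have jm: "j n \<in> m n" for n
    unfolding j_def using m(2)[of n] Inf_nat_def1[of "m n"] by fastforce
  have "m (Suc n) \<subseteq> m n" for n using p[of n] unfolding R_def by auto
  then have mdec: "m b \<subseteq> m a" if "a \<le> b" for a b
    using that by (rule lift_Suc_antimono_le)
  have "j n < j (Suc n)" for n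
    using p[of n] jm[of "Suc n"] unfolding R_def j_def by auto
  then have jmono: "strict_mono j" by (simp add: strict_mono_Suc_iff)
  have "p n \<in> \<S> \<times> UNIV" for n using p[of n] unfolding R_def by (simp add: mem_Times_iff)
  then have "range p \<subseteq> \<S> \<times> UNIV" by blast
  then have "finite (range p)" using fin by (meson finite finite_SigmaI finite_subset)
  \<comment> \<open>Finitely many pairs are available, so one of them occurs at infinitely many
    stages; \<open>L\<close> collects the indices of these stages.\<close>
  then obtain k0 where k0: "infinite {k. p k = p k0}"
    using pigeonhole_infinite[of UNIV p] by auto
  define T b where "T = fst (p k0)" and "b = snd (p k0)"
  define L where "L = j ` {k. p k = p k0}"
  have "infinite L"
    unfolding L_def using k0 jmono by (metis finite_imageD inj_on_subset strict_mono_imp_inj_on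
        subset_UNIV)
  moreover have "L \<subseteq> M" unfolding L_def using jm m by blast
  moreover have "separates_finitely A B T L"
    unfolding separates_finitely_def
  proof
    fix t assume t: "t \<in> T"
    show "finite {n \<in> L. t \<in> A n} \<or> finite {n \<in> L. t \<in> B n}"
    \<comment> \<open>Either t lies in the chosen half at some stage k, and is then handled along
      \<open>m (Suc k)\<close>, which contains all but finitely many elements of L; or t avoids the
      chosen side at every index of L.\<close>
    proof (cases "\<exists>k. p k = p k0 \<and> t \<in> C b (j k)")
      case True
      then obtain k where k: "p k = p k0" "t \<in> C b (j k)" by blast
      have "separates_finitely A B (T \<inter> C b (j k)) (m (Suc k))"
        using p[of k] k unfolding R_def T_def b_def j_def by simp
      then have *: "finite {n\<in>m (Suc k). t \<in> A n} \<or> finite {n\<in>m (Suc k). t \<in> B n}"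
        using t k unfolding separates_finitely_def by blast
      have "L \<subseteq> m (Suc k) \<union> j ` {..k}"
      proof
        fix l assume "l \<in> L"
        then obtain i where "l = j i" unfolding L_def by blast
        then show "l \<in> m (Suc k) \<union> j ` {..k}"
          using jm[of i] mdec[of "Suc k" i] by (cases "i \<le> k") auto
      qed
      then have "{n \<in> L. t \<in> D n} \<subseteq> {n \<in> m (Suc k). t \<in> D n} \<union> j ` {..k}" for D by auto
      then show ?thesis using * by (meson finite_UnI finite_atMost finite_imageI finite_subset)
    next
      case False
      then have "{n \<in> L. t \<in> C b n} = {}" unfolding L_def by auto
      then have "finite {n \<in> L. t \<in> C b n}" by (metis finite.emptyI)
      then show ?thesis unfolding C_def by (cases b) simp_all
    qed
  qed
  moreover have "T \<in> \<S>" using p[of k0] unfolding R_def T_def by simp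
  ultimately show False using bad unfolding nowhere_separated_def by blast
qed

text \<open>A binary tree of cells: at stage k every cell is cut by both
  \<open>A (\<sigma> k)\<close> and \<open>B (\<sigma> k)\<close>, where the splitting lemma serves
  the whole finite level with one index and one remaining infinite set. Cells stay nonempty because
  the empty set is trivially separated.\<close>

lemma nowhere_separated_imp_independent:
  fixes A B :: "nat \<Rightarrow> 't set"
  assumes inf: "infinite M" and bad: "nowhere_separated A B S M"
  shows "\<exists>\<sigma>::nat \<Rightarrow> nat. strict_mono \<sigma> \<and> (\<forall>k c. \<exists>t. \<forall>i<k. t \<in> (if c i then A (\<sigma> i) else B (\<sigma> i)))"
proof -
  define good where "good p \<longleftrightarrow> finite (fst p) \<and> infinite (snd p) \<and>
    (\<forall>T\<in>fst p. nowhere_separated A B T (snd p))" for p :: "'t set set \<times> nat set"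
  define R where "R p j q \<longleftrightarrow> j \<in> snd p \<and> snd q \<subseteq> snd p \<inter> {j<..} \<and>
    fst q = (\<lambda>T. T \<inter> A j) ` fst p \<union> (\<lambda>T. T \<inter> B j) ` fst p" for p q :: "'t set set \<times> nat set" and j
  have step: "\<exists>q. good q \<and> (\<exists>j. R p j q)" if "good p" for p
  proof -
    obtain \<S> M1 where p: "p = (\<S>, M1)" by (cases p)
    have "\<exists>j\<in>M1. \<exists>M'\<subseteq>M1. infinite M' \<and>
           (\<forall>T\<in>\<S>. nowhere_separated A B (T \<inter> A j) M' \<and> nowhere_separated A B (T \<inter> B j) M')"
      using that unfolding good_def p by (intro nowhere_separated_split) auto
    then obtain j M' where j: "j \<in> M1" "M' \<subseteq> M1" "infinite M'"
      "\<forall>T\<in>\<S>. nowhere_separated A B (T \<inter> A j) M' \<and> nowhere_separated A B (T \<inter> B j) M'" by blast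
    have "infinite (M' \<inter> {j<..})"
      using j(3) by (metis Compl_eq Diff_eq finite_Diff2 finite_atMost Compl_atMost)
    moreover have "M' \<inter> {j<..} \<subseteq> M'" by blast
    ultimately have "good ((\<lambda>T. T \<inter> A j) ` \<S> \<union> (\<lambda>T. T \<inter> B j) ` \<S>, M' \<inter> {j<..})"
      using that j(4) nowhere_separated_mono[of A B _ M' "M' \<inter> {j<..}"] unfolding good_def p by auto
    moreover have "R p j ((\<lambda>T. T \<inter> A j) ` \<S> \<union> (\<lambda>T. T \<inter> B j) ` \<S>, M' \<inter> {j<..})"
      unfolding R_def p using j by auto
    ultimately show ?thesis by blast
  qed
  have "\<exists>s. \<forall>n. (good (s n) \<and> (n = 0 \<longrightarrow> S \<in> fst (s n))) \<and> (\<exists>j. R (s n) j (s (Suc n)))"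
  proof (rule dependent_nat_choice)
    show "\<exists>x. good x \<and> (0 = (0::nat) \<longrightarrow> S \<in> fst x)"
      using assms unfolding good_def by (intro exI[of _ "({S}, M)"]) auto
    show "\<exists>y. (good y \<and> (Suc n = 0 \<longrightarrow> S \<in> fst y)) \<and> (\<exists>j. R x j y)"
      if "good x \<and> (n = 0 \<longrightarrow> S \<in> fst x)" for x n
      using step[of x] that by auto
  qed
  then obtain s where s: "\<And>n. good (s n)" "S \<in> fst (s 0)" and "\<And>n. \<exists>j. R (s n) j (s (Suc n))"
    by blast
  then obtain \<sigma> where \<sigma>: "\<And>n. R (s n) (\<sigma> n) (s (Suc n))" by metis
  have "\<sigma> n < \<sigma> (Suc n)" for n using \<sigma>[of n] \<sigma>[of "Suc n"] unfolding R_def by auto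
  then have mono: "strict_mono \<sigma>" by (simp add: strict_mono_Suc_iff)
  \<comment> \<open>A sign pattern c is a branch of the tree, and its cell at level k realizes the
    first k signs.\<close>
  have ex: "\<exists>T\<in>fst (s k). \<forall>i<k. T \<subseteq> (if c i then A (\<sigma> i) else B (\<sigma> i))" for k and c :: "nat \<Rightarrow> bool"
  proof (induction k)
    case 0
    then show ?case using s by auto
  next
    case (Suc k)
    then obtain T where T: "T \<in> fst (s k)" "\<forall>i<k. T \<subseteq> (if c i then A (\<sigma> i) else B (\<sigma> i))" by blast
    have "T \<inter> (if c k then A (\<sigma> k) else B (\<sigma> k)) \<in> fst (s (Suc k))"
      using \<sigma>[of k] T(1) unfolding R_def by auto
    moreover have "\<forall>i<Suc k. T \<inter> (if c k then A (\<sigma> k) else B (\<sigma> k))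
        \<subseteq> (if c i then A (\<sigma> i) else B (\<sigma> i))"
    proof (intro allI impI)
      fix i assume "i < Suc k"
      then consider "i = k" | "i < k" by linarith
      then show "T \<inter> (if c k then A (\<sigma> k) else B (\<sigma> k)) \<subseteq> (if c i then A (\<sigma> i) else B (\<sigma> i))"
        using T(2) by cases blast+
    qed
    ultimately show ?case by blast
  qed
  have "T \<noteq> {}" if "T \<in> fst (s k)" for T k
  proof
    assume "T = {}"
    then show False
      using s(1)[of k] that unfolding good_def nowhere_separated_def separates_finitely_def by blast
  qed
  then have "\<exists>t. \<forall>i<k. t \<in> (if c i then A (\<sigma> i) else B (\<sigma> i))" for k c
    using ex[of k c] by (smt (verit) ex_in_conv subsetD)
  with mono show ?thesis by blast
qed

text \<open>Countably many rational gaps r < s exhaust all gaps. If none carries an independent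
  subsequence, successive thinning disposes of each of them, and along the diagonal sequence liminf
  cannot fall below limsup at any point.\<close>

theorem rosenthal_dichotomy:
  fixes f :: "nat \<Rightarrow> 't \<Rightarrow> real"
  assumes bdd: "\<And>t n. \<bar>f n t\<bar> \<le> C"
  obtains \<sigma> :: "nat \<Rightarrow> nat" where "strict_mono \<sigma>" "\<And>t. convergent (\<lambda>k. f (\<sigma> k) t)"
  | r s and \<sigma> :: "nat \<Rightarrow> nat" where "r < s" "strict_mono \<sigma>"
      "\<And>k c. \<exists>t. \<forall>i<k. if c i then f (\<sigma> i) t > s else f (\<sigma> i) t < (r::real)"
proof (cases "\<exists>r s (\<sigma>::nat \<Rightarrow> nat). r < s \<and> strict_mono \<sigma> \<and>
     (\<forall>k c. \<exists>t. \<forall>i<k. if c i then f (\<sigma> i) t > s else f (\<sigma> i) t < (r::real))")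
  case True
  then obtain r s and \<sigma> :: "nat \<Rightarrow> nat" where rs: "r < s" "strict_mono \<sigma>" and
     ind: "\<forall>k c. \<exists>t. \<forall>i<k. if c i then f (\<sigma> i) t > s else f (\<sigma> i) t < r"
    by (elim exE conjE) (rule that; assumption)
  show ?thesis by (rule that(2)[OF rs]) (rule ind[THEN spec, THEN spec])
next
  case False
  define A where "A s n = {t. f n t > s}" for s n
  define B where "B r n = {t. f n t < r}" for r n
  have nb: "\<not> nowhere_separated (A s) (B r) UNIV M" if rs: "r < s" and inf: "infinite M" for r s M
  proof
    assume ns: "nowhere_separated (A s) (B r) UNIV M"
    obtain \<sigma> :: "nat \<Rightarrow> nat" where \<sigma>: "strict_mono \<sigma>"
      "\<forall>k c. \<exists>t. \<forall>i<k. t \<in> (if c i then A s (\<sigma> i) else B r (\<sigma> i))"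
      using nowhere_separated_imp_independent[OF inf ns] by (elim exE conjE) (rule that; assumption)
    then have "\<exists>t. \<forall>i<k. if c i then f (\<sigma> i) t > s else f (\<sigma> i) t < r" for k c
      using \<sigma>(2)[rule_format, of k c] unfolding A_def B_def by (elim exE, intro exI) auto
    then have "\<forall>k c. \<exists>t. \<forall>i<k. if c i then f (\<sigma> i) t > s else f (\<sigma> i) t < r" by simp
    then show False using False rs \<sigma>(1) by blast
  qed
  define q where "q n = (from_nat n :: rat \<times> rat)" for n
  define P where "P n s \<longleftrightarrow> (fst (q n) < snd (q n) \<longrightarrow>
     separates_finitely (A (of_rat (snd (q n)))) (B (of_rat (fst (q n)))) UNIV (range s))"
    for n and s :: "nat \<Rightarrow> nat"
  interpret subseqs P
  proof
    fix n and s :: "nat \<Rightarrow> nat" assume s: "strict_mono s"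
    show "\<exists>r'. strict_mono r' \<and> P n (s \<circ> r')"
    proof (cases "fst (q n) < snd (q n)")
      case True
      have "infinite (range s)" using s by (simp add: finite_image_iff strict_mono_imp_inj_on)
      then obtain M' where M': "M' \<subseteq> range s" "infinite M'"
        "separates_finitely (A (of_rat (snd (q n)))) (B (of_rat (fst (q n)))) UNIV M'"
        using nb[of "of_rat (fst (q n))" "of_rat (snd (q n))" "range s"] True
        unfolding nowhere_separated_def by (auto simp: of_rat_less)
      have eq: "s ` (s -` M') = M'" using M'(1) by auto
      then have inf: "infinite (s -` M')" using M'(2) by (metis finite_imageI)
      have "range (s \<circ> enumerate (s -` M')) = M'"
        using range_enumerate[OF inf] eq by (metis image_comp)
      then show ?thesis
        using M'(3) strict_mono_enumerate[OF inf] unfolding P_def by metis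
    next
      case False
      then have "strict_mono (id :: nat \<Rightarrow> nat) \<and> P n (s \<circ> id)" by (simp add: P_def strict_mono_def)
      then show ?thesis by blast
    qed
  qed

  have diag: "P n (diagseq \<circ> (+) (Suc n))" for n
  proof (rule diagseq_holds)
    show "P n (s \<circ> r)" if "P n s" for n and r s :: "nat \<Rightarrow> nat"
      using that separates_finitely_mono[of _ _ UNIV "range s" "range (s \<circ> r)"]
      unfolding P_def by auto
  qed
  have "convergent (\<lambda>k. f (diagseq k) t)" for t
  proof -
    define a where "a k = f (diagseq k) t" for k
    \<comment> \<open>The upper and lower limits are taken in the extended reals, where they always
      exist; the bound C makes the common value finite at the end.\<close>
    have "limsup a = liminf a" if "\<And>r s. r < s \<Longrightarrow>
        (\<forall>\<^sub>F k in sequentially. a k \<le> of_rat s) \<or> (\<forall>\<^sub>F k in sequentially. a k \<ge> of_rat r)"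
    proof (rule ccontr)
      assume ne: "limsup a \<noteq> liminf a"
      have "liminf (\<lambda>k. ereal (a k)) \<le> limsup (\<lambda>k. ereal (a k))" by (simp add: Liminf_le_Limsup)
      with ne have "liminf (\<lambda>k. ereal (a k)) < limsup (\<lambda>k. ereal (a k))" by simp
      then obtain r s where rs: "liminf (\<lambda>k. ereal (a k)) < ereal (of_rat r)"
        "r < s" "ereal (of_rat s) < limsup (\<lambda>k. ereal (a k))"
        by (metis ereal_dense3 ereal_less_eq(3) less_ereal.simps(1) of_rat_less)
      from that[OF rs(2)] show False
      proof
        assume "\<forall>\<^sub>F k in sequentially. a k \<le> of_rat s"
        then have "limsup (\<lambda>k. ereal (a k)) \<le> ereal (of_rat s)"
          by (intro Limsup_bounded) (auto elim: eventually_mono)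
        with rs show False by simp
      next
        assume "\<forall>\<^sub>F k in sequentially. a k \<ge> of_rat r"
        then have "ereal (of_rat r) \<le> liminf (\<lambda>k. ereal (a k))"
          by (intro Liminf_bounded) (auto elim: eventually_mono)
        with rs show False by simp
      qed
    qed
    moreover have "(\<forall>\<^sub>F k in sequentially. a k \<le> of_rat s)
        \<or> (\<forall>\<^sub>F k in sequentially. a k \<ge> of_rat r)"
      if "r < s" for r s
    proof -
      obtain n where n: "q n = (r, s)" unfolding q_def by (metis from_nat_to_nat)
      \<comment> \<open>Only from this position on is the diagonal sequence a subsequence of the
        thinning made for the n-th gap.\<close>
      define d where "d k = diagseq (k + Suc n)" for k
      have "separates_finitely (A (of_rat s)) (B (of_rat r)) UNIV (range d)"
        using diag[of n] n that unfolding P_def d_def by (simp add: o_def add.commute)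
      then have fin: "finite {m \<in> range d. f m t > of_rat s}
          \<or> finite {m \<in> range d. f m t < of_rat r}"
        unfolding separates_finitely_def A_def B_def by simp
      have inj: "inj d" using subseq_diagseq unfolding d_def
        by (simp add: inj_def strict_mono_eq)
      have ev: "\<forall>\<^sub>F k in sequentially. \<not> Q (a k)" if "finite {m \<in> range d. Q (f m t)}" for Q
      proof -
        have "d ` {k. Q (f (d k) t)} \<subseteq> {m \<in> range d. Q (f m t)}" by auto
        then have "finite {k. Q (f (d k) t)}" using that inj
          by (metis finite_imageD finite_subset inj_on_subset subset_UNIV)
        then have "\<forall>\<^sub>F k in cofinite. \<not> Q (f (d k) t)" by (simp add: eventually_cofinite)
        then have "\<forall>\<^sub>F k in sequentially. \<not> Q (a (k + Suc n))"
          unfolding a_def d_def by (simp add: cofinite_eq_sequentially)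
        then show ?thesis by (rule eventually_sequentially_seg[THEN iffD1])
      qed
      from fin show ?thesis using ev[of "\<lambda>x. x > of_rat s"] ev[of "\<lambda>x. x < of_rat r"]
        by (auto simp: not_less)
    qed
    ultimately have "limsup a = liminf a" by blast
    then have "convergent (\<lambda>k. ereal (a k))" by (simp add: convergent_ereal)
    then obtain l where l: "(\<lambda>k. ereal (a k)) \<longlonglongrightarrow> l" unfolding convergent_def by blast
    have "\<bar>l\<bar> \<noteq> \<infinity>"
    proof -
      have "a k \<le> C" "- C \<le> a k" for k
        using bdd[of "diagseq k" t] unfolding a_def by linarith+
      then have "l \<le> ereal C" "ereal (-C) \<le> l"
        using LIMSEQ_le_const2[OF l, of "ereal C"] LIMSEQ_le_const[OF l, of "ereal (-C)"]
        by simp_all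
      then
      show ?thesis by auto
    qed
    then obtain l' where "l = ereal l'" by auto
    with l have "a \<longlonglongrightarrow> l'" by simp
    then show ?thesis unfolding a_def convergent_def by blast
  qed
  then show ?thesis using that(1) subseq_diagseq by blast
qed

section \<open>The Koopman operator and tameness\<close>

lemma norm_bcontfun_le: "(\<And>\<omega>. \<bar>apply_bcontfun x \<omega>\<bar> \<le> B) \<Longrightarrow> norm (x::'a::metric_space CX) \<le> B"
  by (rule norm_bound) simp

lemma abs_le_norm_bcontfun: "\<bar>apply_bcontfun x \<omega>\<bar> \<le> norm (x::'a::metric_space CX)"
  using norm_bounded[of x \<omega>] by simp

lemma abs_blinfun_le:
  fixes \<mu> :: "'b::real_normed_vector \<Rightarrow>\<^sub>L real"
  shows "\<bar>blinfun_apply \<mu> x\<bar> \<le> norm \<mu> * norm x"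
  using norm_blinfun[of \<mu> x] by simp

definition dirac :: "'a::metric_space \<Rightarrow> 'a CXd" where
  "dirac \<omega> = Blinfun (\<lambda>x. apply_bcontfun x \<omega>)"

lemma dirac_apply [simp]: "blinfun_apply (dirac \<omega>) x = apply_bcontfun x \<omega>"
proof -
  have "bounded_linear (\<lambda>x::'a CX. apply_bcontfun x \<omega>)"
    by (rule bounded_linear_intro[where K = 1])
       (auto simp: plus_bcontfun.rep_eq scaleR_bcontfun.rep_eq abs_le_norm_bcontfun)
  then show ?thesis by (simp add: dirac_def bounded_linear_Blinfun_apply)
qed

lemma apply_bcontfun_sum:
  "apply_bcontfun (\<Sum>k\<in>K. f k) \<omega> = (\<Sum>k\<in>K. apply_bcontfun (f k :: 'a::metric_space CX) \<omega>)"
  using blinfun.sum_right[of "dirac \<omega>" f K] by simp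

lemma norm_dirac_le: "norm (dirac \<omega>) \<le> 1"
  by (rule norm_blinfun_bound) (auto simp: abs_le_norm_bcontfun)

locale dynamical_system =
  fixes \<phi> :: "'a::metric_space \<Rightarrow> 'a"
  assumes compact_UNIV: "compact (UNIV :: 'a set)"
    and continuous: "continuous_on UNIV \<phi>"
begin

lemma continuous_funpow: "continuous_on UNIV (\<phi> ^^ n)"
proof (induction n)
  case (Suc n)
  have "continuous_on UNIV (\<phi> \<circ> (\<phi> ^^ n))"
    by (intro continuous_on_compose Suc continuous_on_subset[OF continuous]) auto
  then show ?case by (simp add: o_def)
qed (simp add: id_def)

definition koop :: "nat \<Rightarrow> 'a CX \<Rightarrow> 'a CX" where
  "koop n x = Bcontfun (\<lambda>\<omega>. apply_bcontfun x ((\<phi> ^^ n) \<omega>))"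

lemma koop_apply [simp]: "apply_bcontfun (koop n x) \<omega> = apply_bcontfun x ((\<phi> ^^ n) \<omega>)"
proof -
  have "continuous_on UNIV (apply_bcontfun x \<circ> (\<phi> ^^ n))"
    by (intro continuous_on_compose continuous_funpow) auto
  moreover have "bounded (range (\<lambda>\<omega>. apply_bcontfun x ((\<phi> ^^ n) \<omega>)))"
    by (rule bounded_subset[OF bounded_apply_bcontfun[of x]]) auto
  ultimately have "(\<lambda>\<omega>. apply_bcontfun x ((\<phi> ^^ n) \<omega>)) \<in> bcontfun"
    by (simp add: bcontfun_def o_def)
  then show ?thesis by (simp add: koop_def Bcontfun_inverse)
qed

lemma norm_koop_le: "norm (koop n x) \<le> norm x"
  by (rule norm_bcontfun_le) (simp add: abs_le_norm_bcontfun)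

lemma bounded_linear_koop: "bounded_linear (koop n)"
  by (rule bounded_linear_intro[where K = 1])
     (auto intro!: bcontfun_eqI simp: plus_bcontfun.rep_eq scaleR_bcontfun.rep_eq norm_koop_le)

lemma koopU_apply: "blinfun_apply (koopU \<phi>) x = koop 1 x"
  using bounded_linear_Blinfun_apply[OF bounded_linear_koop[of 1]]
  unfolding koopU_def koop_def by simp

lemma koop_koop: "koop m (koop n x) = koop (m + n) x"
  by (rule bcontfun_eqI) (simp add: funpow_add add.commute[of m])

lemma koopV_apply: "blinfun_apply (blinfun_apply (koopV \<phi>) \<mu>) x = blinfun_apply \<mu> (koop 1 x)"
proof -
  have "bounded_linear (\<lambda>\<mu>::'a CXd. \<mu> o\<^sub>L koopU \<phi>)"
    by (rule bounded_bilinear.bounded_linear_left[OF bounded_bilinear_blinfun_compose])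
  then show ?thesis by (simp add: koopV_def bounded_linear_Blinfun_apply koopU_apply)
qed

lemma Vpow_apply: "blinfun_apply (blinfun_apply (Vpow \<phi> n) \<mu>) x = blinfun_apply \<mu> (koop n x)"
proof (induction n arbitrary: x)
  case 0
  have "koop 0 x = x" by (rule bcontfun_eqI) simp
  then show ?case by (simp add: Vpow_def)
next
  case (Suc n)
  have "Vpow \<phi> (Suc n) = koopV \<phi> o\<^sub>L Vpow \<phi> n" by (simp add: Vpow_def)
  then show ?case by (simp add: koopV_apply Suc koop_koop)
qed

definition orb :: "'a CX \<Rightarrow> 'a CX set" where
  "orb x = range (\<lambda>n. koop n x)"

text \<open>The function h is the preadjoint of T applied to x, i.e. the same convex combination of
  Koopman iterates. One h serves every \<mu>, so arguments about operators can be carried out with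
  continuous functions.\<close>

lemma coV_pairing:
  assumes "T \<in> coV \<phi>"
  obtains h where "h \<in> convex hull (orb x)" "\<And>\<mu>. blinfun_apply (blinfun_apply T \<mu>) x
      = blinfun_apply \<mu> h"
proof -
  let ?S = "{T :: 'a LXd. \<exists>h\<in>convex hull (orb x). \<forall>\<mu>. blinfun_apply (blinfun_apply T \<mu>) x
      = blinfun_apply \<mu> h}"
  have "range (Vpow \<phi>) \<subseteq> ?S"
    by (auto simp: Vpow_apply orb_def intro!: bexI[where x = "koop _ x"] hull_inc)
  moreover have "convex ?S"
  proof (rule convexI)
    fix S T :: "'a LXd" and u v :: real
    assume "S \<in> ?S" "T \<in> ?S" and uv: "0 \<le> u" "0 \<le> v" "u + v = 1"
    then obtain g h where gh: "g \<in> convex hull (orb x)" "h \<in> convex hull (orb x)"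
      "\<And>\<mu>. blinfun_apply (blinfun_apply S \<mu>) x = blinfun_apply \<mu> g"
      "\<And>\<mu>. blinfun_apply (blinfun_apply T \<mu>) x = blinfun_apply \<mu> h" by auto
    have "u *\<^sub>R g + v *\<^sub>R h \<in> convex hull (orb x)"
      using convexD[OF convex_convex_hull gh(1,2) uv] .
    moreover have "blinfun_apply (blinfun_apply (u *\<^sub>R S + v *\<^sub>R T) \<mu>) x
        = blinfun_apply \<mu> (u *\<^sub>R g + v *\<^sub>R h)" for \<mu>
      by (simp add: gh blinfun.add_left blinfun.scaleR_left blinfun.add_right blinfun.scaleR_right)
    ultimately show "u *\<^sub>R S + v *\<^sub>R T \<in> ?S" by blast
  qed
  ultimately have "coV \<phi> \<subseteq> ?S" unfolding coV_def by (rule hull_minimal)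
  then show ?thesis using assms that by blast
qed

lemma hull_orb_norm_le: "h \<in> convex hull (orb x) \<Longrightarrow> norm h \<le> norm x"
proof -
  have "orb x \<subseteq> cball 0 (norm x)" unfolding orb_def using norm_koop_le by auto
  then have "convex hull (orb x) \<subseteq> cball 0 (norm x)" by (rule hull_minimal) (rule convex_cball)
  then show "h \<in> convex hull (orb x) \<Longrightarrow> norm h \<le> norm x" by auto
qed

lemma coV_abs_le:
  assumes "T \<in> coV \<phi>"
  shows "\<bar>blinfun_apply (blinfun_apply T \<mu>) x\<bar> \<le> norm \<mu> * norm x"
proof -
  obtain h where h: "h \<in> convex hull (orb x)"
      "\<And>\<mu>. blinfun_apply (blinfun_apply T \<mu>) x = blinfun_apply \<mu> h"
    using coV_pairing[OF assms] by blast
  have "\<bar>blinfun_apply \<mu> h\<bar> \<le> norm \<mu> * norm h" by (rule abs_blinfun_le)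
  also have "\<dots> \<le> norm \<mu> * norm x" using hull_orb_norm_le[OF h(1)] by (simp add: mult_left_mono)
  finally show ?thesis using h by simp
qed

text \<open>An independent subsequence of the orbit would satisfy a lower l^1 estimate with constant
  (s - r)/2, against tameness. The times m k may repeat and come in any order, so the independent
  ones are shown to be distinct and then rearranged increasingly, as tameness speaks of increasing
  sequences.\<close>

lemma tame_orbit_subsequence:
  fixes x :: "'a CX"
  assumes tame: "tame \<phi>"
  obtains \<sigma> :: "nat \<Rightarrow> nat" where "strict_mono \<sigma>"
    "\<And>\<omega>. convergent (\<lambda>k. apply_bcontfun x ((\<phi> ^^ m (\<sigma> k)) \<omega>))"
proof -
  define f where "f k \<omega> = apply_bcontfun x ((\<phi> ^^ m k) \<omega>)" for k \<omega>
  have "\<bar>f k \<omega>\<bar> \<le> norm x" for k \<omega> unfolding f_def by (rule abs_le_norm_bcontfun)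
  then show ?thesis
  proof (cases f rule: rosenthal_dichotomy)
    case (1 \<sigma>)
    then show ?thesis using that unfolding f_def by blast
  next
    case (2 r s \<sigma>)
    define p where "p i = m (\<sigma> i)" for i
    have inj_p: "inj p"
    proof (rule injI, rule ccontr)
      fix i j assume ij: "p i = p j" "i \<noteq> j"
      obtain t where t: "\<forall>l<Suc (max i j). if l = i then f (\<sigma> l) t > s else f (\<sigma> l) t < r"
        using 2(3)[where k = "Suc (max i j)" and c = "\<lambda>l. l = i"] by blast
      have "f (\<sigma> i) t > s" using t[rule_format, of i] by simp
      moreover have "f (\<sigma> j) t < r" using t[rule_format, of j] ij by (simp split: if_splits)
      ultimately show False using 2(1) ij unfolding f_def p_def by simp
    qed
    have inf: "infinite (range p)" using inj_p by (simp add: finite_image_iff)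
    define n where "n = enumerate (range p)"
    have "strict_mono n" unfolding n_def by (rule strict_mono_enumerate[OF inf])
    have "n k \<in> range p" for k unfolding n_def by (rule enumerate_in_set[OF inf])
    then have "\<exists>i. n k = p i" for k by blast
    then obtain \<pi> where \<pi>: "\<And>k. n k = p (\<pi> k)" by metis
    have inj_\<pi>: "inj \<pi>"
      using \<open>strict_mono n\<close> \<pi> by (metis injI strict_mono_eq)
    let ?A = "{norm (\<Sum>k\<in>K. a k *\<^sub>R Bcontfun (\<lambda>\<omega>. apply_bcontfun x ((\<phi> ^^ n k) \<omega>)))
          | K (a::nat \<Rightarrow> real). finite K \<and> (\<Sum>k\<in>K. \<bar>a k\<bar>) = 1}"
    have "(s - r) / 2 \<le> Inf ?A"
    proof (rule cInf_greatest)
      show "?A \<noteq> {}"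
        by (rule ex_in_conv[THEN iffD1], rule exI, rule CollectI, rule exI[of _ "{0}"],
            rule exI[of _ "\<lambda>_. 1"], rule conjI, rule refl, simp)
    next
      fix v assume "v \<in> ?A"
      then obtain K a where K: "finite K" "(\<Sum>k\<in>K. \<bar>a k\<bar>) = 1"
        and v: "v = norm (\<Sum>k\<in>K. a k *\<^sub>R koop (n k) x)" unfolding koop_def by blast
      define z where "z = (\<Sum>k\<in>K. a k *\<^sub>R koop (n k) x)"
      \<comment> \<open>The sign pattern of the coefficients, transported by the rearrangement
        \<pi>; t realizes it and u realizes its opposite.\<close>
      define c where "c i = (a (inv \<pi> i) \<ge> 0)" for i
      have c: "c (\<pi> k) = (a k \<ge> 0)" for k unfolding c_def using inj_\<pi> by simp
      have "finite (\<pi> ` K)" using K by simp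
      then obtain N where N: "\<And>k. k \<in> K \<Longrightarrow> \<pi> k < N"
        using finite_nat_set_iff_bounded by auto
      obtain t where t: "\<forall>i<N. if c i then f (\<sigma> i) t > s else f (\<sigma> i) t < r"
        using 2(3)[where k = N and c = c] by blast
      obtain u where u: "\<forall>i<N. if \<not> c i then f (\<sigma> i) u > s else f (\<sigma> i) u < r"
        using 2(3)[where k = N and c = "\<lambda>i. \<not> c i"] by blast
      have zval: "apply_bcontfun z \<omega> = (\<Sum>k\<in>K. a k * f (\<sigma> (\<pi> k)) \<omega>)" for \<omega>
        unfolding z_def by (simp add: apply_bcontfun_sum scaleR_bcontfun.rep_eq f_def \<pi> p_def)
      \<comment> \<open>The comparison of two opposite points makes the position of the gap
        immaterial, as r and s may have the same sign. Its price is the factor 2 in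
        \<open>2 * norm z\<close>.\<close>
      have "s - r = (\<Sum>k\<in>K. \<bar>a k\<bar> * (s - r))" using K by (simp flip: sum_distrib_right)
      also have "\<dots> \<le> (\<Sum>k\<in>K. a k * f (\<sigma> (\<pi> k)) t - a k * f (\<sigma> (\<pi> k)) u)"
      proof (rule sum_mono)
        fix k assume "k \<in> K"
        then have "\<pi> k < N" by (rule N)
        then have *: "if a k \<ge> 0 then f (\<sigma> (\<pi> k)) t > s else f (\<sigma> (\<pi> k)) t < r"
          "if \<not> a k \<ge> 0 then f (\<sigma> (\<pi> k)) u > s else f (\<sigma> (\<pi> k)) u < r"
          using t u c by metis+
        show "\<bar>a k\<bar> * (s - r) \<le> a k * f (\<sigma> (\<pi> k)) t - a k * f (\<sigma> (\<pi> k)) u"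
        proof (cases "a k \<ge> 0")
          case True
          then have "a k * (s - r) \<le> a k * (f (\<sigma> (\<pi> k)) t - f (\<sigma> (\<pi> k)) u)"
            using * by (intro mult_left_mono) auto
          then show ?thesis using True by (simp add: algebra_simps)
        next
          case False
          then have "- a k * (s - r) \<le> - a k * (f (\<sigma> (\<pi> k)) u - f (\<sigma> (\<pi> k)) t)"
            using * by (intro mult_left_mono) auto
          then show ?thesis using False by (simp add: algebra_simps)
        qed
      qed
      also have "\<dots> = apply_bcontfun z t - apply_bcontfun z u"
        by (simp add: zval sum_subtractf)
      also have "\<dots> \<le> 2 * norm z"
        using abs_le_norm_bcontfun[of z t] abs_le_norm_bcontfun[of z u] by linarith
      finally show "(s - r) / 2 \<le> v" unfolding v z_def by simp
    qed
    moreover have "Inf ?A = 0"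
      using tame \<open>strict_mono n\<close> unfolding tame_def by blast
    ultimately show ?thesis using 2(1) by simp
  qed
qed

end

section \<open>Riesz representation on compact metric spaces\<close>

definition nonneg_cont :: "('a::metric_space \<Rightarrow> real) set" where
  "nonneg_cont = {f. continuous_on UNIV f \<and> (\<forall>x. 0 \<le> f x)}"

text \<open>For open G a continuous function that is positive exactly on G. The case
  \<open>UNIV\<close> is set apart because \<open>infdist\<close> to the empty set is 0.\<close>

definition codist :: "'a::metric_space set \<Rightarrow> 'a \<Rightarrow> real" where
  "codist G x = (if G = UNIV then 1 else infdist x (- G))"

lemma codist_nonneg_cont: "codist G \<in> nonneg_cont"
  unfolding nonneg_cont_def codist_def
  by (cases "G = UNIV") (auto intro!: continuous_on_infdist continuous_on_id simp: infdist_nonneg)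

lemma codist_pos: "open G \<Longrightarrow> x \<in> G \<Longrightarrow> 0 < codist G x"
  unfolding codist_def
  using in_closed_iff_infdist_zero[of "- G" x] infdist_nonneg[of x "- G"]
  by (auto simp: closed_Compl less_le)

lemma codist_outside: "x \<notin> G \<Longrightarrow> codist G x = 0"
  unfolding codist_def by auto

text \<open>Confining the laws to the cone of nonnegative continuous functions makes both a state
  and the total variation of a functional, a supremum defined for nonnegative arguments, instances
  of one construction.\<close>

locale positive_functional =
  fixes \<Lambda> :: "('a::metric_space \<Rightarrow> real) \<Rightarrow> real"
  assumes compact_UNIV: "compact (UNIV :: 'a set)"
    and nonneg: "f \<in> nonneg_cont \<Longrightarrow> 0 \<le> \<Lambda> f"
    and add: "f \<in> nonneg_cont \<Longrightarrow> g \<in> nonneg_cont \<Longrightarrow> \<Lambda> (\<lambda>x. f x + g x) = \<Lambda> f + \<Lambda> g"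
    and scale: "f \<in> nonneg_cont \<Longrightarrow> 0 \<le> c \<Longrightarrow> \<Lambda> (\<lambda>x. c * f x) = c * \<Lambda> f"
begin

lemma mono:
  assumes "f \<in> nonneg_cont" "g \<in> nonneg_cont" "\<And>x. f x \<le> g x"
  shows "\<Lambda> f \<le> \<Lambda> g"
proof -
  have d: "(\<lambda>x. g x - f x) \<in> nonneg_cont"
    using assms unfolding nonneg_cont_def by (auto intro: continuous_on_diff)
  have "\<Lambda> g = \<Lambda> (\<lambda>x. f x + (g x - f x))" by simp
  also have "\<dots> = \<Lambda> f + \<Lambda> (\<lambda>x. g x - f x)" by (rule add[OF assms(1) d])
  finally show ?thesis using nonneg[OF d] by simp
qed

lemma const_nonneg_cont: "0 \<le> c \<Longrightarrow> (\<lambda>x. c) \<in> nonneg_cont"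
  by (simp add: nonneg_cont_def)

lemma const: "0 \<le> c \<Longrightarrow> \<Lambda> (\<lambda>x. c) = c * \<Lambda> (\<lambda>x. 1)"
  using scale[of "\<lambda>x. 1" c] const_nonneg_cont[of 1] by simp

lemma zero: "\<Lambda> (\<lambda>x. 0) = 0"
  using const[of 0] by simp

lemma sum:
  assumes "finite I" "\<And>i. i \<in> I \<Longrightarrow> f i \<in> nonneg_cont"
  shows "(\<lambda>x. \<Sum>i\<in>I. f i x) \<in> nonneg_cont \<and> \<Lambda> (\<lambda>x. \<Sum>i\<in>I. f i x) = (\<Sum>i\<in>I. \<Lambda> (f i))"
  using assms
proof (induction I rule: finite_induct)
  case empty
  then show ?case by (simp add: zero const_nonneg_cont)
next
  case (insert i I)
  then have IH: "(\<lambda>x. \<Sum>i\<in>I. f i x) \<in> nonneg_cont" "\<Lambda> (\<lambda>x. \<Sum>i\<in>I. f i x) = (\<Sum>i\<in>I. \<Lambda> (f i))"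
    and i: "f i \<in> nonneg_cont" by auto
  have "(\<lambda>x. f i x + (\<Sum>i\<in>I. f i x)) \<in> nonneg_cont"
    using IH(1) i unfolding nonneg_cont_def by (auto intro: continuous_on_add)
  then show ?case using insert.hyps add[OF i IH(1)] IH(2) by simp
qed

text \<open>The test functions vanish outside G but may have support reaching its boundary. Hence
  the estimates below first cut off at a small height \<delta>: where f is at least \<delta>, the
  point ranges over a compact subset of G.\<close>

definition open_mass :: "'a set \<Rightarrow> ennreal" where
  "open_mass G = (SUP f\<in>{f \<in> nonneg_cont. \<forall>x. f x \<le> indicator G x}. ennreal (\<Lambda> f))"

definition outer_mass :: "'a set \<Rightarrow> ennreal" where
  "outer_mass A = (INF G\<in>{G. open G \<and> A \<subseteq> G}. open_mass G)"

lemma open_mass_upper: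
  "f \<in> nonneg_cont \<Longrightarrow> (\<And>x. f x \<le> indicator G x) \<Longrightarrow> ennreal (\<Lambda> f) \<le> open_mass G"
  unfolding open_mass_def by (rule SUP_upper) auto

lemma open_mass_least:
  "(\<And>f. f \<in> nonneg_cont \<Longrightarrow> (\<And>x. f x \<le> indicator G x) \<Longrightarrow> ennreal (\<Lambda> f) \<le> c) \<Longrightarrow> open_mass G \<le> c"
  unfolding open_mass_def by (rule SUP_least) auto

lemma open_mass_mono: "G \<subseteq> H \<Longrightarrow> open_mass G \<le> open_mass H"
proof (rule open_mass_least, rule open_mass_upper)
  fix f :: "'a \<Rightarrow> real" and x
  assume "G \<subseteq> H" and le: "\<And>x. f x \<le> indicator G x"
  then have "indicator G x \<le> (indicator H x :: real)" by (auto simp: indicator_def of_bool_def)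
  with le show "f x \<le> indicator H x" by (rule order_trans)
qed

lemma outer_mass_open: "open G \<Longrightarrow> outer_mass G = open_mass G"
  unfolding outer_mass_def by (rule antisym) (auto intro!: INF_lower INF_greatest open_mass_mono)

lemma outer_mass_mono: "A \<subseteq> B \<Longrightarrow> outer_mass A \<le> outer_mass B"
  unfolding outer_mass_def by (rule INF_superset_mono) auto

lemma open_mass_UNIV: "open_mass UNIV = ennreal (\<Lambda> (\<lambda>x. 1))"
  by (rule antisym, rule open_mass_least, rule ennreal_leI, rule mono)
     (auto intro: open_mass_upper simp: const_nonneg_cont)

lemma outer_mass_finite: "outer_mass A < \<top>"
proof -
  have "outer_mass A \<le> open_mass UNIV" using outer_mass_mono[of A UNIV]
    by (simp add: outer_mass_open)
  then show ?thesis by (simp add: open_mass_UNIV le_less_trans)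
qed

lemma outer_mass_empty: "outer_mass {} = 0"
proof -
  have "open_mass {} \<le> 0"
  proof (rule open_mass_least)
    fix f :: "'a \<Rightarrow> real" assume f: "f \<in> nonneg_cont" "\<And>x. f x \<le> indicator {} x"
    then have "f = (\<lambda>x. 0)" unfolding nonneg_cont_def by (auto intro!: ext antisym)
    then show "ennreal (\<Lambda> f) \<le> 0" using zero by simp
  qed
  then show ?thesis by (simp add: outer_mass_open)
qed

text \<open>Up to an error \<delta>, f lives on the compact set K where it is at least \<delta>, and
  finitely many \<open>G i\<close> cover K. Functions \<open>g i\<close> below f, each vanishing
  outside its own \<open>G i\<close>, take the place of a partition of unity.\<close>

lemma open_mass_UN_le:
  fixes G :: "nat \<Rightarrow> 'a set"
  assumes G: "\<And>i. open (G i)"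
  shows "open_mass (\<Union>i. G i) \<le> (\<Sum>i. open_mass (G i))"
proof (rule open_mass_least)
  fix f :: "'a \<Rightarrow> real" assume f: "f \<in> nonneg_cont" and le: "\<And>x. f x \<le> indicator (\<Union>i. G i) x"
  have fc: "continuous_on UNIV f" and f0: "\<And>x. 0 \<le> f x" using f unfolding nonneg_cont_def by auto
  have f1: "f x \<le> 1" for x by (rule order_trans[OF le indicator_le_1])
  show "ennreal (\<Lambda> f) \<le> (\<Sum>i. open_mass (G i))"
  proof (rule ennreal_le_epsilon)
    fix e :: real assume e: "0 < e"
    define L where "L = \<Lambda> (\<lambda>x. 1)"
    have L: "0 \<le> L" unfolding L_def by (rule nonneg) (simp add: const_nonneg_cont)
    \<comment> \<open>The summand 1 guards against L = 0; the constant \<delta> contributes at most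
      e to the value of the functional.\<close>
    define \<delta> where "\<delta> = e / (L + 1)"
    have \<delta>: "0 < \<delta>" "\<delta> * L \<le> e" using e L unfolding \<delta>_def by (auto simp: field_simps)
    define K where "K = {x. \<delta> \<le> f x}"
    have "closed K" unfolding K_def using fc by (intro closed_Collect_le) auto
    then have cK: "compact K" using compact_UNIV by (metis compact_Int_closed inf_top_left)
    have "K \<subseteq> (\<Union>i\<in>UNIV. G i)"
    proof
      fix x assume "x \<in> K"
      then have "0 < f x" using \<delta> unfolding K_def by simp
      then show "x \<in> (\<Union>i\<in>UNIV. G i)"
        using le[of x] by (auto simp: indicator_def of_bool_def split: if_splits)
    qed
    then obtain I where I: "finite I" "K \<subseteq> (\<Union>i\<in>I. G i)"
      using compactE_image[OF cK, of UNIV G] G by auto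
    define s where "s x = (\<Sum>i\<in>I. codist (G i) x)" for x
    have sc: "s \<in> nonneg_cont" unfolding s_def using sum[OF I(1) codist_nonneg_cont] by auto
    have spos: "0 < s x" if xK: "x \<in> K" for x
    proof -
      obtain i where i: "i \<in> I" "x \<in> G i" using xK I by blast
      have "0 < codist (G i) x" using codist_pos[OF G i(2)] .
      also have "\<dots> \<le> s x" unfolding s_def
        using I(1) i(1) codist_nonneg_cont by (intro member_le_sum) (auto simp: nonneg_cont_def)
      finally show ?thesis .
    qed
    obtain c where c: "0 \<le> c" "\<And>x. x \<in> K \<Longrightarrow> 1 \<le> c * s x"
    proof (cases "K = {}")
      case True
      then show ?thesis using that[of 0] by auto
    next
      case False
      have "continuous_on K s" using sc unfolding nonneg_cont_def
        by (auto intro: continuous_on_subset)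
      then obtain z where z: "z \<in> K" "\<And>y. y \<in> K \<Longrightarrow> s z \<le> s y"
        using continuous_attains_inf[OF cK False] by blast
      have "1 \<le> (1 / s z) * s x" if "x \<in> K" for x
        using z(2)[OF that] spos[OF z(1)] by (simp add: field_simps)
      then show ?thesis using that[of "1 / s z"] spos[OF z(1)] by simp
    qed
    \<comment> \<open>By the choice of c, \<open>c * s x\<close> is at least 1 on K. There either
      one of the minima is f itself, or all of them are the multiples of \<open>codist\<close>, with
      sum at least 1 and hence at least f.\<close>
    define g where "g i x = min (f x) (c * codist (G i) x)" for i x
    have gc: "g i \<in> nonneg_cont" for i
      unfolding g_def using fc f0 c(1) codist_nonneg_cont[of "G i"] unfolding nonneg_cont_def
      by (auto intro!: continuous_on_min continuous_on_mult continuous_on_const)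
    have sumg: "(\<lambda>x. \<Sum>i\<in>I. g i x) \<in> nonneg_cont" "\<Lambda> (\<lambda>x. \<Sum>i\<in>I. g i x) = (\<Sum>i\<in>I. \<Lambda> (g i))"
      using sum[OF I(1), of g] gc by auto
    have bound: "f x \<le> \<delta> + (\<Sum>i\<in>I. g i x)" for x
    proof (cases "x \<in> K")
      case True
      have g0: "0 \<le> g i x" for i using gc[of i] unfolding nonneg_cont_def by auto
      show ?thesis
      proof (cases "\<exists>i\<in>I. g i x = f x")
        case True
        then obtain i where "i \<in> I" "g i x = f x" by blast
        then have "f x \<le> (\<Sum>i\<in>I. g i x)"
          using member_le_sum[of i I "\<lambda>i. g i x"] g0 I(1) by auto
        then show ?thesis using \<delta> by simp
      next
        case False
        then have "g i x = c * codist (G i) x" if "i \<in> I" for i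
          using that unfolding g_def by (auto simp: min_def)
        then have "(\<Sum>i\<in>I. g i x) = c * s x"
          unfolding s_def sum_distrib_left by (intro sum.cong) auto
        then show ?thesis using c(2)[OF True] f1[of x] \<delta> by simp
      qed
    next
      case False
      have "0 \<le> (\<Sum>i\<in>I. g i x)" using sumg(1) unfolding nonneg_cont_def by auto
      then show ?thesis using False unfolding K_def by simp
    qed
    have "\<Lambda> f \<le> \<Lambda> (\<lambda>x. \<delta> + (\<Sum>i\<in>I. g i x))"
      using bound sumg(1) \<delta> by (intro mono f)
          (auto simp: nonneg_cont_def intro!: continuous_on_add add_nonneg_nonneg)
    also have "\<dots> = \<delta> * L + (\<Sum>i\<in>I. \<Lambda> (g i))"
      using add[OF const_nonneg_cont sumg(1), of \<delta>] const[of \<delta>] \<delta> sumg(2) unfolding L_def by simp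
    also have "\<dots> \<le> (\<Sum>i\<in>I. \<Lambda> (g i)) + e" using \<delta> by simp
    finally have "ennreal (\<Lambda> f) \<le> ennreal ((\<Sum>i\<in>I. \<Lambda> (g i)) + e)" by (rule ennreal_leI)
    also have "\<dots> = (\<Sum>i\<in>I. ennreal (\<Lambda> (g i))) + ennreal e"
      using e nonneg[OF gc] by (simp add: ennreal_plus sum_nonneg sum_ennreal)
    also have "(\<Sum>i\<in>I. ennreal (\<Lambda> (g i))) \<le> (\<Sum>i\<in>I. open_mass (G i))"
    proof (intro sum_mono open_mass_upper gc)
      fix i x
      show "g i x \<le> indicator (G i) x"
        using f1[of x] f0[of x] codist_outside[of x "G i"] unfolding g_def
        by (cases "x \<in> G i") (auto simp: min_def)
    qed
    also have "(\<Sum>i\<in>I. open_mass (G i)) \<le> (\<Sum>i. open_mass (G i))"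
      using I(1) by (intro sum_le_suminf) auto
    finally show "ennreal (\<Lambda> f) \<le> (\<Sum>i. open_mass (G i)) + ennreal e"
      by (simp add: add_mono)
  qed
qed

lemma outer_mass_UN_le:
  fixes A :: "nat \<Rightarrow> 'a set"
  shows "outer_mass (\<Union>i. A i) \<le> (\<Sum>i. outer_mass (A i))"
proof (rule ennreal_le_epsilon)
  fix e :: real assume e: "0 < e"
  have "\<exists>G. open G \<and> A i \<subseteq> G \<and> open_mass G < outer_mass (A i) + ennreal (e * (1/2)^Suc i)" for i
  proof -
    have "0 < e * (1/2)^Suc i" "outer_mass (A i) \<noteq> \<infinity>"
      using e outer_mass_finite[of "A i"] by auto
    from INF_approx_ennreal[OF this(1) outer_mass_def this(2)] show ?thesis by blast
  qed
  then obtain G where G: "\<And>i. open (G i)" "\<And>i. A i \<subseteq> G i"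
    "\<And>i. open_mass (G i) < outer_mass (A i) + ennreal (e * (1/2)^Suc i)" by metis
  have "outer_mass (\<Union>i. A i) \<le> outer_mass (\<Union>i. G i)" using G(2) by (intro outer_mass_mono) blast
  also have "\<dots> = open_mass (\<Union>i. G i)" using G(1) by (intro outer_mass_open) auto
  also have "\<dots> \<le> (\<Sum>i. open_mass (G i))" by (rule open_mass_UN_le[OF G(1)])
  also have "\<dots> \<le> (\<Sum>i. outer_mass (A i) + ennreal (e * (1/2)^Suc i))"
    using G(3) by (intro suminf_le less_imp_le) auto
  also have "\<dots> = (\<Sum>i. outer_mass (A i)) + (\<Sum>i. ennreal (e * (1/2)^Suc i))"
    by (rule suminf_add[symmetric]) auto
  also have "(\<Sum>i. ennreal (e * (1/2)^Suc i)) = ennreal e"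
  proof (rule suminf_ennreal_eq)
    show "(\<lambda>i. e * (1/2)^Suc i) sums e" using sums_mult[OF power_half_series, of e] by simp
  qed (use e in auto)
  finally show "outer_mass (\<Union>i. A i) \<le> (\<Sum>i. outer_mass (A i)) + ennreal e" .
qed

lemma outer_measure_space_outer_mass: "outer_measure_space (Pow UNIV) outer_mass"
  unfolding outer_measure_space_def positive_def increasing_def countably_subadditive_def
  using outer_mass_empty outer_mass_mono outer_mass_UN_le by auto

lemma outer_mass_Un_le: "outer_mass (A \<union> B) \<le> outer_mass A + outer_mass B"
proof -
  have "(\<Union>i. binaryset A B i) = A \<union> B" by (rule UN_binaryset_eq)
  moreover have "(\<Sum>i. outer_mass (binaryset A B i)) = outer_mass A + outer_mass B"
    using suminf_binaryset_eq[of outer_mass A B] outer_mass_empty by simp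
  ultimately show ?thesis using outer_mass_UN_le[of "binaryset A B"] by simp
qed

text \<open>Caratheodory measurability of open sets. For f below the indicator of H \<inter> G, the
  set where f < \<delta> inside H is an open neighbourhood of A - G, and a function g living there
  has no overlap with the part of f above \<delta>. So f and g fit together into H up to an error
  \<open>\<delta> * L\<close>.\<close>

lemma open_splits:
  assumes G: "open G"
  shows "outer_mass (A \<inter> G) + outer_mass (A - G) \<le> outer_mass A"
proof -
  have main: "outer_mass (A \<inter> G) + outer_mass (A - G) \<le> open_mass H" if H: "open H" "A \<subseteq> H" for H
  proof (rule ennreal_le_epsilon)
    fix e :: real assume e: "0 < e"
    define L where "L = \<Lambda> (\<lambda>x. 1)"
    have L: "0 \<le> L" unfolding L_def by (rule nonneg) (simp add: const_nonneg_cont)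
    define \<delta> where "\<delta> = e / (L + 1)"
    have \<delta>: "0 < \<delta>" "\<delta> * L \<le> e" using e L unfolding \<delta>_def by (auto simp: field_simps)
    have "open_mass (H \<inter> G) + outer_mass (A - G) \<le> open_mass H + ennreal e"
      unfolding open_mass_def[of "H \<inter> G"]
    proof (subst ennreal_SUP_add_left[symmetric])
      show "{f \<in> nonneg_cont. \<forall>x. f x \<le> indicator (H \<inter> G) x} \<noteq> {}"
        using const_nonneg_cont[of 0] by force
      show "(SUP f\<in>{f \<in> nonneg_cont. \<forall>x. f x \<le> indicator (H \<inter> G) x}. ennreal (\<Lambda> f)
          + outer_mass (A - G))
          \<le> open_mass H + ennreal e"
      proof (rule SUP_least)
        fix f :: "'a \<Rightarrow> real" assume "f \<in> {f \<in> nonneg_cont. \<forall>x. f x \<le> indicator (H \<inter> G) x}"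
        then have f: "f \<in> nonneg_cont" "\<And>x. f x \<le> indicator (H \<inter> G) x" by auto
        then have fc: "continuous_on UNIV f" and f0: "\<And>x. 0 \<le> f x" unfolding nonneg_cont_def by auto
        define W where "W = H \<inter> {x. f x < \<delta>}"
        have W: "open W" unfolding W_def using H(1) fc by (intro open_Int open_Collect_less) auto
        have "A - G \<subseteq> W"
        proof
          fix x assume x: "x \<in> A - G"
          then have "f x \<le> 0" using f(2)[of x] by simp
          then show "x \<in> W" using x H(2) \<delta> unfolding W_def by auto
        qed
        then have "outer_mass (A - G) \<le> open_mass W"
          using outer_mass_mono outer_mass_open[OF W] by metis
        then have "ennreal (\<Lambda> f) + outer_mass (A - G) \<le> ennreal (\<Lambda> f) + open_mass W"
          by (rule add_left_mono)
        also have "\<dots> \<le> open_mass H + ennreal e"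
          unfolding open_mass_def[of W]
        proof (subst ennreal_SUP_add_right)
          show "{f \<in> nonneg_cont. \<forall>x. f x \<le> indicator W x} \<noteq> {}"
            using const_nonneg_cont[of 0] by force
          show "(SUP g\<in>{f \<in> nonneg_cont. \<forall>x. f x \<le> indicator W x}. ennreal (\<Lambda> f) + ennreal (\<Lambda> g))
              \<le> open_mass H + ennreal e"
          proof (rule SUP_least)
            fix g :: "'a \<Rightarrow> real" assume "g \<in> {f \<in> nonneg_cont. \<forall>x. f x \<le> indicator W x}"
            then have g: "g \<in> nonneg_cont" "\<And>x. g x \<le> indicator W x" by auto
            define f' where "f' x = max 0 (f x - \<delta>)" for x
            have f': "f' \<in> nonneg_cont" unfolding f'_def nonneg_cont_def using fc
              by (auto intro!: continuous_on_max continuous_on_diff continuous_on_const)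
            have fg: "(\<lambda>x. f' x + g x) \<in> nonneg_cont"
              using f' g(1) unfolding nonneg_cont_def by (auto intro: continuous_on_add)
            have le: "f' x + g x \<le> indicator H x" for x
              using f(2)[of x] g(2)[of x] g(1) \<delta> unfolding f'_def W_def nonneg_cont_def
              by (auto simp: indicator_def of_bool_def split: if_splits)
            have "\<Lambda> f \<le> \<Lambda> (\<lambda>x. \<delta> + f' x)"
              using f' \<delta> f(1) by (intro mono)
                  (auto simp: nonneg_cont_def f'_def intro!: continuous_on_add)
            also have "\<dots> = \<delta> * L + \<Lambda> f'"
              using add[OF const_nonneg_cont f', of \<delta>] const[of \<delta>] \<delta> unfolding L_def by simp
            finally have "\<Lambda> f + \<Lambda> g \<le> \<Lambda> (\<lambda>x. f' x + g x) + e"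
              using add[OF f' g(1)] \<delta> by simp
            then have "ennreal (\<Lambda> f + \<Lambda> g) \<le> ennreal (\<Lambda> (\<lambda>x. f' x + g x) + e)" by (rule ennreal_leI)
            then have "ennreal (\<Lambda> f) + ennreal (\<Lambda> g) \<le> ennreal (\<Lambda> (\<lambda>x. f' x + g x)) + ennreal e"
              using nonneg[OF f(1)] nonneg[OF g(1)] nonneg[OF fg] e by (simp add: ennreal_plus)
            also have "\<dots> \<le> open_mass H + ennreal e"
              by (intro add_right_mono open_mass_upper fg le)
            finally show "ennreal (\<Lambda> f) + ennreal (\<Lambda> g) \<le> open_mass H + ennreal e" .
          qed
        qed
        finally show "ennreal (\<Lambda> f) + outer_mass (A - G) \<le> open_mass H + ennreal e" .
      qed
    qed
    moreover have "outer_mass (A \<inter> G) \<le> open_mass (H \<inter> G)"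
      by (metis H G open_Int inf_mono order_refl outer_mass_mono outer_mass_open)
    ultimately show "outer_mass (A \<inter> G) + outer_mass (A - G) \<le> open_mass H + ennreal e"
      by (meson add_right_mono order_trans)
  qed
  have "outer_mass (A \<inter> G) + outer_mass (A - G) \<le> (INF H\<in>{H. open H \<and> A \<subseteq> H}. open_mass H)"
    using main by (intro INF_greatest) auto
  then show ?thesis unfolding outer_mass_def[of A] .
qed

definition riesz_measure :: "'a measure" where
  "riesz_measure = measure_of UNIV (sets borel) outer_mass"

lemma sets_riesz_measure [simp, measurable_cong]: "sets riesz_measure = sets borel"
  unfolding riesz_measure_def by (metis sets.sigma_sets_eq sets_measure_of space_borel
      top_greatest Pow_UNIV)

lemma space_riesz_measure [simp]: "space riesz_measure = UNIV"
  using sets_eq_imp_space_eq[OF sets_riesz_measure] by simp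

lemma emeasure_riesz_measure:
  assumes A: "A \<in> sets borel"
  shows "emeasure riesz_measure A = outer_mass A"
proof -
  interpret P: sigma_algebra UNIV "Pow (UNIV :: 'a set)" by (rule sigma_algebra_Pow)
  let ?L = "lambda_system UNIV (Pow UNIV) outer_mass"
  have ms: "measure_space UNIV ?L outer_mass"
    by (rule P.caratheodory_lemma[OF outer_measure_space_outer_mass])
  have opn: "{G. open G} \<subseteq> ?L"
  proof
    fix G :: "'a set" assume "G \<in> {G. open G}"
    then have "outer_mass (A \<inter> G) + outer_mass (A - G) = outer_mass A" for A
      using open_splits[of G A] outer_mass_Un_le[of "A \<inter> G" "A - G"]
      by (auto intro!: antisym simp: Int_Diff_Un)
    then show "G \<in> ?L" unfolding P.lambda_system_eq by auto
  qed
  interpret L: sigma_algebra UNIV ?L using ms unfolding measure_space_def by simp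
  have "sets borel \<subseteq> ?L"
    unfolding borel_def using L.sigma_sets_subset[OF opn] by (simp add: sets_measure_of)
  moreover have "countably_additive ?L outer_mass" using ms unfolding measure_space_def by blast
  ultimately have "countably_additive (sets borel) outer_mass"
    unfolding countably_additive_def by (meson subset_iff order_trans)
  moreover have "positive (sets borel) outer_mass"
    unfolding positive_def by (rule outer_mass_empty)
  ultimately show ?thesis
    using A unfolding riesz_measure_def
    by (intro emeasure_measure_of_sigma) (auto simp: sets.sigma_algebra_axioms intro:
        sets.sigma_algebra_axioms[of borel, simplified])
qed

lemma finite_riesz_measure: "finite_measure riesz_measure"
  by (rule finite_measureI) (use emeasure_riesz_measure[of UNIV] outer_mass_finite[of UNIV] in auto)

lemma integrable_riesz_measure:
  assumes f: "continuous_on UNIV f"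
  shows "integrable riesz_measure (f :: 'a \<Rightarrow> real)"
proof -
  interpret finite_measure riesz_measure by (rule finite_riesz_measure)
  have "bounded (range f)" using compact_continuous_image[OF f compact_UNIV]
    by (rule compact_imp_bounded)
  then obtain B where "\<And>x. norm (f x) \<le> B" unfolding bounded_iff by auto
  moreover have "f \<in> borel_measurable riesz_measure"
    using borel_measurable_continuous_onI[OF f] measurable_cong_sets[OF sets_riesz_measure refl]
      by blast
  ultimately show ?thesis by (intro integrable_const_bound[where B = B]) auto
qed

text \<open>Layer cake: n * f is cut into n slices of height 1. Slice i is a test function for the
  open set where n * f exceeds i, and the indicators of these sets add up to at most n * f + 1.
  Division by n leaves the error L / n.\<close>

lemma integral_ge_aux:
  assumes f: "f \<in> nonneg_cont" and f1: "\<And>x. f x \<le> 1"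
  shows "\<Lambda> f \<le> (\<integral>x. f x \<partial>riesz_measure)"
proof (rule field_le_epsilon)
  interpret finite_measure riesz_measure by (rule finite_riesz_measure)
  have fc: "continuous_on UNIV f" and f0: "\<And>x. 0 \<le> f x" using f unfolding nonneg_cont_def by auto
  define L where "L = \<Lambda> (\<lambda>x. 1)"
  have L: "0 \<le> L" unfolding L_def by (rule nonneg) (simp add: const_nonneg_cont)
  have mass: "measure riesz_measure UNIV = L"
    using emeasure_riesz_measure[of UNIV] open_mass_UNIV L
    unfolding L_def by (simp add: outer_mass_open measure_def)
  fix e :: real assume e: "0 < e"
  obtain n :: nat where n: "L / e < n" using reals_Archimedean2 by blast
  have n0: "0 < n" using n e L by (metis divide_nonneg_pos gr0I not_le of_nat_0)
  define g where "g i x = min (max 0 (n * f x - real i)) 1" for i x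
  have gc: "g i \<in> nonneg_cont" for i unfolding g_def nonneg_cont_def using fc
    by (auto intro!: continuous_intros)
  have layers: "(\<Sum>i<k. min (max 0 (t - real i)) 1) = min (max 0 t) (real k)" for k and t :: real
    by (induction k) (auto simp: min_def max_def)
  have sumg: "(\<Sum>i<n. g i x) = n * f x" for x
    unfolding g_def layers using f0[of x] f1[of x] n0 by (simp add: min_def mult_left_le)
  define U where "U i = {x. real i < n * f x}" for i
  have U: "open (U i)" for i unfolding U_def using fc
    by (intro open_Collect_less continuous_intros) auto
  have le: "\<Lambda> (g i) \<le> measure riesz_measure (U i)" for i
  proof -
    have "ennreal (\<Lambda> (g i)) \<le> open_mass (U i)"
      by (rule open_mass_upper[OF gc]) (auto simp: g_def U_def indicator_def)
    also have "\<dots> = emeasure riesz_measure (U i)"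
      using U[of i] by (simp add: emeasure_riesz_measure outer_mass_open)
    also have "\<dots> = ennreal (measure riesz_measure (U i))" by (simp add: emeasure_eq_measure)
    finally show ?thesis by simp
  qed
  have Ui: "integrable riesz_measure (indicator (U i) :: 'a \<Rightarrow> real)" for i
    using U[of i] by (intro integrable_real_indicator) (auto simp: emeasure_eq_measure)
  have "n * \<Lambda> f = \<Lambda> (\<lambda>x. \<Sum>i<n. g i x)" using scale[OF f, of "real n"] by (simp add: sumg)
  also have "\<dots> = (\<Sum>i<n. \<Lambda> (g i))" using sum[of "{..<n}" g] gc by simp
  also have "\<dots> \<le> (\<Sum>i<n. measure riesz_measure (U i))" by (rule sum_mono) (rule le)
  also have "\<dots> = (\<integral>x. (\<Sum>i<n. indicator (U i) x) \<partial>riesz_measure)"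
    using Ui by (subst Bochner_Integration.integral_sum) auto
  also have "\<dots> \<le> (\<integral>x. n * f x + 1 \<partial>riesz_measure)"
  proof (rule integral_mono)
    show "integrable riesz_measure (\<lambda>x. \<Sum>i<n. indicator (U i) x :: real)" using Ui by auto
    show "integrable riesz_measure (\<lambda>x. n * f x + 1)" using integrable_riesz_measure[OF fc] by auto
    fix x
    \<comment> \<open>The bound by \<open>real k\<close> is carried along for the induction: if x is
      in \<open>U k\<close>, then k < n * f x, so the new count, at most k + 1, is below n * f x +
      1.\<close>
    have "(\<Sum>i<k. indicator (U i) x) \<le> real k \<and> (\<Sum>i<k. indicator (U i) x) \<le> n * f x + 1" for k
    proof (induction k)
      case 0
      then show ?case using f0[of x] by (simp add: add_nonneg_nonneg)
    next
      case (Suc k)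
      then show ?case by (cases "x \<in> U k") (auto simp: U_def)
    qed
    then show "(\<Sum>i<n. indicator (U i) x) \<le> n * f x + 1" by blast
  qed
  also have "\<dots> = n * (\<integral>x. f x \<partial>riesz_measure) + L"
    using integrable_riesz_measure[OF fc] mass by simp
  finally have "\<Lambda> f \<le> (\<integral>x. f x \<partial>riesz_measure) + L / n"
    using n0 by (simp add: field_simps)
  also have "L / n \<le> e" using n n0 e by (simp add: field_simps)
  finally show "\<Lambda> f \<le> (\<integral>x. f x \<partial>riesz_measure) + e" by simp
qed

text \<open>The one-sided estimate is applied to g and to 1 - g. Both sides then add up to the total
  mass, so neither inequality can be strict.\<close>

theorem integral_riesz_measure:
  assumes f: "f \<in> nonneg_cont"
  shows "(\<integral>x. f x \<partial>riesz_measure) = \<Lambda> f"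
proof -
  interpret finite_measure riesz_measure by (rule finite_riesz_measure)
  have fc: "continuous_on UNIV f" and f0: "\<And>x. 0 \<le> f x" using f unfolding nonneg_cont_def by auto
  have "bounded (range f)" using compact_continuous_image[OF fc compact_UNIV]
    by (rule compact_imp_bounded)
  then obtain B where B: "0 < B" "\<And>x. norm (f x) \<le> B" unfolding bounded_pos by auto
  define g where "g x = (1 / B) * f x" for x
  have g1: "g x \<le> 1" for x using B(2)[of x] B(1) by (simp add: g_def field_simps)
  have gc: "g \<in> nonneg_cont" using f B(1) unfolding g_def nonneg_cont_def
    by (auto intro!: continuous_intros)
  have hc: "(\<lambda>x. 1 - g x) \<in> nonneg_cont" using gc g1 unfolding nonneg_cont_def
    by (auto intro!: continuous_intros)
  have gi: "integrable riesz_measure g" using gc integrable_riesz_measure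
    unfolding nonneg_cont_def by auto
  have "0 \<le> \<Lambda> (\<lambda>x. 1)" by (rule nonneg) (simp add: const_nonneg_cont)
  then have mass: "measure riesz_measure UNIV = \<Lambda> (\<lambda>x. 1)"
    using emeasure_riesz_measure[of UNIV] open_mass_UNIV by (simp add: outer_mass_open measure_def)
  have "\<Lambda> (\<lambda>x. 1) = \<Lambda> g + \<Lambda> (\<lambda>x. 1 - g x)" using add[OF gc hc] by simp
  moreover have "\<Lambda> (\<lambda>x. 1 - g x) \<le> (\<integral>x. 1 - g x \<partial>riesz_measure)"
    using gc by (intro integral_ge_aux hc) (auto simp: nonneg_cont_def)
  moreover have "(\<integral>x. 1 - g x \<partial>riesz_measure) = \<Lambda> (\<lambda>x. 1) - (\<integral>x. g x \<partial>riesz_measure)"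
    using gi mass by simp
  moreover have "\<Lambda> g \<le> (\<integral>x. g x \<partial>riesz_measure)" by (rule integral_ge_aux[OF gc g1])
  ultimately have "(\<integral>x. g x \<partial>riesz_measure) = \<Lambda> g" by linarith
  moreover have "\<Lambda> g = (1 / B) * \<Lambda> f" unfolding g_def using B(1) by (intro scale f) simp
  ultimately show ?thesis using B(1) unfolding g_def by simp
qed

end

section \<open>States and the dual of the space of continuous functions\<close>

lemma finite_measure_integrable_continuous:
  fixes f :: "'a::metric_space \<Rightarrow> real"
  assumes "finite_measure M" and [measurable_cong]: "sets M = sets borel"
    and f: "continuous_on UNIV f" and b: "\<And>x. \<bar>f x\<bar> \<le> B"
  shows "integrable M f"
proof -
  interpret finite_measure M by fact
  have "f \<in> borel_measurable M"
    using borel_measurable_continuous_onI[OF f] measurable_cong_sets[OF assms(2) refl] by blast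
  then show ?thesis by (intro integrable_const_bound[where B = B]) (auto simp: b)
qed

text \<open>The functions min 1 (n * codist G) converge pointwise to the indicator of the open set
  G, so the integrals determine the masses of open sets, an intersection-stable generator.\<close>

lemma measure_eq_continuousI:
  fixes M N :: "'a::metric_space measure"
  assumes fin: "finite_measure M" "finite_measure N"
    and sets: "sets M = sets borel" "sets N = sets borel"
    and eq: "\<And>f :: 'a \<Rightarrow> real. continuous_on UNIV f \<Longrightarrow> (\<And>x. 0 \<le> f x) \<Longrightarrow> (\<And>x. f x \<le> 1) \<Longrightarrow>
       (\<integral>x. f x \<partial>M) = (\<integral>x. f x \<partial>N)"
  shows "M = N"
proof (rule measure_eqI_generator_eq[where E = "{G. open G}" and \<Omega> = UNIV and A = "\<lambda>_. UNIV"])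
  show "Int_stable {G :: 'a set. open G}" by (auto simp: Int_stable_def)
  show "sets M = sigma_sets UNIV {G. open G}" "sets N = sigma_sets UNIV {G. open G}"
    unfolding sets borel_def by (simp_all add: sets_measure_of)
  show "emeasure M UNIV \<noteq> \<infinity>" for i :: nat
    using fin(1) by (simp add: finite_measure.emeasure_finite)
  fix G :: "'a set" assume "G \<in> {G. open G}"
  then have G: "open G" by simp
  define u where "u n x = min 1 (real n * codist G x)" for n x
  have cont: "continuous_on UNIV (u n)" and u0: "0 \<le> u n x" and u1: "u n x \<le> 1" for n x
    using codist_nonneg_cont[of G] unfolding u_def nonneg_cont_def
    by (auto intro!: continuous_intros)
  have lim: "(\<lambda>n. u n x) \<longlonglongrightarrow> indicator G x" for x
  proof (cases "x \<in> G")
    case True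
    have pos: "0 < codist G x" using codist_pos[OF G True] .
    obtain n0 :: nat where n0: "1 / codist G x < n0" using reals_Archimedean2 by blast
    have "u n x = 1" if "n \<ge> n0" for n
    proof -
      have "1 < n0 * codist G x" using n0 pos by (simp add: field_simps)
      also have "\<dots> \<le> n * codist G x" using that pos by (intro mult_right_mono) auto
      finally show ?thesis unfolding u_def by simp
    qed
    then have "\<forall>\<^sub>F n in sequentially. u n x = 1" unfolding eventually_sequentially by blast
    then show ?thesis using True by (simp add: tendsto_eventually)
  next
    case False
    then show ?thesis unfolding u_def by (simp add: codist_outside)
  qed
  have conv: "(\<lambda>n. \<integral>x. u n x \<partial>K) \<longlonglongrightarrow> measure K G"
    if K: "finite_measure K" "sets K = sets borel" for K :: "'a measure"
  proof -
    interpret finite_measure K by fact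
    have m: "u n \<in> borel_measurable K" for n
      using borel_measurable_continuous_onI[OF cont] measurable_cong_sets[OF K(2) refl] by blast
    have "(\<lambda>n. \<integral>x. u n x \<partial>K) \<longlonglongrightarrow> (\<integral>x. indicator G x \<partial>K)"
    proof (rule integral_dominated_convergence[where w = "\<lambda>_. 1"])
      show "(\<lambda>x. indicator G x :: real) \<in> borel_measurable K"
        using G by (intro borel_measurable_indicator) (simp add: K(2) borel_open)
      show "AE x in K. (\<lambda>n. u n x) \<longlonglongrightarrow> indicator G x" using lim by simp
      show "AE x in K. norm (u n x) \<le> 1" for n using u0 u1 by simp
    qed (use m in auto)
    moreover have "(\<integral>x. indicator G x \<partial>K) = measure K G"
      using sets_eq_imp_space_eq[OF K(2)] by simp
    ultimately show ?thesis by simp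
  qed
  have "(\<integral>x. u n x \<partial>M) = (\<integral>x. u n x \<partial>N)" for n
    by (rule eq) (rule cont u0 u1)+
  then have "(\<lambda>n. \<integral>x. u n x \<partial>M) = (\<lambda>n. \<integral>x. u n x \<partial>N)" by simp
  then have "measure M G = measure N G"
    using LIMSEQ_unique conv[OF fin(1) sets(1)] conv[OF fin(2) sets(2)] by metis
  then show "emeasure M G = emeasure N G"
    using fin by (simp add: finite_measure.emeasure_eq_measure)
qed auto

lemma apply_Bcontfun:
  fixes f :: "'a::metric_space \<Rightarrow> real"
  assumes "compact (UNIV :: 'a set)" "continuous_on UNIV f"
  shows "apply_bcontfun (Bcontfun f) = f"
proof -
  have "bounded (range f)" using compact_continuous_image[OF assms(2,1)]
    by (rule compact_imp_bounded)
  then show ?thesis using assms(2) by (simp add: Bcontfun_inverse bcontfun_def)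
qed

text \<open>By \<open>state_measure\<close> these are the Borel probability measures. As plain
  functions, with the norm bound derived from positivity, they pass easily to pointwise
  limits.\<close>

definition state :: "('a::metric_space CX \<Rightarrow> real) \<Rightarrow> bool" where
  "state L \<longleftrightarrow> linear L \<and> (\<forall>x. (\<forall>\<omega>. 0 \<le> apply_bcontfun x \<omega>) \<longrightarrow> 0 \<le> L x) \<and> L (const_bcontfun 1) = 1"

lemma state_mono:
  assumes "state L" "\<And>\<omega>. apply_bcontfun x \<omega> \<le> apply_bcontfun y \<omega>"
  shows "L x \<le> L y"
proof -
  have "0 \<le> L (y - x)" using assms unfolding state_def by auto
  moreover have "L (y - x) = L y - L x" using assms(1) linear_diff unfolding state_def by blast
  ultimately show ?thesis by simp
qed

lemma state_const: "state L \<Longrightarrow> L (const_bcontfun c) = c"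
proof -
  assume L: "state L"
  have "const_bcontfun c = c *\<^sub>R (const_bcontfun 1 :: 'a CX)" by (rule bcontfun_eqI) simp
  then show ?thesis using L linear_cmul[of L c "const_bcontfun 1"] unfolding state_def by simp
qed

lemma state_abs_le:
  assumes "state L"
  shows "\<bar>L x\<bar> \<le> norm x"
proof -
  have "apply_bcontfun x \<omega> \<le> apply_bcontfun (const_bcontfun (norm x)) \<omega>"
    "apply_bcontfun (const_bcontfun (- norm x)) \<omega> \<le> apply_bcontfun x \<omega>" for \<omega>
    using abs_le_norm_bcontfun[of x \<omega>] by auto
  then have "L x \<le> norm x" "- norm x \<le> L x"
    using state_mono[OF assms] state_const[OF assms] by metis+
  then show ?thesis by simp
qed

lemma positive_functional_measure:
  fixes L :: "('a::metric_space \<Rightarrow> real) \<Rightarrow> real"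
  assumes "positive_functional L"
  obtains M where "finite_measure M" "sets M = sets borel"
    "\<And>f. f \<in> nonneg_cont \<Longrightarrow> (\<integral>x. f x \<partial>M) = L f"
proof -
  interpret positive_functional L by fact
  show ?thesis using that[OF finite_riesz_measure sets_riesz_measure integral_riesz_measure] .
qed

lemma state_measure:
  assumes c: "compact (UNIV :: 'a::metric_space set)" and L: "state (L :: 'a CX \<Rightarrow> real)"
  obtains M where "prob_space M" "sets M = sets borel" "\<And>x. L x = (\<integral>\<omega>. apply_bcontfun x \<omega> \<partial>M)"
proof -
  have lin: "linear L" using L unfolding state_def by blast
  have "positive_functional (\<lambda>f. L (Bcontfun f))"
  proof
    fix f g :: "'a \<Rightarrow> real" assume f: "f \<in> nonneg_cont"
    then have fc: "continuous_on UNIV f" "\<And>x. 0 \<le> f x" unfolding nonneg_cont_def by auto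
    then show "0 \<le> L (Bcontfun f)" using L apply_Bcontfun[OF c fc(1)] unfolding state_def by auto
    show "L (Bcontfun (\<lambda>x. k * f x)) = k * L (Bcontfun f)" if "0 \<le> k" for k
    proof -
      have "continuous_on UNIV (\<lambda>x. k * f x)" using fc by (intro continuous_intros)
      then have "Bcontfun (\<lambda>x. k * f x) = k *\<^sub>R Bcontfun f"
        by (intro bcontfun_eqI) (simp add: apply_Bcontfun[OF c] fc)
      then show ?thesis using linear_cmul[OF lin] by simp
    qed
    assume "g \<in> nonneg_cont"
    then have gc: "continuous_on UNIV g" unfolding nonneg_cont_def by auto
    have "continuous_on UNIV (\<lambda>x. f x + g x)" using fc gc by (intro continuous_intros)
    then have "Bcontfun (\<lambda>x. f x + g x) = Bcontfun f + Bcontfun g"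
      by (intro bcontfun_eqI) (simp add: apply_Bcontfun[OF c] fc gc)
    then show "L (Bcontfun (\<lambda>x. f x + g x)) = L (Bcontfun f) + L (Bcontfun g)"
      using linear_add[OF lin] by simp
  qed (rule c)
  then obtain M where M: "finite_measure M" "sets M = sets borel"
    "\<And>f. f \<in> nonneg_cont \<Longrightarrow> (\<integral>x. f x \<partial>M) = L (Bcontfun f)"
    using positive_functional_measure by blast
  interpret finite_measure M by fact
  have sp: "space M = UNIV" using sets_eq_imp_space_eq[OF M(2)] by simp
  have one: "Bcontfun (\<lambda>_. 1) = (const_bcontfun 1 :: 'a CX)"
    by (rule bcontfun_eqI) (simp add: apply_Bcontfun[OF c])
  have mass: "measure M UNIV = 1"
    using M(3)[of "\<lambda>_. 1"] L sp one unfolding state_def by (simp add: nonneg_cont_def)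
  have "prob_space M" using mass sp by (intro prob_spaceI) (simp add: emeasure_eq_measure)
  moreover have "L x = (\<integral>\<omega>. apply_bcontfun x \<omega> \<partial>M)" for x
  proof -
    \<comment> \<open>The Riesz formula is available on nonnegative functions; adding the constant
      \<open>norm x\<close> moves x into the cone.\<close>
    define f where "f \<omega> = apply_bcontfun x \<omega> + norm x" for \<omega>
    have fc: "continuous_on UNIV f" unfolding f_def by (intro continuous_intros) simp
    have "0 \<le> f \<omega>" for \<omega> using abs_le_norm_bcontfun[of x \<omega>] unfolding f_def by linarith
    then have "(\<integral>\<omega>. f \<omega> \<partial>M) = L (Bcontfun f)" using fc M(3) unfolding nonneg_cont_def by blast
    moreover have "Bcontfun f = x + const_bcontfun (norm x)"
      by (rule bcontfun_eqI) (simp add: apply_Bcontfun[OF c fc] f_def)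
    moreover have "integrable M (apply_bcontfun x)"
      by (rule finite_measure_integrable_continuous[OF M(1,2), where B = "norm x"])
         (auto simp: abs_le_norm_bcontfun)
    then have "(\<integral>\<omega>. f \<omega> \<partial>M) = (\<integral>\<omega>. apply_bcontfun x \<omega> \<partial>M) + norm x"
      unfolding f_def using mass sp by simp
    ultimately show ?thesis
      using linear_add[OF lin, of x "const_bcontfun (norm x)"] state_const[OF L, of "norm x"]
        by simp
  qed
  ultimately show ?thesis using that M(2) by blast
qed

text \<open>M is the total variation of \<mu>, obtained as the Riesz measure of the functional that
  sends f to the supremum of \<mu> over all g with |g| \<le> f. The estimate makes \<mu> continuous
  for the L^1(M) distance.\<close>

lemma dual_dominating_measure:
  fixes \<mu> :: "'a::metric_space CXd"
  assumes c: "compact (UNIV :: 'a set)"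
  obtains M where "finite_measure M" "sets M = sets borel"
    "\<And>x. \<bar>blinfun_apply \<mu> x\<bar> \<le> (\<integral>\<omega>. \<bar>apply_bcontfun x \<omega>\<bar> \<partial>M)"
proof -
  define A where "A f = {blinfun_apply \<mu> g | g. \<forall>\<omega>. \<bar>apply_bcontfun g \<omega>\<bar> \<le> f \<omega>}"
      for f :: "'a \<Rightarrow> real"
  define L where "L f = Sup (A f)" for f
  have bdd: "bdd_above (A f)" if f: "f \<in> nonneg_cont" for f
  proof -
    have "bounded (range f)"
      using f compact_continuous_image[OF _ c] unfolding nonneg_cont_def
        by (auto intro: compact_imp_bounded)
    then obtain B where B: "\<And>x. norm (f x) \<le> B" unfolding bounded_iff by auto
    have "blinfun_apply \<mu> g \<le> norm \<mu> * B" if "\<forall>\<omega>. \<bar>apply_bcontfun g \<omega>\<bar> \<le> f \<omega>" for g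
    proof -
      have "norm g \<le> B"
        by (rule norm_bcontfun_le) (use that B in \<open>metis abs_le_D1 order_trans real_norm_def\<close>)
      then have "norm \<mu> * norm g \<le> norm \<mu> * B" by (simp add: mult_left_mono)
      then show ?thesis using abs_blinfun_le[of \<mu> g] by linarith
    qed
    then show ?thesis unfolding A_def bdd_above_def by blast
  qed
  have upper: "blinfun_apply \<mu> g \<le> L f" if "f \<in> nonneg_cont" "\<And>\<omega>. \<bar>apply_bcontfun g \<omega>\<bar> \<le> f \<omega>"
      for f g
    unfolding L_def by (rule cSup_upper[OF _ bdd[OF that(1)]]) (use that in \<open>auto simp: A_def\<close>)
  have least: "L f \<le> z" if "f \<in> nonneg_cont"
      "\<And>g. (\<And>\<omega>. \<bar>apply_bcontfun g \<omega>\<bar> \<le> f \<omega>) \<Longrightarrow> blinfun_apply \<mu> g \<le> z" for f z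
    unfolding L_def
  proof (rule cSup_least)
    have "blinfun_apply \<mu> 0 \<in> A f" unfolding A_def using that(1)
      by (auto simp: nonneg_cont_def intro!: exI[of _ 0])
    then show "A f \<noteq> {}" by blast
  qed (use that in \<open>auto simp: A_def\<close>)
  have L0: "0 \<le> L f" if "f \<in> nonneg_cont" for f
    using upper[OF that, of 0] that by (simp add: nonneg_cont_def)
  have Lscale: "L (\<lambda>x. k * f x) \<le> k * L f" if f: "f \<in> nonneg_cont" and k: "0 < k" for f k
  proof (rule least)
    show "(\<lambda>x. k * f x) \<in> nonneg_cont" using f k unfolding nonneg_cont_def
      by (auto intro!: continuous_intros)
    fix g :: "'a CX" assume g: "\<And>\<omega>. \<bar>apply_bcontfun g \<omega>\<bar> \<le> k * f \<omega>"
    have "\<bar>apply_bcontfun ((1 / k) *\<^sub>R g) \<omega>\<bar> \<le> f \<omega>" for \<omega>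
      using g[of \<omega>] k by (simp add: abs_mult field_simps)
    then have "blinfun_apply \<mu> ((1 / k) *\<^sub>R g) \<le> L f" by (rule upper[OF f])
    then show "blinfun_apply \<mu> g \<le> k * L f" using k by (simp add: blinfun.scaleR_right field_simps)
  qed
  have "positive_functional L"
  proof
    fix f :: "'a \<Rightarrow> real" and k :: real assume f: "f \<in> nonneg_cont" and "0 \<le> k"
    then consider "k = 0" | "0 < k" by linarith
    then show "L (\<lambda>x. k * f x) = k * L f"
    proof cases
      case 1
      have z: "(\<lambda>_. 0) \<in> (nonneg_cont :: ('a \<Rightarrow> real) set)" by (simp add: nonneg_cont_def)
      have "L (\<lambda>_. 0) \<le> 0"
      proof (rule least[OF z])
        fix g :: "'a CX" assume "\<And>\<omega>. \<bar>apply_bcontfun g \<omega>\<bar> \<le> 0"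
        then have "g = 0" by (intro bcontfun_eqI) auto
        then show "blinfun_apply \<mu> g \<le> 0" by simp
      qed
      then show ?thesis using 1 L0[OF z] by simp
    next
      case 2
      have kf: "(\<lambda>x. k * f x) \<in> nonneg_cont" using f 2 unfolding nonneg_cont_def
        by (auto intro!: continuous_intros)
      have "L (\<lambda>x. (1 / k) * (k * f x)) \<le> (1 / k) * L (\<lambda>x. k * f x)"
        by (rule Lscale[OF kf]) (use 2 in simp)
      moreover have "(\<lambda>x. (1 / k) * (k * f x)) = f" using 2 by auto
      ultimately have "k * L f \<le> L (\<lambda>x. k * f x)" using 2 by (simp add: field_simps)
      then show ?thesis using Lscale[OF f 2] by simp
    qed
  next
    fix f1 f2 :: "'a \<Rightarrow> real" assume f: "f1 \<in> nonneg_cont" "f2 \<in> nonneg_cont"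
    then have fc: "continuous_on UNIV f1" "continuous_on UNIV f2" "\<And>x. 0 \<le> f1 x" "\<And>x. 0 \<le> f2 x"
      unfolding nonneg_cont_def by auto
    have f12: "(\<lambda>x. f1 x + f2 x) \<in> nonneg_cont" using fc unfolding nonneg_cont_def
      by (auto intro!: continuous_intros)
    show "L (\<lambda>x. f1 x + f2 x) = L f1 + L f2"
    proof (rule antisym)
      show "L (\<lambda>x. f1 x + f2 x) \<le> L f1 + L f2"
      proof (rule least[OF f12])
        fix g :: "'a CX" assume g: "\<And>\<omega>. \<bar>apply_bcontfun g \<omega>\<bar> \<le> f1 \<omega> + f2 \<omega>"
        \<comment> \<open>g is clipped to the band between -f1 and f1; the remainder then stays
          between -f2 and f2.\<close>
        define h where "h \<omega> = max (- f1 \<omega>) (min (apply_bcontfun g \<omega>) (f1 \<omega>))" for \<omega>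
        have hc: "continuous_on UNIV h" unfolding h_def
          by (intro continuous_on_max continuous_on_min continuous_on_minus fc
              continuous_on_apply_bcontfun)
        have ah: "apply_bcontfun (Bcontfun h) \<omega> = h \<omega>" for \<omega> using apply_Bcontfun[OF c hc] by simp
        have "blinfun_apply \<mu> (Bcontfun h) \<le> L f1"
        proof (intro upper f)
          show "\<bar>apply_bcontfun (Bcontfun h) \<omega>\<bar> \<le> f1 \<omega>" for \<omega>
            using fc(3)[of \<omega>] unfolding ah h_def by (auto simp: abs_le_iff max_def min_def)
        qed
        moreover have "\<bar>apply_bcontfun (g - Bcontfun h) \<omega>\<bar> \<le> f2 \<omega>" for \<omega>
          using g[of \<omega>] fc(3)[of \<omega>] fc(4)[of \<omega>] by (auto simp: ah h_def abs_le_iff max_def min_def)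
        then have "blinfun_apply \<mu> (g - Bcontfun h) \<le> L f2" by (intro upper f)
        ultimately show "blinfun_apply \<mu> g \<le> L f1 + L f2" by (simp add: blinfun.diff_right)
      qed
      have "L f1 \<le> L (\<lambda>x. f1 x + f2 x) - L f2"
      proof (rule least[OF f(1)])
        fix g1 :: "'a CX" assume g1: "\<And>\<omega>. \<bar>apply_bcontfun g1 \<omega>\<bar> \<le> f1 \<omega>"
        have "L f2 \<le> L (\<lambda>x. f1 x + f2 x) - blinfun_apply \<mu> g1"
        proof (rule least[OF f(2)])
          fix g2 :: "'a CX" assume g2: "\<And>\<omega>. \<bar>apply_bcontfun g2 \<omega>\<bar> \<le> f2 \<omega>"
          have "\<bar>apply_bcontfun (g1 + g2) \<omega>\<bar> \<le> f1 \<omega> + f2 \<omega>" for \<omega>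
            using g1[of \<omega>] g2[of \<omega>] by auto
          then have "blinfun_apply \<mu> (g1 + g2) \<le> L (\<lambda>x. f1 x + f2 x)" by (intro upper f12)
          then show "blinfun_apply \<mu> g2 \<le> L (\<lambda>x. f1 x + f2 x) - blinfun_apply \<mu> g1"
            by (simp add: blinfun.add_right)
        qed
        then show "blinfun_apply \<mu> g1 \<le> L (\<lambda>x. f1 x + f2 x) - L f2" by simp
      qed
      then show "L f1 + L f2 \<le> L (\<lambda>x. f1 x + f2 x)" by simp
    qed
  qed (use c L0 in auto)
  then obtain M where M: "finite_measure M" "sets M = sets borel"
    "\<And>f. f \<in> nonneg_cont \<Longrightarrow> (\<integral>x. f x \<partial>M) = L f"
    using positive_functional_measure by blast
  have "\<bar>blinfun_apply \<mu> x\<bar> \<le> (\<integral>\<omega>. \<bar>apply_bcontfun x \<omega>\<bar> \<partial>M)" for x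
  proof -
    have f: "(\<lambda>\<omega>. \<bar>apply_bcontfun x \<omega>\<bar>) \<in> nonneg_cont"
      unfolding nonneg_cont_def by (auto intro!: continuous_intros)
    have "blinfun_apply \<mu> x \<le> L (\<lambda>\<omega>. \<bar>apply_bcontfun x \<omega>\<bar>)"
      "blinfun_apply \<mu> (- x) \<le> L (\<lambda>\<omega>. \<bar>apply_bcontfun x \<omega>\<bar>)"
      by (intro upper[OF f]; simp)+
    then show ?thesis using M(3)[OF f] by (simp add: blinfun.minus_right abs_le_iff)
  qed
  then show ?thesis using that M by blast
qed

lemma compact_finite_net:
  assumes c: "compact (UNIV :: 'a::metric_space set)" and e: "0 < e"
  obtains cs :: "'a::metric_space list" where "\<And>x. \<exists>c\<in>set cs. dist x c < e"
proof -
  obtain C where C: "finite C" "(UNIV :: 'a set) \<subseteq> (\<Union>x\<in>C. ball x e)"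
    using c[unfolded compact_eq_totally_bounded] e by blast
  obtain cs where "set cs = C" using finite_list[OF C(1)] by blast
  then have "\<exists>c\<in>set cs. dist x c < e" for x using C(2) by (force simp: dist_commute)
  then show ?thesis using that by blast
qed

text \<open>Rational combinations of partitions of unity, one partition for a finite net of each
  mesh 1/(N + 1), form a countable family. Uniform continuity makes it dense.\<close>

lemma separable_bcontfun:
  assumes c: "compact (UNIV :: 'a::metric_space set)"
  obtains Z :: "nat \<Rightarrow> 'a::metric_space CX" where "\<And>x e. 0 < e \<Longrightarrow> \<exists>n. norm (x - Z n) < e"
proof -
  have "\<exists>cs :: 'a list. \<forall>x. \<exists>c\<in>set cs. dist x c < 1 / Suc N" for N
    using compact_finite_net[OF c, of "1 / Suc N"]
      by (metis of_nat_0_less_iff zero_less_Suc zero_less_divide_1_iff)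
  then obtain cs :: "nat \<Rightarrow> 'a list" where cs: "\<And>N x. \<exists>c\<in>set (cs N). dist x c < 1 / Suc N" by metis
  define \<psi> where "\<psi> N i x = max 0 (1 / Suc N - dist x (cs N ! i))" for N i and x :: 'a
  define s where "s N x = (\<Sum>i<length (cs N). \<psi> N i x)" for N x
  \<comment> \<open>A coefficient list of the wrong length is harmless: entries beyond its end are
    unspecified numbers, and \<open>F p\<close> is still continuous.\<close>
  define F where "F p x = (\<Sum>i<length (cs (fst p)). of_rat (snd p ! i) *
      (\<psi> (fst p) i x / s (fst p) x))"
    for p :: "nat \<times> rat list" and x
  have psi0: "0 \<le> \<psi> N i x" for N i x unfolding \<psi>_def by simp
  have psic: "continuous_on UNIV (\<psi> N i)" for N i unfolding \<psi>_def by (intro continuous_intros)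
  have spos: "0 < s N x" for N x
  proof -
    obtain c where "c \<in> set (cs N)" "dist x c < 1 / Suc N" using cs by blast
    then obtain i where i: "i < length (cs N)" "dist x (cs N ! i) < 1 / Suc N"
      by (metis in_set_conv_nth)
    then have "0 < \<psi> N i x" unfolding \<psi>_def by simp
    also have "\<dots> \<le> s N x" unfolding s_def using i psi0 by (intro member_le_sum) auto
    finally show ?thesis .
  qed
  have sc: "continuous_on UNIV (s N)" for N unfolding s_def by (intro continuous_intros psic)
  have "continuous_on UNIV (F p)" for p
    unfolding F_def using spos[of "fst p"]
    by (intro continuous_intros psic sc) (auto simp: less_le)
  then have FC: "apply_bcontfun (Bcontfun (F p)) = F p" for p by (rule apply_Bcontfun[OF c])
  have dense: "\<exists>p. norm (x - Bcontfun (F p)) < e" if e: "0 < e" for x :: "'a CX" and e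
  proof -
    have "uniformly_continuous_on UNIV (apply_bcontfun x)"
      by (rule compact_uniformly_continuous[OF _ c]) simp
    then obtain d where d: "0 < d" "\<And>u v. dist u v < d
        \<Longrightarrow> dist (apply_bcontfun x u) (apply_bcontfun x v) < e / 3"
      using e unfolding uniformly_continuous_on_def
        by (metis UNIV_I divide_pos_pos zero_less_numeral)
    obtain N where N: "1 / Suc N < d" using d(1) nat_approx_posE by blast
    have "\<exists>q::rat. \<bar>of_rat q - apply_bcontfun x c\<bar> < e / 3" for c
    proof -
      obtain q where "apply_bcontfun x c < of_rat q" "of_rat q < apply_bcontfun x c + e / 3"
        using of_rat_dense[of "apply_bcontfun x c" "apply_bcontfun x c + e / 3"] e by auto
      then show ?thesis by (intro exI[of _ q]) auto
    qed
    then obtain q :: "'a \<Rightarrow> rat" where q: "\<And>c. \<bar>of_rat (q c) - apply_bcontfun x c\<bar> < e / 3" by metis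
    define p where "p = (N, map q (cs N))"
    \<comment> \<open>One third of e pays for the oscillation of x near \<omega>, another for
      rounding to rationals; centres farther away have weight 0.\<close>
    have "\<bar>apply_bcontfun (x - Bcontfun (F p)) \<omega>\<bar> \<le> 2 * e / 3" for \<omega>
    proof -
      let ?w = "\<lambda>i. \<psi> N i \<omega> / s N \<omega>"
      have w0: "0 \<le> ?w i" for i using psi0 spos[of N \<omega>] by simp
      have w1: "(\<Sum>i<length (cs N). ?w i) = 1"
        using spos[of N \<omega>] unfolding s_def by (simp flip: sum_divide_distrib)
      have "apply_bcontfun x \<omega> - F p \<omega> = (\<Sum>i<length (cs N).
          (apply_bcontfun x \<omega> - of_rat (q (cs N ! i))) * ?w i)"
      proof -
        have "(\<Sum>i<length (cs N). (apply_bcontfun x \<omega> - of_rat (q (cs N ! i))) * ?w i)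
            = apply_bcontfun x \<omega> * (\<Sum>i<length (cs N). ?w i)
                - (\<Sum>i<length (cs N). of_rat (q (cs N ! i)) * ?w i)"
          by (simp only: left_diff_distrib sum_subtractf sum_distrib_left)
        then show ?thesis unfolding w1 F_def p_def by simp
      qed
      also have "\<bar>\<dots>\<bar> \<le> (\<Sum>i<length (cs N). \<bar>(apply_bcontfun x \<omega> - of_rat (q (cs N ! i))) * ?w i\<bar>)"
        by (rule sum_abs)
      also have "\<dots> \<le> (\<Sum>i<length (cs N). (2 * e / 3) * ?w i)"
      proof (rule sum_mono)
        fix i
        show "\<bar>(apply_bcontfun x \<omega> - of_rat (q (cs N ! i))) * ?w i\<bar> \<le> (2 * e / 3) * ?w i"
        proof (cases "dist \<omega> (cs N ! i) < 1 / Suc N")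
          case True
          then have "\<bar>apply_bcontfun x \<omega> - apply_bcontfun x (cs N ! i)\<bar> < e / 3"
            using d(2)[of \<omega> "cs N ! i"] N by (simp add: dist_real_def)
          then have "\<bar>apply_bcontfun x \<omega> - of_rat (q (cs N ! i))\<bar> \<le> 2 * e / 3"
            using q[of "cs N ! i"] by linarith
          then show ?thesis using w0[of i] e unfolding abs_mult by (intro mult_mono) auto
        next
          case False
          then have "\<psi> N i \<omega> = 0" unfolding \<psi>_def by simp
          then show ?thesis by simp
        qed
      qed
      also have "\<dots> = 2 * e / 3" by (simp only: sum_distrib_left[symmetric] w1 mult_1_right)
      finally show ?thesis by (simp add: FC)
    qed
    then have "norm (x - Bcontfun (F p)) \<le> 2 * e / 3" by (rule norm_bcontfun_le)
    then show ?thesis using e by (intro exI[of _ p]) simp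
  qed
  have "\<exists>n. norm (x - Bcontfun (F (from_nat n))) < e" if "0 < e" for x e
    using dense[OF that, of x] by (metis from_nat_to_nat)
  then show ?thesis using that[of "\<lambda>n. Bcontfun (F (from_nat n))"] by blast
qed

text \<open>The Lipschitz bound is uniform in n and t, so convergence on a dense sequence of
  functions suffices. For the Cesaro means t is a point of \<Omega>; as there may be uncountably
  many, \<open>sub\<close> has to provide one subsequence for all t.\<close>

lemma diagonal_convergence:
  fixes L :: "nat \<Rightarrow> 'a::metric_space CX \<Rightarrow> 't \<Rightarrow> real"
  assumes c: "compact (UNIV :: 'a set)"
    and lip: "\<And>n x y t. \<bar>L n x t - L n y t\<bar> \<le> norm (x - y)"
    and sub: "\<And>x s. strict_mono s \<Longrightarrow> \<exists>r. strict_mono (r :: nat \<Rightarrow> nat)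
        \<and> (\<forall>t. convergent (\<lambda>k. L (s (r k)) x t))"
  obtains \<sigma> :: "nat \<Rightarrow> nat" where "strict_mono \<sigma>" "\<And>x t. convergent (\<lambda>k. L (\<sigma> k) x t)"
proof -
  obtain Z :: "nat \<Rightarrow> 'a CX" where Z: "\<And>x e. 0 < e \<Longrightarrow> \<exists>n. norm (x - Z n) < e"
    using separable_bcontfun[OF c] by blast
  interpret subseqs "\<lambda>n s. \<forall>t. convergent (\<lambda>k. L (s k) (Z n) t)"
    using sub by unfold_locales (simp add: o_def)
  have diagZ: "convergent (\<lambda>k. L (diagseq k) (Z n) t)" for n t
  proof -
    have "\<forall>t. convergent (\<lambda>k. L ((diagseq \<circ> (+) (Suc n)) k) (Z n) t)"
    proof (rule diagseq_holds)
      fix r s n assume "strict_mono (r :: nat \<Rightarrow> nat)" "\<forall>t. convergent (\<lambda>k. L (s k) (Z n) t)"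
      then show "\<forall>t. convergent (\<lambda>k. L ((s \<circ> r) k) (Z n) t)"
        using convergent_subseq_convergent[of "\<lambda>k. L (s k) (Z n) _" r] by (simp add: o_def)
    qed
    then have "convergent (\<lambda>k. L (diagseq (k + Suc n)) (Z n) t)" by (simp add: o_def add.commute)
    then show ?thesis
      using convergent_ignore_initial_segment[where f = "\<lambda>k. L (diagseq k) (Z n) t"
          and m = "Suc n"] by blast
  qed
  have "convergent (\<lambda>k. L (diagseq k) x t)" for x t
  proof -
    have "Cauchy (\<lambda>k. L (diagseq k) x t)"
    proof (rule metric_CauchyI)
      fix e :: real assume e: "0 < e"
      obtain n where n: "norm (x - Z n) < e / 3" using Z[of "e / 3" x] e by auto
      have "Cauchy (\<lambda>k. L (diagseq k) (Z n) t)" using diagZ by (rule convergent_Cauchy)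
      from metric_CauchyD[OF this, of "e / 3"] e
      obtain M where M: "\<forall>k\<ge>M. \<forall>l\<ge>M. dist (L (diagseq k) (Z n) t) (L (diagseq l) (Z n) t) < e / 3"
        by auto
      have "dist (L (diagseq k) x t) (L (diagseq l) x t) < e" if "k \<ge> M" "l \<ge> M" for k l
        using M[rule_format, OF that] lip[of "diagseq k" x t "Z n"] lip[of "diagseq l" x t "Z n"] n
        unfolding dist_real_def by linarith
      then show "\<exists>M. \<forall>m\<ge>M. \<forall>n\<ge>M. dist (L (diagseq m) x t) (L (diagseq n) x t) < e" by blast
    qed
    then show ?thesis by (rule Cauchy_convergent)
  qed
  then show ?thesis using that subseq_diagseq by blast
qed

text \<open>Sequential weak-star compactness of the state space, by diagonalization over a dense
  sequence of functions.\<close>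

lemma states_subsequence:
  fixes L :: "nat \<Rightarrow> 'a::metric_space CX \<Rightarrow> real"
  assumes c: "compact (UNIV :: 'a set)" and L: "\<And>n. state (L n)"
  obtains \<sigma> :: "nat \<Rightarrow> nat" and L' where "strict_mono \<sigma>" "state L'" "\<And>x. (\<lambda>k. L (\<sigma> k) x) \<longlonglongrightarrow> L' x"
proof -
  have lin: "linear (L n)" for n using L unfolding state_def by blast
  obtain \<sigma> :: "nat \<Rightarrow> nat" where \<sigma>: "strict_mono \<sigma>"
      "\<And>x t. convergent (\<lambda>k. (\<lambda>n x t. L n x) (\<sigma> k) x (t :: unit))"
  proof (rule diagonal_convergence[OF c, where L = "\<lambda>n x (t :: unit). L n x"])
    fix n and x y :: "'a CX"
    show "\<bar>L n x - L n y\<bar> \<le> norm (x - y)"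
      using state_abs_le[OF L, of n "x - y"] linear_diff[OF lin] by simp
  next
    fix x and s :: "nat \<Rightarrow> nat"
    have "bounded (range (\<lambda>k. L (s k) x))"
      using state_abs_le[OF L] by (intro boundedI[where B = "norm x"]) auto
    then obtain r l where "strict_mono (r :: nat \<Rightarrow> nat)" "((\<lambda>k. L (s k) x) \<circ> r) \<longlonglongrightarrow> l"
      using bounded_imp_convergent_subsequence by blast
    then show "\<exists>r. strict_mono (r :: nat \<Rightarrow> nat) \<and> (\<forall>t :: unit. convergent (\<lambda>k. L (s (r k)) x))"
      by (auto simp: o_def convergent_def)
  qed (use that in blast)
  define L' where "L' x = lim (\<lambda>k. L (\<sigma> k) x)" for x
  have lim: "(\<lambda>k. L (\<sigma> k) x) \<longlonglongrightarrow> L' x" for x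
    unfolding L'_def using \<sigma>(2) by (simp add: convergent_LIMSEQ_iff)
  have "state L'"
    unfolding state_def
  proof (intro conjI allI impI)
    show "linear L'"
    proof (rule linearI)
      fix x y :: "'a CX" and r :: real
      have "(\<lambda>k. L (\<sigma> k) (x + y)) \<longlonglongrightarrow> L' x + L' y"
        using tendsto_add[OF lim lim] by (simp add: linear_add[OF lin])
      then show "L' (x + y) = L' x + L' y" using lim LIMSEQ_unique by blast
      have "(\<lambda>k. L (\<sigma> k) (r *\<^sub>R x)) \<longlonglongrightarrow> r *\<^sub>R L' x"
        using tendsto_scaleR[OF tendsto_const lim] by (simp add: linear_cmul[OF lin])
      then show "L' (r *\<^sub>R x) = r *\<^sub>R L' x" using lim LIMSEQ_unique by blast
    qed
    show "L' (const_bcontfun 1) = 1"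
      using lim[of "const_bcontfun 1"] L LIMSEQ_unique[OF _ tendsto_const] unfolding state_def
        by simp
    fix x :: "'a CX" assume "\<forall>\<omega>. 0 \<le> apply_bcontfun x \<omega>"
    then have "0 \<le> L (\<sigma> k) x" for k using L unfolding state_def by blast
    then show "0 \<le> L' x" using LIMSEQ_le_const[OF lim] by blast
  qed
  then show ?thesis using that \<sigma>(1) lim by blast
qed

section \<open>Convergence in mean\<close>

lemma compact_countable_basis:
  assumes c: "compact (UNIV :: 'a::metric_space set)"
  obtains B :: "nat \<Rightarrow> 'a::metric_space set" where "\<And>n. open (B n)"
    "\<And>U x. open U \<Longrightarrow> x \<in> U \<Longrightarrow> \<exists>n. x \<in> B n \<and> B n \<subseteq> U"
proof -
  have "\<exists>cs :: 'a list. \<forall>x. \<exists>c\<in>set cs. dist x c < 1 / Suc N" for N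
    using compact_finite_net[OF c, of "1 / Suc N"]
      by (metis of_nat_0_less_iff zero_less_Suc zero_less_divide_1_iff)
  then obtain cs :: "nat \<Rightarrow> 'a list" where cs: "\<And>N x. \<exists>c\<in>set (cs N). dist x c < 1 / Suc N" by metis
  define B' where "B' p = ball (cs (fst p) ! snd p) (1 / Suc (fst p))" for p :: "nat \<times> nat"
  have "\<exists>p. x \<in> B' p \<and> B' p \<subseteq> U" if U: "open U" "x \<in> U" for U x
  proof -
    obtain e where e: "0 < e" "ball x e \<subseteq> U" using U open_contains_ball by blast
    obtain N where N: "1 / Suc N < e / 2" using e(1) nat_approx_posE[of "e / 2"] by auto
    obtain c where c: "c \<in> set (cs N)" "dist x c < 1 / Suc N" using cs by blast
    obtain i where i: "cs N ! i = c" using c(1) by (metis in_set_conv_nth)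
    have "ball c (1 / Suc N) \<subseteq> ball x e"
    proof
      fix y assume "y \<in> ball c (1 / Suc N)"
      then show "y \<in> ball x e" using dist_triangle[of x y c] c(2) N by simp
    qed
    then have "x \<in> B' (N, i) \<and> B' (N, i) \<subseteq> U"
      using c(2) e(2) unfolding B'_def by (auto simp: i dist_commute)
    then show ?thesis by blast
  qed
  then have "\<exists>n. x \<in> B' (from_nat n) \<and> B' (from_nat n) \<subseteq> U" if "open U" "x \<in> U" for U x
    using that by (metis from_nat_to_nat)
  moreover have "open (B' (from_nat n))" for n unfolding B'_def by simp
  ultimately show ?thesis using that[of "\<lambda>n. B' (from_nat n)"] by blast
qed

lemma compact_Baire:
  fixes D :: "'a::metric_space set"
  assumes D: "compact D" "D \<noteq> {}" and Z: "\<And>n::nat. closed (Z n)" "D \<subseteq> (\<Union>n. Z n)"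
  obtains n U where "open U" "U \<inter> D \<noteq> {}" "U \<inter> D \<subseteq> Z n"
proof (rule ccontr)
  assume neg: "\<not> thesis"
  let ?X = "top_of_set D"
  have "?X interior_of \<Union>(range (\<lambda>n. Z n \<inter> D)) = {}"
  proof (rule Baire_category_alt)
    show "completely_metrizable_space ?X \<or> locally_compact_space ?X \<and> regular_space ?X"
      using D(1) by (metis compact_imp_locally_compact_space compact_space_subtopology
          compactin_euclidean_iff
          metrizable_imp_regular_space metrizable_space_euclidean metrizable_space_subtopology)
    fix T assume "T \<in> range (\<lambda>n. Z n \<inter> D)"
    then obtain n where T: "T = Z n \<inter> D" by blast
    have "closedin ?X T" unfolding T using Z(1) by (metis closedin_closed inf_commute)
    moreover have "?X interior_of T = {}"
    proof (rule ccontr)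
      assume ne: "?X interior_of T \<noteq> {}"
      have "openin ?X (?X interior_of T)" by simp
      then obtain U where U: "open U" "?X interior_of T = D \<inter> U" by (metis openin_open)
      have "U \<inter> D \<subseteq> Z n" using interior_of_subset[of ?X T] U(2) T by auto
      then show False using that[of U n] neg U ne by (simp add: Int_commute)
    qed
    ultimately show "closedin ?X T \<and> ?X interior_of T = {}" ..
  qed simp
  moreover have "\<Union>(range (\<lambda>n. Z n \<inter> D)) = D" using Z(2) by blast
  ultimately show False using D(2) interior_of_topspace[of ?X] by simp
qed

text \<open>The limits may lie outside H and may be discontinuous. They are of the first Baire
  class, hence measurable, which dominated convergence requires.\<close>

definition ptwise_precompact :: "'a::metric_space CX set \<Rightarrow> bool" where
  "ptwise_precompact H \<longleftrightarrow> (\<forall>y. range y \<subseteq> H \<longrightarrow>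
     (\<exists>\<sigma> :: nat \<Rightarrow> nat. strict_mono \<sigma> \<and> (\<forall>\<omega>. convergent (\<lambda>k. apply_bcontfun (y (\<sigma> k)) \<omega>))))"

section \<open>Pointwise precompact sets in L^1(M)\<close>

locale finite_borel_measure = finite_measure M for M :: "'a::metric_space measure" +
  assumes sets_M: "sets M = sets borel"
begin

lemma space_M: "space M = UNIV"
  using sets_eq_imp_space_eq[OF sets_M] by simp

lemma measurable_bcontfun [measurable]: "apply_bcontfun (x :: 'a CX) \<in> borel_measurable M"
  using borel_measurable_continuous_onI[OF continuous_on_apply_bcontfun]
      measurable_cong_sets[OF sets_M refl]
  by blast

lemma integrable_bounded:
  fixes f :: "'a \<Rightarrow> real"
  assumes "f \<in> borel_measurable M" "\<And>\<omega>. \<bar>f \<omega>\<bar> \<le> B"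
  shows "integrable M f"
  using assms by (intro integrable_const_bound[where B = B]) auto

lemma integrable_bcontfun [simp]: "integrable M (apply_bcontfun (x :: 'a CX))"
  by (rule integrable_bounded[OF measurable_bcontfun abs_le_norm_bcontfun])

lemma ptwise_limit_bounded:
  assumes "\<And>n. norm (y n :: 'a CX) \<le> B" "\<And>\<omega>. (\<lambda>n. apply_bcontfun (y n) \<omega>) \<longlonglongrightarrow> f \<omega>"
  shows "f \<in> borel_measurable M" "\<And>\<omega>. \<bar>f \<omega>\<bar> \<le> B" "integrable M f"
proof -
  show m: "f \<in> borel_measurable M"
    by (rule borel_measurable_LIMSEQ_real[OF assms(2)]) auto
  show b: "\<bar>f \<omega>\<bar> \<le> B" for \<omega>
  proof (rule LIMSEQ_le_const2[OF tendsto_rabs[OF assms(2)]])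
    show "\<exists>N. \<forall>n\<ge>N. \<bar>apply_bcontfun (y n) \<omega>\<bar> \<le> B"
      using abs_le_norm_bcontfun assms(1) order_trans by blast
  qed
  show "integrable M f" by (rule integrable_bounded[OF m b])
qed

definition L1dist :: "('a \<Rightarrow> real) \<Rightarrow> ('a \<Rightarrow> real) \<Rightarrow> real" where
  "L1dist f g = (\<integral>\<omega>. \<bar>f \<omega> - g \<omega>\<bar> \<partial>M)"

lemma L1dist_nonneg: "0 \<le> L1dist f g"
  unfolding L1dist_def by simp

lemma L1dist_commute: "L1dist f g = L1dist g f"
  unfolding L1dist_def by (simp add: abs_minus_commute)

lemma L1dist_triangle:
  assumes "integrable M f" "integrable M g" "integrable M h"
  shows "L1dist f h \<le> L1dist f g + L1dist g h"
proof -
  have "L1dist f h \<le> (\<integral>\<omega>. \<bar>f \<omega> - g \<omega>\<bar> + \<bar>g \<omega> - h \<omega>\<bar> \<partial>M)"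
    unfolding L1dist_def using assms by (intro integral_mono) auto
  also have "\<dots> = L1dist f g + L1dist g h" unfolding L1dist_def using assms by simp
  finally show ?thesis .
qed

lemma L1dist_le_norm: "L1dist (apply_bcontfun x) (apply_bcontfun y)
    \<le> measure M UNIV * norm (x - y :: 'a CX)"
proof -
  have "L1dist (apply_bcontfun x) (apply_bcontfun y) \<le> (\<integral>\<omega>. norm (x - y) \<partial>M)"
    unfolding L1dist_def using abs_le_norm_bcontfun[of "x - y"] by (intro integral_mono) auto
  then show ?thesis using space_M by simp
qed

lemma L1dist_ptwise:
  assumes "\<And>n. norm (y n :: 'a CX) \<le> B" "\<And>\<omega>. (\<lambda>n. apply_bcontfun (y n) \<omega>) \<longlonglongrightarrow> f \<omega>"
  shows "(\<lambda>n. L1dist (apply_bcontfun (y n)) f) \<longlonglongrightarrow> 0"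
proof -
  have m[measurable]: "f \<in> borel_measurable M" and b: "\<And>\<omega>. \<bar>f \<omega>\<bar> \<le> B"
    using ptwise_limit_bounded[OF assms] by auto
  have "(\<lambda>n. L1dist (apply_bcontfun (y n)) f) \<longlonglongrightarrow> (\<integral>\<omega>. 0 \<partial>M)"
    unfolding L1dist_def
  proof (rule integral_dominated_convergence[where w = "\<lambda>_. 2 * B"])
    show "AE \<omega> in M. (\<lambda>n. \<bar>apply_bcontfun (y n) \<omega> - f \<omega>\<bar>) \<longlonglongrightarrow> 0"
      using tendsto_rabs_zero[OF LIM_zero[OF assms(2)]] by simp
    have "\<bar>apply_bcontfun (y n) \<omega> - f \<omega>\<bar> \<le> 2 * B" for n \<omega>
      using b[of \<omega>] abs_le_norm_bcontfun[of "y n" \<omega>] assms(1)[of n] by linarith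
    then show "AE \<omega> in M. norm \<bar>apply_bcontfun (y n) \<omega> - f \<omega>\<bar> \<le> 2 * B" for n by simp
  qed simp_all
  then show ?thesis by simp
qed

definition L1_totally_bounded :: "'a CX set \<Rightarrow> bool" where
  "L1_totally_bounded H \<longleftrightarrow> (\<forall>e>0. \<exists>C. finite C \<and> C \<subseteq> H \<and>
     (\<forall>h\<in>H. \<exists>c\<in>C. L1dist (apply_bcontfun h) (apply_bcontfun c) < e))"

text \<open>Otherwise H contains an e-separated sequence, while a pointwise convergent subsequence
  of it converges in L^1(M) by dominated convergence.\<close>

lemma ptwise_precompact_totally_bounded:
  assumes H: "ptwise_precompact H" and B: "\<And>h. h \<in> H \<Longrightarrow> norm h \<le> B"
  shows "L1_totally_bounded H"
  unfolding L1_totally_bounded_def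
proof (intro allI impI, rule ccontr)
  fix e :: real assume e: "0 < e"
  assume neg: "\<nexists>C. finite C \<and> C \<subseteq> H \<and> (\<forall>h\<in>H. \<exists>c\<in>C. L1dist (apply_bcontfun h) (apply_bcontfun c)
      < e)"
  define P where "P y n h \<longleftrightarrow> h \<in> H \<and> (\<forall>m<n. e \<le> L1dist (apply_bcontfun h) (apply_bcontfun (y m)))"
    for y :: "nat \<Rightarrow> 'a CX" and n :: nat and h :: "'a CX"
  have "\<exists>y. \<forall>n. P y n (y n)"
  proof (rule dependent_wellorder_choice)
    fix n and y :: "nat \<Rightarrow> 'a CX"
    assume y: "\<And>m. m < n \<Longrightarrow> P y m (y m)"
    have fin: "finite (y ` {..<n})" "y ` {..<n} \<subseteq> H" using y unfolding P_def by auto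
    show "\<exists>h. P y n h"
    proof (rule ccontr)
      assume "\<not> ?thesis"
      then have "\<forall>h\<in>H. \<exists>c\<in>y ` {..<n}. L1dist (apply_bcontfun h) (apply_bcontfun c) < e"
        unfolding P_def by (simp add: not_le Bex_def)
      then show False using neg fin by meson
    qed
  qed (simp add: P_def)
  then obtain y :: "nat \<Rightarrow> 'a CX" where y: "\<And>n. y n \<in> H"
      "\<And>m n. m < n \<Longrightarrow> L1dist (apply_bcontfun (y n)) (apply_bcontfun (y m)) \<ge> e"
    unfolding P_def by blast
  then obtain \<sigma> :: "nat \<Rightarrow> nat" where \<sigma>: "strict_mono \<sigma>"
      "\<And>\<omega>. convergent (\<lambda>k. apply_bcontfun (y (\<sigma> k)) \<omega>)"
    using H unfolding ptwise_precompact_def by (meson image_subsetI)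
  define f where "f \<omega> = lim (\<lambda>k. apply_bcontfun (y (\<sigma> k)) \<omega>)" for \<omega>
  have lim: "(\<lambda>k. apply_bcontfun (y (\<sigma> k)) \<omega>) \<longlonglongrightarrow> f \<omega>" for \<omega>
    using \<sigma>(2) unfolding f_def by (simp add: convergent_LIMSEQ_iff)
  have nb: "norm (y (\<sigma> k)) \<le> B" for k using B y(1) by blast
  have fi: "integrable M f" using ptwise_limit_bounded(3)[of "\<lambda>k. y (\<sigma> k)", OF nb lim] .
  have "(\<lambda>k. L1dist (apply_bcontfun (y (\<sigma> k))) f) \<longlonglongrightarrow> 0"
    using L1dist_ptwise[of "\<lambda>k. y (\<sigma> k)", OF nb lim] .
  then have "\<forall>\<^sub>F k in sequentially. L1dist (apply_bcontfun (y (\<sigma> k))) f < e / 2"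
    using e by (intro order_tendstoD) auto
  then obtain k where k: "\<And>l. l \<ge> k \<Longrightarrow> L1dist (apply_bcontfun (y (\<sigma> l))) f < e / 2"
    unfolding eventually_sequentially by blast
  have "L1dist (apply_bcontfun (y (\<sigma> (Suc k)))) (apply_bcontfun (y (\<sigma> k))) < e"
    using L1dist_triangle[OF integrable_bcontfun fi integrable_bcontfun, of "y (\<sigma> (Suc k))"
        "y (\<sigma> k)"]
      k[of k] k[of "Suc k"] L1dist_commute[of f] by simp
  moreover have "\<sigma> k < \<sigma> (Suc k)" using \<sigma>(1) by (simp add: strict_mono_def)
  ultimately show False using y(2) by (metis not_less)
qed

lemma L1dist_convex_combination:
  assumes "0 \<le> u" "0 \<le> v"
  shows "L1dist (apply_bcontfun (u *\<^sub>R a + v *\<^sub>R b)) (apply_bcontfun (u *\<^sub>R c + v *\<^sub>R d :: 'a CX))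
    \<le> u * L1dist (apply_bcontfun a) (apply_bcontfun c) + v *
        L1dist (apply_bcontfun b) (apply_bcontfun d)"
proof -
  have "L1dist (apply_bcontfun (u *\<^sub>R a + v *\<^sub>R b)) (apply_bcontfun (u *\<^sub>R c + v *\<^sub>R d))
    \<le> (\<integral>\<omega>. u * \<bar>apply_bcontfun a \<omega> - apply_bcontfun c \<omega>\<bar> + v * \<bar>apply_bcontfun b \<omega> -
        apply_bcontfun d \<omega>\<bar> \<partial>M)"
    unfolding L1dist_def
  proof (intro integral_mono)
    fix \<omega>
    have "apply_bcontfun (u *\<^sub>R a + v *\<^sub>R b) \<omega> - apply_bcontfun (u *\<^sub>R c + v *\<^sub>R d) \<omega>
       = u * (apply_bcontfun a \<omega> - apply_bcontfun c \<omega>) + v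
           * (apply_bcontfun b \<omega> - apply_bcontfun d \<omega>)"
      by (simp add: algebra_simps)
    also have "\<bar>\<dots>\<bar> \<le> \<bar>u * (apply_bcontfun a \<omega> - apply_bcontfun c \<omega>)\<bar>
        + \<bar>v * (apply_bcontfun b \<omega> - apply_bcontfun d \<omega>)\<bar>"
      by (rule abs_triangle_ineq)
    finally show "\<bar>apply_bcontfun (u *\<^sub>R a + v *\<^sub>R b) \<omega> - apply_bcontfun (u *\<^sub>R c + v *\<^sub>R d) \<omega>\<bar>
       \<le> u * \<bar>apply_bcontfun a \<omega> - apply_bcontfun c \<omega>\<bar> + v * \<bar>apply_bcontfun b \<omega> - apply_bcontfun
           d \<omega>\<bar>"
      using assms by (simp add: abs_mult)
  qed auto
  then show ?thesis unfolding L1dist_def by simp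
qed

text \<open>A finite net of S spans a polytope that is compact in the sup norm, and convex
  combinations are no farther apart in L^1(M) than the corresponding average of the distances of
  their terms.\<close>

lemma L1_net_convex_hull:
  assumes tb: "L1_totally_bounded S" and e: "0 < e"
  obtains C where "finite C" "\<And>h. h \<in> convex hull S
      \<Longrightarrow> \<exists>c\<in>C. L1dist (apply_bcontfun h) (apply_bcontfun c) < e"
proof -
  obtain C0 where C0: "finite C0" "\<And>h. h \<in> S \<Longrightarrow> \<exists>c\<in>C0. L1dist (apply_bcontfun h) (apply_bcontfun c)
      < e / 2"
    using tb e unfolding L1_totally_bounded_def by (meson half_gt_zero)
  let ?K = "convex hull C0"
  let ?T = "{h. \<exists>k\<in>?K. L1dist (apply_bcontfun h) (apply_bcontfun k) < e / 2}"
  have "convex hull S \<subseteq> ?T"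
  proof (rule hull_minimal)
    show "S \<subseteq> ?T" using C0(2) hull_inc[of _ C0 convex] by blast
    show "convex ?T"
    proof (rule convexI)
      fix a b :: "'a CX" and u v :: real assume "a \<in> ?T" "b \<in> ?T"
          and uv: "0 \<le> u" "0 \<le> v" "u + v = 1"
      then obtain c d where cd: "c \<in> ?K" "d \<in> ?K"
          "L1dist (apply_bcontfun a) (apply_bcontfun c) < e / 2"
        "L1dist (apply_bcontfun b) (apply_bcontfun d) < e / 2" by blast
      have "u *\<^sub>R c + v *\<^sub>R d \<in> ?K" using convexD[OF convex_convex_hull cd(1,2) uv] .
      moreover have "L1dist (apply_bcontfun (u *\<^sub>R a + v *\<^sub>R b))
          (apply_bcontfun (u *\<^sub>R c + v *\<^sub>R d)) < e / 2"
        using L1dist_convex_combination[OF uv(1,2), of a b c d] convex_bound_lt[OF cd(3,4) uv]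
          by linarith
      ultimately show "u *\<^sub>R a + v *\<^sub>R b \<in> ?T" by blast
    qed
  qed
  moreover
  \<comment> \<open>A sup-norm mesh that amounts to at most e / 2 in L^1(M); the summand 1 covers
    total mass 0.\<close>
  define d where "d = e / (2 * (measure M UNIV + 1))"
  have d: "0 < d" "measure M UNIV * d \<le> e / 2"
    using e measure_nonneg[of M UNIV] unfolding d_def by (auto simp: field_simps add_pos_nonneg)
  have "compact ?K" using C0(1) by (rule finite_imp_compact_convex_hull)
  then obtain C where C: "finite C" "?K \<subseteq> (\<Union>x\<in>C. ball x d)"
    using d(1) unfolding compact_eq_totally_bounded by blast
  ultimately have "\<exists>c\<in>C. L1dist (apply_bcontfun h) (apply_bcontfun c) < e"
      if hS: "h \<in> convex hull S" for h
  proof -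
    obtain k where k: "k \<in> ?K" "L1dist (apply_bcontfun h) (apply_bcontfun k) < e / 2"
      using hS \<open>convex hull S \<subseteq> ?T\<close> by blast
    obtain c where c: "c \<in> C" "norm (k - c) < d" using k(1) C(2)
      by (auto simp: dist_norm norm_minus_commute)
    have "L1dist (apply_bcontfun k) (apply_bcontfun c) \<le> measure M UNIV * norm (k - c)"
      by (rule L1dist_le_norm)
    also have "\<dots> \<le> measure M UNIV * d" using c(2) by (intro mult_left_mono) auto
    finally have "L1dist (apply_bcontfun k) (apply_bcontfun c) \<le> e / 2" using d(2) by simp
    moreover have "L1dist (apply_bcontfun h) (apply_bcontfun c)
        \<le> L1dist (apply_bcontfun h) (apply_bcontfun k) +
            L1dist (apply_bcontfun k) (apply_bcontfun c)"
      by (rule L1dist_triangle) simp_all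
    ultimately show ?thesis using c(1) k(2) by (intro bexI[of _ c]) auto
  qed
  then show ?thesis using that C(1) by blast
qed

end

text \<open>A pointwise limit of continuous functions has continuity points relative to any closed set,
  so it cannot be large on a dense subset and small on another one.\<close>

lemma no_oscillation_on_closed:
  fixes w :: "nat \<Rightarrow> 'a::metric_space CX" and B :: "nat \<Rightarrow> 'a set"
  assumes c: "compact (UNIV :: 'a set)" and D: "closed D" "D \<noteq> {}"
    and w: "\<And>\<omega>. \<omega> \<in> D \<Longrightarrow> (\<lambda>n. apply_bcontfun (w n) \<omega>) \<longlonglongrightarrow> q \<omega>"
    and basis: "\<And>U x. open U \<Longrightarrow> x \<in> U \<Longrightarrow> \<exists>n. x \<in> B n \<and> B n \<subseteq> U"
    and large: "\<And>n. B n \<inter> D \<noteq> {} \<Longrightarrow> \<exists>p\<in>B n \<inter> D. b \<le> q p"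
    and small: "\<And>n. B n \<inter> D \<noteq> {} \<Longrightarrow> \<exists>p\<in>B n \<inter> D. q p \<le> a"
  shows "b \<le> a"
proof (rule ccontr)
  assume "\<not> b \<le> a"
  \<comment> \<open>The comparison of q at y and z runs through w n at y, p and z and meets four
    errors of size at most \<eta>, short of the assumed gap 5 * \<eta>.\<close>
  define \<eta> where "\<eta> = (b - a) / 5"
  have \<eta>: "0 < \<eta>" "b - a = 5 * \<eta>" using \<open>\<not> b \<le> a\<close> unfolding \<eta>_def by auto
  \<comment> \<open>These sets are closed because only continuous functions occur in them, and at
    points of D in \<open>Z n\<close> the function \<open>w n\<close> is within \<eta> of q. Baire
    places a relatively open part of D inside one of them.\<close>
  define Z where "Z n = (\<Inter>k\<in>{n..}. \<Inter>l\<in>{n..}. {\<omega>. \<bar>apply_bcontfun (w k) \<omega> - apply_bcontfun (w l) \<omega>\<bar>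
      \<le> \<eta>})" for n
  have Zc: "closed (Z n)" for n
    unfolding Z_def by (intro closed_INT ballI closed_Collect_le continuous_intros) simp_all
  have cov: "D \<subseteq> (\<Union>n. Z n)"
  proof
    fix \<omega> assume "\<omega> \<in> D"
    then have "Cauchy (\<lambda>n. apply_bcontfun (w n) \<omega>)" using w LIMSEQ_imp_Cauchy by blast
    then obtain n where "\<forall>k\<ge>n. \<forall>l\<ge>n. dist (apply_bcontfun (w k) \<omega>) (apply_bcontfun (w l) \<omega>) < \<eta>"
      using \<eta>(1) unfolding Cauchy_def by blast
    then have "\<omega> \<in> Z n" unfolding Z_def by (auto simp: dist_real_def intro: less_imp_le)
    then show "\<omega> \<in> (\<Union>n. Z n)" by blast
  qed
  have cD: "compact D" using c D(1) by (metis compact_Int_closed inf_top_left)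
  obtain n U where U: "open U" "U \<inter> D \<noteq> {}" "U \<inter> D \<subseteq> Z n"
    by (rule compact_Baire[OF cD D(2) Zc cov], rule that)
  have near: "\<bar>apply_bcontfun (w n) \<omega> - q \<omega>\<bar> \<le> \<eta>" if "\<omega> \<in> U \<inter> D" for \<omega>
  proof (rule LIMSEQ_le_const2)
    show "(\<lambda>k. \<bar>apply_bcontfun (w n) \<omega> - apply_bcontfun (w k) \<omega>\<bar>) \<longlonglongrightarrow> \<bar>apply_bcontfun (w n) \<omega> - q \<omega>\<bar>"
      using w that by (intro tendsto_intros) auto
    have "\<omega> \<in> Z n" using that U(3) by blast
    then show "\<exists>N. \<forall>k\<ge>N. \<bar>apply_bcontfun (w n) \<omega> - apply_bcontfun (w k) \<omega>\<bar> \<le> \<eta>"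
      unfolding Z_def by (intro exI[of _ n]) auto
  qed
  obtain p where p: "p \<in> U" "p \<in> D" using U(2) by blast
  define V where "V = {\<omega>. \<bar>apply_bcontfun (w n) \<omega> - apply_bcontfun (w n) p\<bar> < \<eta>}"
  have "open V" unfolding V_def by (intro open_Collect_less continuous_intros) simp_all
  then have "open (U \<inter> V)" "p \<in> U \<inter> V" using U(1) p \<eta>(1) by (auto simp: V_def)
  then obtain m where m: "p \<in> B m" "B m \<subseteq> U \<inter> V" using basis by blast
  have "B m \<inter> D \<noteq> {}" using m(1) p(2) by blast
  then obtain y z where y: "y \<in> B m \<inter> D" "b \<le> q y" and z: "z \<in> B m \<inter> D" "q z \<le> a"
    using large small by blast
  have "y \<in> U \<inter> D" "z \<in> U \<inter> D" "y \<in> V" "z \<in> V" using y(1) z(1) m(2) by auto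
  then show False using near[of y] near[of z] y(2) z(2) \<eta> unfolding V_def by auto
qed

section \<open>Pointwise limits along filters and integration\<close>

context finite_borel_measure
begin

text \<open>On \<open>Z n\<close> all approximants from n on obey the weak inequalities, so
  \<open>Z n\<close> is closed, and these sets cover the part of K where the strict inequalities
  hold; one of them has positive mass. Removing every \<open>B k\<close> with null trace on it costs
  no mass and leaves a D whose nonempty traces all have positive measure.\<close>

lemma separation_core:
  fixes u v :: "nat \<Rightarrow> 'a CX" and B :: "nat \<Rightarrow> 'a set"
  assumes K: "closed K" "emeasure M (UNIV - K) = 0"
    and u: "\<And>\<omega>. \<omega> \<in> K \<Longrightarrow> (\<lambda>n. apply_bcontfun (u n) \<omega>) \<longlonglongrightarrow> f \<omega>"
    and v: "\<And>\<omega>. \<omega> \<in> K \<Longrightarrow> (\<lambda>n. apply_bcontfun (v n) \<omega>) \<longlonglongrightarrow> g \<omega>"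
    and basis: "\<And>n. open (B n)"
    and neg: "\<not> (AE \<omega> in M. \<not> (f \<omega> > b \<and> g \<omega> < a))"
  obtains D where "closed D" "D \<subseteq> K" "D \<noteq> {}" "\<And>\<omega>. \<omega> \<in> D \<Longrightarrow> b \<le> f \<omega> \<and> g \<omega> \<le> a"
    "\<And>n. B n \<inter> D \<noteq> {} \<Longrightarrow> emeasure M (B n \<inter> D) \<noteq> 0"
proof -
  define Z where "Z n = K \<inter> (\<Inter>m\<in>{n..}. {\<omega>. b \<le> apply_bcontfun (u m) \<omega>} \<inter>
      {\<omega>. apply_bcontfun (v m) \<omega> \<le> a})" for n
  have Zc: "closed (Z n)" for n
    unfolding Z_def by (intro closed_Int K closed_INT ballI closed_Collect_le) simp_all
  have Zm: "C \<in> sets M" if "closed C" for C using that by (simp add: sets_M borel_closed)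
  have Om: "U \<in> sets M" if "open U" for U using that by (simp add: sets_M borel_open)
  have "\<exists>n. emeasure M (Z n) \<noteq> 0"
  proof (rule ccontr)
    assume "\<nexists>n. emeasure M (Z n) \<noteq> 0"
    then have "Z n \<in> null_sets M" for n using Zm[OF Zc] by (auto simp: null_sets_def)
    moreover have "UNIV - K \<in> null_sets M"
      using K(2) Om[OF open_Diff[OF open_UNIV K(1)]] by (simp add: null_sets_def)
    ultimately have null: "(\<Union>n. Z n) \<union> (UNIV - K) \<in> null_sets M" by auto
    have "AE \<omega> in M. \<not> (f \<omega> > b \<and> g \<omega> < a)"
    proof (rule AE_I'[OF null], rule subsetI, rule ccontr)
      fix \<omega> assume "\<omega> \<in> {\<omega> \<in> space M. \<not> \<not> (f \<omega> > b \<and> g \<omega> < a)}" "\<omega> \<notin> (\<Union>n. Z n) \<union> (UNIV - K)"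
      then have \<omega>: "b < f \<omega>" "g \<omega> < a" "\<omega> \<notin> (\<Union>n. Z n)" "\<omega> \<in> K" by auto
      have "\<forall>\<^sub>F n in sequentially. b < apply_bcontfun (u n) \<omega> \<and> apply_bcontfun (v n) \<omega> < a"
        using order_tendstoD(1)[OF u[OF \<omega>(4)] \<omega>(1)] order_tendstoD(2)[OF v[OF \<omega>(4)] \<omega>(2)]
        by (rule eventually_conj)
      then obtain n where "\<forall>m\<ge>n. b < apply_bcontfun (u m) \<omega> \<and> apply_bcontfun (v m) \<omega> < a"
        unfolding eventually_sequentially by blast
      then have "\<omega> \<in> Z n" using \<omega>(4) unfolding Z_def by (auto simp: less_imp_le)
      then show False using \<omega>(3) by blast
    qed
    then show False using neg by blast
  qed
  then obtain n where n: "emeasure M (Z n) \<noteq> 0" by blast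
  define N where "N = (\<Union>k\<in>{k. emeasure M (B k \<inter> Z n) = 0}. B k)"
  define D where "D = Z n - N"
  have Nopen: "open N" unfolding N_def using basis by auto
  have null: "Z n \<inter> N \<in> null_sets M"
  proof -
    have "(\<Union>k\<in>{k. emeasure M (B k \<inter> Z n) = 0}. B k \<inter> Z n) \<in> null_sets M"
      by (rule null_sets_UN') (auto simp: null_sets_def intro!: sets.Int Om[OF basis] Zm[OF Zc])
    moreover have "(\<Union>k\<in>{k. emeasure M (B k \<inter> Z n) = 0}. B k \<inter> Z n) = Z n \<inter> N" unfolding N_def
      by blast
    ultimately show ?thesis by simp
  qed
  have same: "emeasure M (C \<inter> D) = emeasure M (C \<inter> Z n)" if C: "C \<in> sets M" for C
  proof -
    have eq: "C \<inter> D = (C \<inter> Z n) - (Z n \<inter> N)" unfolding D_def by blast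
    show ?thesis unfolding eq
      by (rule emeasure_Diff_null_set[OF null]) (intro sets.Int C Zm[OF Zc])
  qed
  have UM: "UNIV \<in> sets M" by (simp add: sets_M)
  show ?thesis
  proof (rule that)
    show "closed D" unfolding D_def using Zc Nopen by (rule closed_Diff)
    show "D \<subseteq> K" unfolding D_def Z_def by blast
    show "D \<noteq> {}" using same[OF UM] n by auto
    show "b \<le> f \<omega> \<and> g \<omega> \<le> a" if "\<omega> \<in> D" for \<omega>
    proof -
      have \<omega>: "\<omega> \<in> K" "\<And>m. m \<ge> n \<Longrightarrow> b \<le> apply_bcontfun (u m) \<omega>"
          "\<And>m. m \<ge> n \<Longrightarrow> apply_bcontfun (v m) \<omega> \<le> a"
        using that unfolding D_def Z_def by auto
      show ?thesis
        using LIMSEQ_le_const[OF u[OF \<omega>(1)], of b] LIMSEQ_le_const2[OF v[OF \<omega>(1)], of a] \<omega>(2,3)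
          by blast
    qed
    show "emeasure M (B k \<inter> D) \<noteq> 0" if "B k \<inter> D \<noteq> {}" for k
    proof
      assume "emeasure M (B k \<inter> D) = 0"
      then have "emeasure M (B k \<inter> Z n) = 0" using same[OF Om[OF basis]] by simp
      then have "B k \<subseteq> N" unfolding N_def by blast
      then show False using that unfolding D_def by blast
    qed
  qed
qed

text \<open>If the L^1 cluster point g differs from f, \<open>separation_core\<close> gives a closed
  D on which their values are kept apart. Late indices can be chosen so that the resulting sequence
  tends to f on a countable dense subset of D and to g in L^1(M); its limit q then oscillates on
  every piece of D. The set K is there because, for an invariant measure of a subsystem, pointwise
  limits are known on the subsystem.\<close>

theorem L1_convergence_along_filter:
  fixes h :: "'i \<Rightarrow> 'a CX" and u :: "nat \<Rightarrow> 'a CX"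
  assumes c: "compact (UNIV :: 'a set)"
    and H: "ptwise_precompact H" "\<And>x. x \<in> H \<Longrightarrow> norm x \<le> b"
    and K: "closed K" "emeasure M (UNIV - K) = 0"
    and ev: "\<forall>\<^sub>F i in F. h i \<in> H"
    and lim: "\<And>\<omega>. \<omega> \<in> K \<Longrightarrow> ((\<lambda>i. apply_bcontfun (h i) \<omega>) \<longlongrightarrow> f \<omega>) F"
    and u: "\<And>n. norm (u n) \<le> b" "\<And>\<omega>. (\<lambda>n. apply_bcontfun (u n) \<omega>) \<longlonglongrightarrow> f \<omega>"
  shows "((\<lambda>i. L1dist (apply_bcontfun (h i)) f) \<longlongrightarrow> 0) F"
proof (rule ccontr)
  assume "\<not> ?thesis"
  then obtain \<epsilon> where \<epsilon>: "0 < \<epsilon>" "\<not> (\<forall>\<^sub>F i in F. L1dist (apply_bcontfun (h i)) f < \<epsilon>)"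
    unfolding tendsto_iff by (auto simp: dist_real_def L1dist_nonneg)
  have fi: "integrable M f" using ptwise_limit_bounded(3)[OF u] .
  have tri: "L1dist p r \<le> L1dist p q + L1dist q r"
      if "integrable M p" "integrable M q" "integrable M r" for p q r
    using that by (rule L1dist_triangle)
  let ?d = "\<lambda>i c. L1dist (apply_bcontfun (h i)) (apply_bcontfun c)"
  define Q where "Q = {i. h i \<in> H \<and> \<epsilon> \<le> L1dist (apply_bcontfun (h i)) f}"
  have freqQ: "\<exists>\<^sub>F i in F. i \<in> Q"
    using frequently_eventually_frequently[of
        "\<lambda>i. \<not> L1dist (apply_bcontfun (h i)) f < \<epsilon>" F, OF _ ev] \<epsilon>(2)
    unfolding Q_def by (simp add: not_eventually not_less conj_commute)
  have tb: "L1_totally_bounded H" by (rule ptwise_precompact_totally_bounded[OF H])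
  \<comment> \<open>Frequent index sets act as a subnet: finitely many L^1 balls of radius 2^-n
    cover H, so one of them is visited frequently, and the next index set is cut down to it.\<close>
  have "\<exists>A. \<forall>n. ((\<exists>\<^sub>F i in F. i \<in> A n) \<and> A n \<subseteq> Q) \<and>
      (A (Suc n) \<subseteq> A n \<and> (\<exists>c. \<forall>i\<in>A (Suc n). ?d i c < (1/2)^n))"
  proof (rule dependent_nat_choice)
    show "\<exists>x. (\<exists>\<^sub>F i in F. i \<in> x) \<and> x \<subseteq> Q" using freqQ by blast
    fix A and n :: nat assume A: "(\<exists>\<^sub>F i in F. i \<in> A) \<and> A \<subseteq> Q"
    obtain C where C: "finite C" "\<And>x. x \<in> H \<Longrightarrow> \<exists>c\<in>C. L1dist (apply_bcontfun x) (apply_bcontfun c)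
        < (1/2)^n"
      using tb unfolding L1_totally_bounded_def
        by (metis half_gt_zero_iff zero_less_one zero_less_power)
    have "\<exists>\<^sub>F i in F. \<exists>c\<in>C. i \<in> A \<and> ?d i c < (1/2)^n"
      using A C(2) unfolding Q_def by (intro frequently_elim1[OF conjunct1[OF A]]) blast
    then have "\<exists>c\<in>C. \<exists>\<^sub>F i in F. i \<in> A \<and> ?d i c < (1/2)^n"
      by (rule frequently_bex_finite[OF C(1)])
    then obtain c where c: "\<exists>\<^sub>F i in F. i \<in> A \<and> ?d i c < (1/2)^n" by blast
    show "\<exists>A'. ((\<exists>\<^sub>F i in F. i \<in> A') \<and> A' \<subseteq> Q) \<and> (A' \<subseteq> A \<and> (\<exists>c. \<forall>i\<in>A'. ?d i c < (1/2)^n))"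
      by (rule exI[of _ "{i \<in> A. ?d i c < (1/2)^n}"]) (use A c in auto)
  qed
  then obtain A where A: "\<And>n. \<exists>\<^sub>F i in F. i \<in> A n" "\<And>n. A n \<subseteq> Q" "\<And>n. A (Suc n) \<subseteq> A n"
    and "\<And>n. \<exists>c. \<forall>i\<in>A (Suc n). ?d i c < (1/2)^n" by blast
  then obtain cc where cc: "\<And>n i. i \<in> A (Suc n) \<Longrightarrow> ?d i (cc n) < (1/2)^n" by metis
  have Adec: "A n \<subseteq> A m" if "m \<le> n" for m n using A(3) that by (rule lift_Suc_antimono_le)
  have close: "L1dist (apply_bcontfun (h i)) (apply_bcontfun (h j)) < 2 * (1/2)^n"
    if "i \<in> A (Suc n)" "j \<in> A (Suc n)" for i j n
    using tri[of "apply_bcontfun (h i)" "apply_bcontfun (cc n)" "apply_bcontfun (h j)"]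
      cc[OF that(1)] cc[OF that(2)] L1dist_commute[of "apply_bcontfun (h j)"] by simp
  have AH: "i \<in> A n \<Longrightarrow> h i \<in> H" "i \<in> A n \<Longrightarrow> \<epsilon> \<le> L1dist (apply_bcontfun (h i)) f" for i n
    using A(2)[of n] unfolding Q_def by auto
  have nz: "(\<lambda>n. 2 * (1/2)^n :: real) \<longlonglongrightarrow> 0"
    using tendsto_mult_right_zero[OF LIMSEQ_power_zero[of "1/2 :: real"]] by simp

  have "\<forall>n. \<exists>i. i \<in> A (Suc n)" using frequently_ex[OF A(1)] by blast
  then obtain i0 where i0: "\<And>n. i0 n \<in> A (Suc n)" by metis
  then have "range (\<lambda>n. h (i0 n)) \<subseteq> H" using AH(1) by blast
  then obtain \<sigma> :: "nat \<Rightarrow> nat" where \<sigma>: "strict_mono \<sigma>"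
      "\<And>\<omega>. convergent (\<lambda>k. apply_bcontfun (h (i0 (\<sigma> k))) \<omega>)"
    using H(1) unfolding ptwise_precompact_def by blast
  define v where "v k = h (i0 (\<sigma> k))" for k
  define g where "g \<omega> = lim (\<lambda>k. apply_bcontfun (v k) \<omega>)" for \<omega>
  have vg: "(\<lambda>k. apply_bcontfun (v k) \<omega>) \<longlonglongrightarrow> g \<omega>" for \<omega>
    using \<sigma>(2) unfolding g_def v_def by (simp add: convergent_LIMSEQ_iff)
  have vb: "norm (v k) \<le> b" for k unfolding v_def using H(2) AH(1) i0 by blast
  have gi: "integrable M g" using ptwise_limit_bounded(3)[OF vb vg] .
  have vg1: "(\<lambda>k. L1dist (apply_bcontfun (v k)) g) \<longlonglongrightarrow> 0" using L1dist_ptwise[OF vb vg] .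
  \<comment> \<open>Members of \<open>A (Suc n)\<close> share the centre \<open>cc n\<close>, whence
    the radius 2 * 2^-n; it passes to g because the sequence v is eventually drawn from
    \<open>A (Suc n)\<close>.\<close>
  have toward_g: "L1dist (apply_bcontfun (h i)) g \<le> 2 * (1/2)^n" if "i \<in> A (Suc n)" for i n
  proof -
    have "L1dist (apply_bcontfun (h i)) g \<le> 2 * (1/2)^n + L1dist (apply_bcontfun (v k)) g"
        if "k \<ge> n" for k
    proof -
      have "n \<le> \<sigma> k" using that seq_suble[OF \<sigma>(1), of k] by simp
      then have "i0 (\<sigma> k) \<in> A (Suc n)" using i0[of "\<sigma> k"] Adec[of "Suc n" "Suc (\<sigma> k)"] by auto
      then have "L1dist (apply_bcontfun (h i)) (apply_bcontfun (v k)) < 2 * (1/2)^n"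
        unfolding v_def using close \<open>i \<in> A (Suc n)\<close> by blast
      then show ?thesis using tri[of "apply_bcontfun (h i)" "apply_bcontfun (v k)" g] gi by simp
    qed
    moreover have "(\<lambda>k. 2 * (1/2)^n + L1dist (apply_bcontfun (v k)) g) \<longlonglongrightarrow> 2 * (1/2)^n + 0"
      by (intro tendsto_intros vg1)
    ultimately show ?thesis using LIMSEQ_le_const by fastforce
  qed
  have "\<epsilon> \<le> L1dist g f"
  proof -
    have "\<epsilon> \<le> L1dist (apply_bcontfun (v k)) g + L1dist g f" for k
      using AH(2)[OF i0[of "\<sigma> k"]] tri[of "apply_bcontfun (v k)" g f] gi fi unfolding v_def by simp
    moreover have "(\<lambda>k. L1dist (apply_bcontfun (v k)) g + L1dist g f) \<longlonglongrightarrow> 0 + L1dist g f"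
      by (intro tendsto_intros vg1)
    ultimately show ?thesis using LIMSEQ_le_const by fastforce
  qed
  then have notAE: "\<not> (AE \<omega> in M. g \<omega> = f \<omega>)"
    using \<epsilon>(1) integral_cong_AE[of "\<lambda>\<omega>. \<bar>g \<omega> - f \<omega>\<bar>" M "\<lambda>_. 0"] fi gi unfolding L1dist_def by auto

  obtain B :: "nat \<Rightarrow> 'a set" where B: "\<And>n. open (B n)"
      "\<And>U x. open U \<Longrightarrow> x \<in> U \<Longrightarrow> \<exists>n. x \<in> B n \<and> B n \<subseteq> U"
    using compact_countable_basis[OF c] by blast
  \<comment> \<open>The factor s is later 1 or -1, for the regions f > g and f < g
    respectively.\<close>
  have core: "\<beta> \<le> \<alpha>"
    if neg: "\<not> (AE \<omega> in M. \<not> (s * f \<omega> > \<beta> \<and> s * g \<omega> < \<alpha>))" for s \<alpha> \<beta> :: real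
  proof -
    have su: "(\<lambda>n. apply_bcontfun (s *\<^sub>R u n) \<omega>) \<longlonglongrightarrow> s * f \<omega>"
      and sv: "(\<lambda>n. apply_bcontfun (s *\<^sub>R v n) \<omega>) \<longlonglongrightarrow> s * g \<omega>" for \<omega>
      using tendsto_mult[OF tendsto_const u(2)] tendsto_mult[OF tendsto_const vg] by simp_all
    obtain D where D: "closed D" "D \<subseteq> K" "D \<noteq> {}" "\<And>\<omega>. \<omega> \<in> D \<Longrightarrow> \<beta> \<le> s * f \<omega> \<and> s * g \<omega> \<le> \<alpha>"
      "\<And>n. B n \<inter> D \<noteq> {} \<Longrightarrow> emeasure M (B n \<inter> D) \<noteq> 0"
      by (rule separation_core[OF K su sv B(1) neg], rule that)
    \<comment> \<open>The points e n are dense in D, as they meet every basic set that meets D; for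
      a basic set that misses D, e n is an arbitrary point of D.\<close>
    have "\<forall>n. \<exists>p. p \<in> D \<and> (B n \<inter> D \<noteq> {} \<longrightarrow> p \<in> B n)" using D(3) by blast
    then obtain e where e: "\<And>n. e n \<in> D" "\<And>n. B n \<inter> D \<noteq> {} \<Longrightarrow> e n \<in> B n" by metis
    \<comment> \<open>A frequent set meets an eventual one: the chosen function is close to f at e
      0, ..., e n while its L^1 distance from g is at most 2 * 2^-n.\<close>
    have "\<exists>j. j \<in> A (Suc n) \<and> (\<forall>m\<in>{..n}. dist (apply_bcontfun (h j) (e m)) (f (e m)) < 1 / Suc n)"
        for n
    proof -
      have "\<forall>\<^sub>F i in F. \<forall>m\<in>{..n}. dist (apply_bcontfun (h i) (e m)) (f (e m)) < 1 / Suc n"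
        using e(1) D(2) by (intro eventually_ball_finite ballI tendstoD[OF lim]) auto
      from frequently_ex[OF frequently_eventually_frequently[OF A(1) this]] show ?thesis by blast
    qed
    then obtain j where j: "\<And>n. j n \<in> A (Suc n)"
      "\<And>n m. m \<le> n \<Longrightarrow> dist (apply_bcontfun (h (j n)) (e m)) (f (e m)) < 1 / Suc n"
        by (metis atMost_iff)
    have "range (\<lambda>n. h (j n)) \<subseteq> H" using AH(1) j(1) by blast
    then obtain \<rho> :: "nat \<Rightarrow> nat" where \<rho>: "strict_mono \<rho>"
        "\<And>\<omega>. convergent (\<lambda>k. apply_bcontfun (h (j (\<rho> k))) \<omega>)"
      using H(1) unfolding ptwise_precompact_def by blast
    define w where "w k = h (j (\<rho> k))" for k
    define q where "q \<omega> = lim (\<lambda>k. apply_bcontfun (w k) \<omega>)" for \<omega>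
    have wq: "(\<lambda>k. apply_bcontfun (w k) \<omega>) \<longlonglongrightarrow> q \<omega>" for \<omega>
      using \<rho>(2) unfolding q_def w_def by (simp add: convergent_LIMSEQ_iff)
    have wb: "norm (w k) \<le> b" for k unfolding w_def using H(2) AH(1) j(1) by blast
    have qi: "integrable M q" using ptwise_limit_bounded(3)[OF wb wq] .
    have wq1: "(\<lambda>k. L1dist (apply_bcontfun (w k)) q) \<longlonglongrightarrow> 0" using L1dist_ptwise[OF wb wq] .
    have "L1dist q g \<le> L1dist (apply_bcontfun (w k)) q + 2 * (1/2)^(\<rho> k)" for k
      using tri[of q "apply_bcontfun (w k)" g] qi gi toward_g[OF j(1)[of "\<rho> k"]]
        L1dist_commute[of q] unfolding w_def by simp
    moreover have "(\<lambda>k. L1dist (apply_bcontfun (w k)) q + 2 * (1/2)^(\<rho> k)) \<longlonglongrightarrow> 0 + 0"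
      using LIMSEQ_subseq_LIMSEQ[OF nz \<rho>(1)] by (intro tendsto_add wq1) (simp add: o_def)
    ultimately have "L1dist q g \<le> 0" using LIMSEQ_le_const by fastforce
    then have "L1dist q g = 0" using L1dist_nonneg[of q g] by simp
    then have "AE \<omega> in M. \<bar>q \<omega> - g \<omega>\<bar> = 0"
      unfolding L1dist_def using qi gi by (subst (asm) integral_nonneg_eq_0_iff_AE) auto
    then have qg: "AE \<omega> in M. q \<omega> = g \<omega>" by simp
    have qe: "q (e m) = f (e m)" for m
    proof -
      have "(\<lambda>k. dist (apply_bcontfun (w k) (e m)) (f (e m))) \<longlonglongrightarrow> 0"
      proof (rule tendsto_sandwich[where f = "\<lambda>_. 0" and h = "\<lambda>k. 1 / Suc (\<rho> k)"])
        have "dist (apply_bcontfun (w k) (e m)) (f (e m)) \<le> 1 / Suc (\<rho> k)" if "k \<ge> m" for k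
          using j(2)[of m "\<rho> k"] that seq_suble[OF \<rho>(1), of k] unfolding w_def by simp
        then show "\<forall>\<^sub>F k in sequentially. dist (apply_bcontfun (w k) (e m)) (f (e m))
            \<le> 1 / Suc (\<rho> k)"
          unfolding eventually_sequentially by blast
        show "(\<lambda>k. 1 / real (Suc (\<rho> k))) \<longlonglongrightarrow> 0"
          using LIMSEQ_subseq_LIMSEQ[OF LIMSEQ_Suc[OF lim_1_over_n] \<rho>(1)] by (simp add: o_def)
      qed auto
      then have "(\<lambda>k. apply_bcontfun (w k) (e m)) \<longlonglongrightarrow> f (e m)" by (rule tendsto_dist_iff[THEN iffD2])
      then show ?thesis using wq LIMSEQ_unique by blast
    qed
    show "\<beta> \<le> \<alpha>"
    proof (rule no_oscillation_on_closed[OF c D(1,3) _ B(2)])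
      show "(\<lambda>n. apply_bcontfun (s *\<^sub>R w n) \<omega>) \<longlonglongrightarrow> s * q \<omega>" for \<omega>
        using tendsto_mult[OF tendsto_const wq] by simp
      fix n assume ne: "B n \<inter> D \<noteq> {}"
      show "\<exists>p\<in>B n \<inter> D. \<beta> \<le> s * q p"
        using e[of n] ne D(4)[OF e(1)[of n]] qe[of n] by (intro bexI[of _ "e n"]) auto
      \<comment> \<open>q agrees with g almost everywhere and the trace of \<open>B n\<close> on D
        is not null, so some point of it carries the small value of g.\<close>
      show "\<exists>p\<in>B n \<inter> D. s * q p \<le> \<alpha>"
      proof (rule ccontr)
        assume "\<not> ?thesis"
        then have "\<And>p. p \<in> B n \<inter> D \<Longrightarrow> q p \<noteq> g p" using D(4) by force
        then have "AE \<omega> in M. \<omega> \<notin> B n \<inter> D" using qg by (auto elim: eventually_mono)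
        moreover have "B n \<inter> D \<in> sets M" using B(1) D(1)
          by (simp add: sets_M borel_open borel_closed sets.Int)
        ultimately have "emeasure M (B n \<inter> D) = 0"
          using AE_iff_measurable[of "B n \<inter> D" M "\<lambda>\<omega>. \<omega> \<notin> B n \<inter> D"] space_M by auto
        then show False using D(5)[OF ne] by blast
      qed
    qed
  qed
  \<comment> \<open>Different reals are separated by a pair of rationals, so countably many null
    sets account for all points where f and g differ.\<close>
  have "AE \<omega> in M. \<forall>p :: rat \<times> rat. fst p < snd p \<longrightarrow>
      \<not> (f \<omega> > of_rat (snd p) \<and> g \<omega> < of_rat (fst p)) \<and>
          \<not> (- f \<omega> > - of_rat (fst p) \<and> - g \<omega> < - of_rat (snd p))"
  proof (subst AE_all_countable, intro allI)
    fix p :: "rat \<times> rat"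
    show "AE \<omega> in M. fst p < snd p \<longrightarrow>
      \<not> (f \<omega> > of_rat (snd p) \<and> g \<omega> < of_rat (fst p)) \<and>
          \<not> (- f \<omega> > - of_rat (fst p) \<and> - g \<omega> < - of_rat (snd p))"
    proof (cases "fst p < snd p")
      case True
      then have "real_of_rat (fst p) < of_rat (snd p)" by (simp add: of_rat_less)
      then have "AE \<omega> in M. \<not> (f \<omega> > of_rat (snd p) \<and> g \<omega> < of_rat (fst p))"
        "AE \<omega> in M. \<not> (- f \<omega> > - of_rat (fst p) \<and> - g \<omega> < - of_rat (snd p))"
        using core[where s = 1 and \<beta> = "of_rat (snd p)" and \<alpha> = "of_rat (fst p)"]
          core[where s = "-1" and \<beta> = "- of_rat (fst p)" and \<alpha> = "- of_rat (snd p)"] by auto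
      then show ?thesis by eventually_elim simp
    qed simp
  qed
  then have "AE \<omega> in M. g \<omega> = f \<omega>"
  proof eventually_elim
    case (elim \<omega>)
    show ?case
    proof (rule ccontr)
      assume "g \<omega> \<noteq> f \<omega>"
      then consider "g \<omega> < f \<omega>" | "f \<omega> < g \<omega>" by linarith
      then show False
      proof cases
        case 1
        then obtain x where x: "g \<omega> < of_rat x" "of_rat x < f \<omega>" using of_rat_dense by blast
        then obtain y where y: "of_rat x < (of_rat y :: real)" "of_rat y < f \<omega>" using of_rat_dense
          by blast
        then show False using elim[rule_format, of "(x, y)"] x by (simp add: of_rat_less)
      next
        case 2
        then obtain x where x: "f \<omega> < of_rat x" "of_rat x < g \<omega>" using of_rat_dense by blast
        then obtain y where y: "of_rat x < (of_rat y :: real)" "of_rat y < g \<omega>" using of_rat_dense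
          by blast
        then show False using elim[rule_format, of "(x, y)"] x by (simp add: of_rat_less)
      qed
    qed
  qed
  then show False using notAE by blast
qed

end

section \<open>Ergodic sequences\<close>

text \<open>Toggling m is an involution on the subsets of A that exchanges those containing exactly
  one of m and n with the others, so each kind makes up half.\<close>

lemma sum_Pow_exactly_one:
  assumes "m \<in> A" "n \<in> A" "m \<noteq> n" "finite A"
  shows "(\<Sum>S\<in>Pow A. of_bool ((m \<in> S) \<noteq> (n \<in> S)) :: real) = 2 ^ card A / 2"
proof -
  define flip where "flip S = (if m \<in> S then S - {m} else insert m S)" for S
  have ff: "flip (flip S) = S" for S unfolding flip_def by auto
  have fP: "flip S \<in> Pow A" if "S \<in> Pow A" for S using that assms(1) unfolding flip_def by auto
  have "bij_betw flip (Pow A) (Pow A)"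
    by (rule bij_betwI[where g = flip]) (auto simp: ff intro: fP[unfolded Pow_iff, THEN subsetD]
        dest: fP)
  then have "(\<Sum>S\<in>Pow A. of_bool ((m \<in> flip S) \<noteq> (n \<in> flip S)) :: real)
      = (\<Sum>S\<in>Pow A. of_bool ((m \<in> S) \<noteq> (n \<in> S)))"
    by (rule sum.reindex_bij_betw)
  moreover have "((m \<in> flip S) \<noteq> (n \<in> flip S)) \<longleftrightarrow> \<not> ((m \<in> S) \<noteq> (n \<in> S))" for S
    using assms(3) unfolding flip_def by auto
  ultimately have "(\<Sum>S\<in>Pow A. of_bool (\<not> ((m \<in> S) \<noteq> (n \<in> S))) :: real)
      = (\<Sum>S\<in>Pow A. of_bool ((m \<in> S) \<noteq> (n \<in> S)))" by simp
  moreover have "(\<Sum>S\<in>Pow A. of_bool (\<not> ((m \<in> S) \<noteq> (n \<in> S))) :: real)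
      + (\<Sum>S\<in>Pow A. of_bool ((m \<in> S) \<noteq> (n \<in> S))) = (\<Sum>S\<in>Pow A. 1)"
    unfolding sum.distrib[symmetric] by (rule sum.cong) auto
  moreover have "(\<Sum>S\<in>Pow A. 1 :: real) = 2 ^ card A"
    using assms(4) by (simp add: card_Pow)
  ultimately show ?thesis by simp
qed

text \<open>Averaging over the \<open>2\<^sup>N\<close> sign patterns of an independent sequence turns it into
  Rademacher-like random variables, which are uniformly separated in mean.\<close>

lemma independent_imp_L1_separated:
  fixes z :: "nat \<Rightarrow> 'a::metric_space CX"
  assumes c: "compact (UNIV :: 'a set)" and rs: "r < s"
    and ind: "\<And>k c. \<exists>t. \<forall>i<k. if c i then apply_bcontfun (z i) t > s else apply_bcontfun (z i) t
        < r"
  obtains M where "prob_space M" "sets M = sets borel"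
    "\<And>m n. m \<noteq> n \<Longrightarrow> (s - r) / 2 \<le> (\<integral>\<omega>. \<bar>apply_bcontfun (z m) \<omega> - apply_bcontfun (z n) \<omega>\<bar> \<partial>M)"
proof -
  have "\<exists>t. \<forall>i<N. if i \<in> S then apply_bcontfun (z i) t > s else apply_bcontfun (z i) t < r" for N S
    using ind[where c = "\<lambda>i. i \<in> S"] by blast
  then obtain t where t: "\<And>N S i. i < N \<Longrightarrow> if i \<in> S then apply_bcontfun (z i) (t N S) > s else
      apply_bcontfun (z i) (t N S) < r"
    by metis
  \<comment> \<open>The average over 2^N sample points, one for each sign pattern of the first N
    functions. Half of the patterns give m and n different signs, and each of these contributes more
    than s - r; hence the constant (s - r) / 2.\<close>
  define L where "L N x = (\<Sum>S\<in>Pow {..<N}. apply_bcontfun x (t N S)) / 2 ^ N"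
    for N :: nat and x :: "'a CX"
  have st: "state (L N)" for N
    unfolding state_def
  proof (intro conjI allI impI)
    show "linear (L N)" unfolding L_def
      by (rule linearI) (simp_all add: sum.distrib add_divide_distrib flip: sum_distrib_left)
    show "L N (const_bcontfun 1) = 1" unfolding L_def by (simp add: card_Pow)
  qed (auto simp: L_def intro!: divide_nonneg_nonneg sum_nonneg)
  define a where "a m n = Bcontfun (\<lambda>\<omega>. \<bar>apply_bcontfun (z m) \<omega> - apply_bcontfun (z n) \<omega>\<bar>)" for m n
  have a: "apply_bcontfun (a m n) \<omega> = \<bar>apply_bcontfun (z m) \<omega> - apply_bcontfun (z n) \<omega>\<bar>" for m n \<omega>
    unfolding a_def by (subst apply_Bcontfun[OF c]) (auto intro!: continuous_intros)
  have La: "(s - r) / 2 \<le> L N (a m n)" if mn: "m \<noteq> n" "m < N" "n < N" for m n N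
  proof -
    have "(s - r) * (2 ^ N / 2) = (\<Sum>S\<in>Pow {..<N}. (s - r) * of_bool ((m \<in> S) \<noteq> (n \<in> S)))"
      using sum_Pow_exactly_one[of m "{..<N}" n] mn by (simp flip: sum_distrib_left)
    also have "\<dots> \<le> (\<Sum>S\<in>Pow {..<N}. apply_bcontfun (a m n) (t N S))"
    proof (rule sum_mono)
      fix S
      show "(s - r) * of_bool ((m \<in> S) \<noteq> (n \<in> S)) \<le> apply_bcontfun (a m n) (t N S)"
        using t[OF mn(2), of S] t[OF mn(3), of S] unfolding a by (cases "m \<in> S"; cases "n \<in> S") auto
    qed
    finally show ?thesis unfolding L_def by (simp add: field_simps)
  qed
  \<comment> \<open>For fixed m and n the estimate holds for all N beyond both, so a single
    weak-star limit serves all pairs.\<close>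
  obtain \<sigma> :: "nat \<Rightarrow> nat" and L' where \<sigma>: "strict_mono \<sigma>" and L': "state L'"
    and lim: "\<And>x. (\<lambda>k. L (\<sigma> k) x) \<longlonglongrightarrow> L' x"
    by (rule states_subsequence[OF c st], rule that)
  obtain M where M: "prob_space M" "sets M = sets borel" "\<And>x. L' x = (\<integral>\<omega>. apply_bcontfun x \<omega> \<partial>M)"
    by (rule state_measure[OF c L'], rule that)
  have "(s - r) / 2 \<le> (\<integral>\<omega>. \<bar>apply_bcontfun (z m) \<omega> - apply_bcontfun (z n) \<omega>\<bar> \<partial>M)" if mn: "m \<noteq> n"
      for m n
  proof -
    have "(s - r) / 2 \<le> L (\<sigma> k) (a m n)" if "k \<ge> Suc (max m n)" for k
      using La[OF mn, of "\<sigma> k"] seq_suble[OF \<sigma>, of k] that by auto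
    then have "(s - r) / 2 \<le> L' (a m n)" using LIMSEQ_le_const[OF lim] by blast
    then show ?thesis unfolding M(3) a .
  qed
  then show ?thesis using that M(1,2) by blast
qed

section \<open>Tame systems: precompact hulls and convergent Cesaro means\<close>

context dynamical_system
begin

lemma tame_orb_ptwise_precompact:
  assumes "tame \<phi>"
  shows "ptwise_precompact (orb x)"
  unfolding ptwise_precompact_def
proof (intro allI impI)
  fix y :: "nat \<Rightarrow> 'a CX" assume "range y \<subseteq> orb x"
  then have "\<forall>n. \<exists>m. y n = koop m x" unfolding orb_def by auto
  then obtain m where m: "\<And>n. y n = koop (m n) x" by metis
  obtain \<sigma> :: "nat \<Rightarrow> nat" where "strict_mono \<sigma>"
      "\<And>\<omega>. convergent (\<lambda>k. apply_bcontfun x ((\<phi> ^^ m (\<sigma> k)) \<omega>))"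
    by (rule tame_orbit_subsequence[OF assms, of x m], rule that)
  then show "\<exists>\<sigma> :: nat \<Rightarrow> nat. strict_mono \<sigma> \<and> (\<forall>\<omega>. convergent (\<lambda>k. apply_bcontfun (y (\<sigma> k)) \<omega>))"
    by (auto simp: m)
qed

text \<open>Tameness speaks of subsequences of the orbit, not of sequences of convex combinations.
  The bridge is L^1(M), where total boundedness survives the convex hull.\<close>

lemma tame_hull_ptwise_precompact:
  assumes tame: "tame \<phi>"
  shows "ptwise_precompact (convex hull (orb x))"
  unfolding ptwise_precompact_def
proof (intro allI impI)
  fix y :: "nat \<Rightarrow> 'a CX" assume y: "range y \<subseteq> convex hull (orb x)"
  define f where "f n \<omega> = apply_bcontfun (y n) \<omega>" for n \<omega>
  have "\<bar>f n \<omega>\<bar> \<le> norm x" for n \<omega>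
    using abs_le_norm_bcontfun[of "y n" \<omega>] hull_orb_norm_le[of "y n" x] y unfolding f_def
    by (metis order_trans range_subsetD)
  then show "\<exists>\<sigma> :: nat \<Rightarrow> nat. strict_mono \<sigma> \<and> (\<forall>\<omega>. convergent (\<lambda>k. apply_bcontfun (y (\<sigma> k)) \<omega>))"
  proof (cases f rule: rosenthal_dichotomy)
    case (1 \<sigma>)
    then show ?thesis unfolding f_def by blast
  next
    case (2 r s \<sigma>)
    define z where "z i = y (\<sigma> i)" for i
    have ind: "\<exists>t. \<forall>i<k. if c i then apply_bcontfun (z i) t > s else apply_bcontfun (z i) t < r"
        for k c
      using 2(3) unfolding f_def z_def .
    obtain M where M: "prob_space M" "sets M = sets borel" and
      sep: "\<And>m n. m \<noteq> n \<Longrightarrow> (s - r) / 2 \<le> (\<integral>\<omega>. \<bar>apply_bcontfun (z m) \<omega> - apply_bcontfun (z n) \<omega>\<bar> \<partial>M)"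
      by (rule independent_imp_L1_separated[OF compact_UNIV 2(1) ind], rule that)
    interpret finite_borel_measure M
      using M prob_space.finite_measure by (simp add: finite_borel_measure_def
          finite_borel_measure_axioms_def)
    have tb: "L1_totally_bounded (orb x)"
      by (rule ptwise_precompact_totally_bounded[OF tame_orb_ptwise_precompact[OF tame],
          where B = "norm x"])
         (auto simp: orb_def norm_koop_le)
    \<comment> \<open>With this radius two functions that share a net point would be closer than (s
      - r) / 2.\<close>
    have e: "0 < (s - r) / 4" using 2(1) by simp
    obtain C where C: "finite C" "\<And>h. h \<in> convex hull (orb x) \<Longrightarrow>
        \<exists>c\<in>C. L1dist (apply_bcontfun h) (apply_bcontfun c) < (s - r) / 4"
      by (rule L1_net_convex_hull[OF tb e], rule that)
    have "\<forall>n. \<exists>c. c \<in> C \<and> L1dist (apply_bcontfun (z n)) (apply_bcontfun c) < (s - r) / 4"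
      using C(2) y unfolding z_def by blast
    then obtain c where c: "\<And>n. c n \<in> C" "\<And>n. L1dist (apply_bcontfun (z n)) (apply_bcontfun (c n))
        < (s - r) / 4"
      by metis
    have "range c \<subseteq> C" using c(1) by blast
    then have "\<not> inj c" using C(1) finite_subset finite_imageD infinite_UNIV_nat by metis
    then obtain m n where mn: "m \<noteq> n" "c m = c n" unfolding inj_def by blast
    have "L1dist (apply_bcontfun (z m)) (apply_bcontfun (z n))
        \<le> L1dist (apply_bcontfun (z m)) (apply_bcontfun (c m)) +
            L1dist (apply_bcontfun (c m)) (apply_bcontfun (z n))"
      by (rule L1dist_triangle) simp_all
    also have "\<dots> < (s - r) / 4 + (s - r) / 4"
      using c(2)[of m] c(2)[of n] mn(2) L1dist_commute[of "apply_bcontfun (c m)"] by simp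
    finally have "L1dist (apply_bcontfun (z m)) (apply_bcontfun (z n)) < (s - r) / 2" by simp
    then show ?thesis using sep[OF mn(1)] unfolding L1dist_def by simp
  qed
qed

text \<open>For the measure that dominates \<mu>, bounded pointwise convergence is L^1 convergence,
  so the values of \<mu> form a Cauchy sequence.\<close>

lemma dual_convergent_of_ptwise:
  fixes \<mu> :: "'a CXd"
  assumes "\<And>n. norm (y n :: 'a CX) \<le> B" "\<And>\<omega>. convergent (\<lambda>n. apply_bcontfun (y n) \<omega>)"
  shows "convergent (\<lambda>n. blinfun_apply \<mu> (y n))"
proof -
  obtain M where M: "finite_measure M" "sets M = sets borel"
    and dom: "\<And>x. \<bar>blinfun_apply \<mu> x\<bar> \<le> (\<integral>\<omega>. \<bar>apply_bcontfun x \<omega>\<bar> \<partial>M)"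
    by (rule dual_dominating_measure[OF compact_UNIV, of \<mu>], rule that)
  interpret finite_borel_measure M
    using M by (simp add: finite_borel_measure_def finite_borel_measure_axioms_def)
  define f where "f \<omega> = lim (\<lambda>n. apply_bcontfun (y n) \<omega>)" for \<omega>
  have lim: "(\<lambda>n. apply_bcontfun (y n) \<omega>) \<longlonglongrightarrow> f \<omega>" for \<omega>
    using assms(2) unfolding f_def by (simp add: convergent_LIMSEQ_iff)
  have fi: "integrable M f" using ptwise_limit_bounded(3)[OF assms(1) lim] .
  have L: "(\<lambda>n. L1dist (apply_bcontfun (y n)) f) \<longlonglongrightarrow> 0" using L1dist_ptwise[OF assms(1) lim] .
  have "Cauchy (\<lambda>n. blinfun_apply \<mu> (y n))"
  proof (rule metric_CauchyI)
    fix e :: real assume e: "0 < e"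
    have "\<forall>\<^sub>F n in sequentially. L1dist (apply_bcontfun (y n)) f < e / 2"
      using e by (intro order_tendstoD(2)[OF L]) simp
    then obtain N where N: "\<And>n. n \<ge> N \<Longrightarrow> L1dist (apply_bcontfun (y n)) f < e / 2"
      unfolding eventually_sequentially by blast
    have "dist (blinfun_apply \<mu> (y m)) (blinfun_apply \<mu> (y n)) < e" if "m \<ge> N" "n \<ge> N" for m n
    proof -
      have "dist (blinfun_apply \<mu> (y m)) (blinfun_apply \<mu> (y n)) = \<bar>blinfun_apply \<mu> (y m - y n)\<bar>"
        by (simp add: dist_real_def blinfun.diff_right)
      also have "\<dots> \<le> L1dist (apply_bcontfun (y m)) (apply_bcontfun (y n))"
        using dom[of "y m - y n"] unfolding L1dist_def by simp
      also have "\<dots> \<le> L1dist (apply_bcontfun (y m)) f + L1dist f (apply_bcontfun (y n))"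
        using fi by (intro L1dist_triangle) simp_all
      also have "\<dots> < e" using N[OF that(1)] N[OF that(2)] L1dist_commute[of f] by simp
      finally show ?thesis .
    qed
    then show "\<exists>N. \<forall>m\<ge>N. \<forall>n\<ge>N. dist (blinfun_apply \<mu> (y m)) (blinfun_apply \<mu> (y n)) < e" by blast
  qed
  then show ?thesis by (rule Cauchy_convergent)
qed

text \<open>The mean has n + 1 terms and a free starting time m. The ergodic estimate does not
  depend on m, which the construction with two minimal sets exploits.\<close>

definition ces :: "nat \<Rightarrow> nat \<Rightarrow> 'a LXd" where
  "ces m n = (\<Sum>k\<le>n. (1 / real (Suc n)) *\<^sub>R Vpow \<phi> (m + k))"

lemma ces_in_coV: "ces m n \<in> coV \<phi>"
  unfolding ces_def coV_def
  by (rule convex_sum) (auto simp: hull_inc)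

lemma ces_apply:
  "blinfun_apply (blinfun_apply (ces m n) \<mu>) x
      = (\<Sum>k\<le>n. blinfun_apply \<mu> (koop (m + k) x)) / real (Suc n)"
  unfolding ces_def
  by (simp add: blinfun.sum_left blinfun.scaleR_left Vpow_apply sum_divide_distrib)

lemma ergodic_apply:
  "blinfun_apply (blinfun_apply (id_blinfun - koopV \<phi>) (blinfun_apply T \<mu>)) x
    = blinfun_apply (blinfun_apply T \<mu>) x - blinfun_apply (blinfun_apply T \<mu>) (koop 1 x)"
  by (simp add: blinfun.diff_left koopV_apply)

text \<open>The sum telescopes to two boundary terms, each at most
  \<open>norm \<mu> * norm x\<close>.\<close>

lemma ces_ergodic_bound:
  "\<bar>blinfun_apply (blinfun_apply (id_blinfun - koopV \<phi>) (blinfun_apply (ces m n) \<mu>)) x\<bar>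
    \<le> 2 * norm \<mu> * norm x / real (Suc n)"
proof -
  have "(\<Sum>k\<le>n. blinfun_apply \<mu> (koop (m + k) x)) - (\<Sum>k\<le>n. blinfun_apply \<mu> (koop (m + k) (koop 1 x)))
     = (\<Sum>k\<le>n. blinfun_apply \<mu> (koop (m + k) x) - blinfun_apply \<mu> (koop (m + Suc k) x))"
    by (simp add: sum_subtractf koop_koop)
  also have "\<dots> = blinfun_apply \<mu> (koop m x) - blinfun_apply \<mu> (koop (m + Suc n) x)"
    by (induction n) auto
  finally have eq: "blinfun_apply (blinfun_apply (id_blinfun - koopV \<phi>)
      (blinfun_apply (ces m n) \<mu>)) x
     = (blinfun_apply \<mu> (koop m x) - blinfun_apply \<mu> (koop (m + Suc n) x)) / real (Suc n)"
    unfolding ergodic_apply ces_apply by (simp flip: diff_divide_distrib)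
  have "\<bar>blinfun_apply \<mu> (koop k x)\<bar> \<le> norm \<mu> * norm x" for k
    using abs_blinfun_le[of \<mu> "koop k x"] mult_left_mono[OF norm_koop_le[of k x]
        norm_ge_zero[of \<mu>]] by linarith
  from this[of m] this[of "m + Suc n"]
  have "\<bar>blinfun_apply \<mu> (koop m x) - blinfun_apply \<mu> (koop (m + Suc n) x)\<bar> \<le> 2 * norm \<mu> * norm x"
    by linarith
  then show ?thesis unfolding eq abs_divide by (simp add: divide_right_mono)
qed

lemma ergodic_seq_ces:
  assumes "filterlim N at_top sequentially"
  shows "ergodic_seq \<phi> (\<lambda>k. ces (m k) (N k))"
  unfolding ergodic_seq_def
proof (intro conjI allI)
  show "ces (m k) (N k) \<in> coV \<phi>" for k by (rule ces_in_coV)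
  fix x :: "'a CX" and \<mu> :: "'a CXd"
  have "(\<lambda>n. 2 * norm \<mu> * norm x * (1 / real (Suc n))) \<longlonglongrightarrow> 0"
    by (intro tendsto_mult_right_zero LIMSEQ_Suc[OF lim_1_over_n])
  then have "(\<lambda>k. 2 * norm \<mu> * norm x * (1 / real (Suc (N k)))) \<longlonglongrightarrow> 0"
    by (rule filterlim_compose[OF _ assms])
  then show "(\<lambda>k. blinfun_apply (blinfun_apply (id_blinfun - koopV \<phi>)
      (blinfun_apply (ces (m k) (N k)) \<mu>)) x) \<longlonglongrightarrow> 0"
  proof (rule Lim_null_comparison[rotated])
    show "\<forall>\<^sub>F k in sequentially. norm (blinfun_apply
        (blinfun_apply (id_blinfun - koopV \<phi>) (blinfun_apply (ces (m k) (N k)) \<mu>)) x)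
       \<le> 2 * norm \<mu> * norm x * (1 / real (Suc (N k)))"
      using ces_ergodic_bound by simp
  qed
qed

text \<open>Elements of \<open>coV \<phi>\<close> obey one common bound, so scalar limits found
  separately for each x and \<mu> assemble into a bounded operator.\<close>

lemma WsO_convergesI:
  assumes F: "F \<noteq> bot" "\<forall>\<^sub>F T in F. T \<in> coV \<phi>"
    and conv: "\<And>x \<mu>. \<exists>l. ((\<lambda>T. blinfun_apply (blinfun_apply T \<mu>) x) \<longlongrightarrow> l) F"
  shows "WsO_converges F"
proof -
  define l where "l x \<mu> = (SOME l. ((\<lambda>T. blinfun_apply (blinfun_apply T \<mu>) x) \<longlongrightarrow> l) F)" for x \<mu>
  have l: "((\<lambda>T. blinfun_apply (blinfun_apply T \<mu>) x) \<longlongrightarrow> l x \<mu>) F" for x \<mu>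
    unfolding l_def by (rule someI_ex[OF conv])
  have uniq: "((\<lambda>T. blinfun_apply (blinfun_apply T \<mu>) x) \<longlongrightarrow> a) F \<Longrightarrow> l x \<mu> = a" for x \<mu> a
    using l F(1) tendsto_unique by blast
  have lb: "\<bar>l x \<mu>\<bar> \<le> norm \<mu> * norm x" for x \<mu>
  proof (rule tendsto_upperbound[OF tendsto_rabs[OF l] _ F(1)])
    show "\<forall>\<^sub>F T in F. \<bar>blinfun_apply (blinfun_apply T \<mu>) x\<bar> \<le> norm \<mu> * norm x"
      using F(2) by (rule eventually_mono) (rule coV_abs_le)
  qed
  have bl1: "bounded_linear (\<lambda>x. l x \<mu>)" for \<mu>
  proof (rule bounded_linear_intro[where K = "norm \<mu>"])
    fix x y :: "'a CX" and r :: real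
    show "l (x + y) \<mu> = l x \<mu> + l y \<mu>"
      by (rule uniq) (use tendsto_add[OF l l] in \<open>simp add: blinfun.add_right\<close>)
    show "l (r *\<^sub>R x) \<mu> = r *\<^sub>R l x \<mu>"
      by (rule uniq) (use tendsto_scaleR[OF tendsto_const l] in \<open>simp add: blinfun.scaleR_right\<close>)
    show "norm (l x \<mu>) \<le> norm x * norm \<mu>" using lb[of x \<mu>] by (simp add: mult.commute)
  qed
  define T1 where "T1 \<mu> = Blinfun (\<lambda>x. l x \<mu>)" for \<mu>
  have T1: "blinfun_apply (T1 \<mu>) x = l x \<mu>" for \<mu> x
    unfolding T1_def using bl1 by (simp add: bounded_linear_Blinfun_apply)
  have "bounded_linear T1"
  proof (rule bounded_linear_intro[where K = 1])
    fix \<mu> \<nu> :: "'a CXd" and r :: real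
    show "T1 (\<mu> + \<nu>) = T1 \<mu> + T1 \<nu>"
    proof (rule blinfun_eqI)
      fix x
      have "l x (\<mu> + \<nu>) = l x \<mu> + l x \<nu>"
        by (rule uniq) (use tendsto_add[OF l l] in \<open>simp add: blinfun.add_right blinfun.add_left\<close>)
      then show "blinfun_apply (T1 (\<mu> + \<nu>)) x = blinfun_apply (T1 \<mu> + T1 \<nu>) x"
        by (simp add: T1 blinfun.add_left)
    qed
    show "T1 (r *\<^sub>R \<mu>) = r *\<^sub>R T1 \<mu>"
    proof (rule blinfun_eqI)
      fix x
      have "l x (r *\<^sub>R \<mu>) = r *\<^sub>R l x \<mu>"
        by (rule uniq) (use tendsto_scaleR[OF tendsto_const l] in \<open>simp add: blinfun.scaleR_right
            blinfun.scaleR_left\<close>)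
      then show "blinfun_apply (T1 (r *\<^sub>R \<mu>)) x = blinfun_apply (r *\<^sub>R T1 \<mu>) x"
        by (simp add: T1 blinfun.scaleR_left)
    qed
    show "norm (T1 \<mu>) \<le> norm \<mu> * 1"
      by (rule norm_blinfun_bound) (use lb in \<open>simp_all add: T1\<close>)
  qed
  then have "blinfun_apply (blinfun_apply (Blinfun T1) \<mu>) x = l x \<mu>" for \<mu> x
    by (simp add: bounded_linear_Blinfun_apply T1)
  then show ?thesis unfolding WsO_converges_def using l by (intro exI[of _ "Blinfun T1"]) simp
qed

lemma WsO_converges_seq_iff: "WsO_converges_seq Vs \<longleftrightarrow> WsO_converges (filtermap Vs sequentially)"
  unfolding WsO_converges_seq_def WsO_converges_def by (simp add: filterlim_filtermap)

lemma ergodic_seq_net: "ergodic_seq \<phi> Vs \<Longrightarrow> ergodic_net \<phi> (filtermap Vs sequentially)"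
  unfolding ergodic_seq_def ergodic_net_def ergodic_filter_def
  by (simp add: filterlim_filtermap filtermap_bot_iff eventually_filtermap)

text \<open>The diagonal argument is run on Dirac functionals with the point \<omega> as parameter;
  dominated convergence then carries convergence over to every \<mu>.\<close>

theorem tame_exists_convergent_ergodic_seq:
  assumes tame: "tame \<phi>"
  obtains Vs where "ergodic_seq \<phi> Vs" "WsO_converges_seq Vs"
proof -
  have sub: "\<exists>r. strict_mono (r :: nat \<Rightarrow> nat) \<and>
      (\<forall>\<omega>. convergent (\<lambda>k. blinfun_apply (blinfun_apply (ces 0 (s (r k))) (dirac \<omega>)) x))" for x
          and s :: "nat \<Rightarrow> nat"
  proof -
    have "\<forall>k. \<exists>h. h \<in> convex hull (orb x) \<and> (\<forall>\<mu>. blinfun_apply (blinfun_apply (ces 0 (s k)) \<mu>) x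
        = blinfun_apply \<mu> h)"
      using coV_pairing[OF ces_in_coV] by metis
    then obtain h where h: "\<And>k. h k \<in> convex hull (orb x)"
      "\<And>k \<mu>. blinfun_apply (blinfun_apply (ces 0 (s k)) \<mu>) x = blinfun_apply \<mu> (h k)" by metis
    have "range h \<subseteq> convex hull (orb x)" using h(1) by blast
    then obtain r :: "nat \<Rightarrow> nat" where "strict_mono r"
        "\<forall>\<omega>. convergent (\<lambda>k. apply_bcontfun (h (r k)) \<omega>)"
      using tame_hull_ptwise_precompact[OF tame, of x] unfolding ptwise_precompact_def by blast
    then show ?thesis using h(2) by (intro exI[of _ r]) simp
  qed
  have lip: "\<bar>blinfun_apply (blinfun_apply (ces 0 n) (dirac \<omega>)) x
      - blinfun_apply (blinfun_apply (ces 0 n) (dirac \<omega>)) y\<bar>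
      \<le> norm (x - y)" for n \<omega> x y
  proof -
    have "\<bar>blinfun_apply (blinfun_apply (ces 0 n) (dirac \<omega>)) (x - y)\<bar>
        \<le> norm (dirac \<omega>) * norm (x - y)"
      by (rule coV_abs_le[OF ces_in_coV])
    also have "\<dots> \<le> 1 * norm (x - y)" by (intro mult_right_mono norm_dirac_le norm_ge_zero)
    finally show ?thesis by (simp add: blinfun.diff_right)
  qed
  obtain \<sigma> :: "nat \<Rightarrow> nat" where \<sigma>: "strict_mono \<sigma>"
    "\<And>x \<omega>. convergent (\<lambda>k. blinfun_apply (blinfun_apply (ces 0 (\<sigma> k)) (dirac \<omega>)) x)"
    by (rule diagonal_convergence[OF compact_UNIV lip sub], rule that)
  define Vs where "Vs k = ces 0 (\<sigma> k)" for k
  have erg: "ergodic_seq \<phi> Vs"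
    unfolding Vs_def by (rule ergodic_seq_ces) (rule filterlim_subseq[OF \<sigma>(1)])
  have "WsO_converges (filtermap Vs sequentially)"
  proof (rule WsO_convergesI)
    show "filtermap Vs sequentially \<noteq> bot" "\<forall>\<^sub>F T in filtermap Vs sequentially. T \<in> coV \<phi>"
      using ergodic_seq_net[OF erg] unfolding ergodic_net_def by auto
    fix x :: "'a CX" and \<mu> :: "'a CXd"
    have "\<forall>k. \<exists>h. h \<in> convex hull (orb x) \<and> (\<forall>\<mu>. blinfun_apply (blinfun_apply (Vs k) \<mu>) x
        = blinfun_apply \<mu> h)"
      unfolding Vs_def using coV_pairing[OF ces_in_coV] by metis
    then obtain h where h: "\<And>k. h k \<in> convex hull (orb x)"
      "\<And>k \<mu>. blinfun_apply (blinfun_apply (Vs k) \<mu>) x = blinfun_apply \<mu> (h k)" by metis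
    have "convergent (\<lambda>k. apply_bcontfun (h k) \<omega>)" for \<omega>
      using \<sigma>(2)[of \<omega> x] h(2)[of _ "dirac \<omega>"] unfolding Vs_def by simp
    then have "convergent (\<lambda>k. blinfun_apply \<mu> (h k))"
      by (rule dual_convergent_of_ptwise[rotated]) (rule hull_orb_norm_le[OF h(1)])
    then have "convergent (\<lambda>k. blinfun_apply (blinfun_apply (Vs k) \<mu>) x)" using h(2) by simp
    then show "\<exists>l. ((\<lambda>T. blinfun_apply (blinfun_apply T \<mu>) x) \<longlongrightarrow> l) (filtermap Vs sequentially)"
      unfolding convergent_def by (simp add: filterlim_filtermap)
  qed
  then show ?thesis using that[OF erg] WsO_converges_seq_iff by blast
qed

end

section \<open>Unique ergodicity and minimal sets\<close>

context finite_borel_measure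
begin

text \<open>A vanishing mean distance is the form in which concentration on Y can be tested by one
  continuous function.\<close>

lemma concentrated_of_integral_infdist:
  assumes c: "compact (UNIV :: 'a set)" and Y: "closed Y" "Y \<noteq> {}"
    and int: "(\<integral>\<omega>. infdist \<omega> Y \<partial>M) = 0"
  shows "emeasure M (UNIV - Y) = 0"
proof -
  have ic: "continuous_on UNIV (\<lambda>\<omega>. infdist \<omega> Y)" by (intro continuous_intros)
  have "integrable M (\<lambda>\<omega>. infdist \<omega> Y)"
    using integrable_bcontfun[of "Bcontfun (\<lambda>\<omega>. infdist \<omega> Y)"] apply_Bcontfun[OF c ic] by simp
  then have "AE \<omega> in M. infdist \<omega> Y = 0"
    using int integral_nonneg_eq_0_iff_AE[of M "\<lambda>\<omega>. infdist \<omega> Y"] by (simp add: infdist_nonneg)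
  then have "AE \<omega> in M. \<omega> \<in> Y" using in_closed_iff_infdist_zero[OF Y] by simp
  moreover have "UNIV - Y \<in> sets M" using open_Diff[OF open_UNIV Y(1)]
    by (simp add: sets_M borel_open)
  ultimately show ?thesis
    using AE_iff_measurable[of "UNIV - Y" M "\<lambda>\<omega>. \<omega> \<in> Y"] space_M by auto
qed

end

lemma invariant_prob_onD:
  assumes "invariant_prob_on \<phi> K M"
  shows "prob_space M" "finite_borel_measure M" "emeasure M (UNIV - K) = 0"
  using assms prob_space.finite_measure
  by (auto simp: invariant_prob_on_def finite_borel_measure_def finite_borel_measure_axioms_def)

section \<open>Invariant measures on orbit closures\<close>

context dynamical_system
begin

lemma koop_fun: "apply_bcontfun (koop n x) = (\<lambda>\<omega>. apply_bcontfun x ((\<phi> ^^ n) \<omega>))"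
  by (rule ext) simp

lemma measurable_phi: "\<phi> \<in> measurable borel borel"
  by (rule borel_measurable_continuous_onI[OF continuous])

lemma invariant_prob_integral:
  assumes M: "invariant_prob_on \<phi> K M"
  shows "(\<integral>\<omega>. apply_bcontfun (koop n x) \<omega> \<partial>M) = (\<integral>\<omega>. apply_bcontfun x \<omega> \<partial>M)"
proof -
  have sM: "sets M = sets borel" and inv: "\<And>A. A \<in> sets borel \<Longrightarrow> emeasure M (\<phi> -` A) = emeasure M A"
    using M unfolding invariant_prob_on_def by auto
  have m: "\<phi> \<in> measurable M borel" using measurable_phi measurable_cong_sets[OF sM refl] by blast
  have sp: "space M = UNIV" using sets_eq_imp_space_eq[OF sM] by simp
  have "distr M borel \<phi> = M"
    by (rule measure_eqI) (auto simp: sM emeasure_distr[OF m] sp inv)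
  then have one: "(\<integral>\<omega>. apply_bcontfun y (\<phi> \<omega>) \<partial>M) = (\<integral>\<omega>. apply_bcontfun y \<omega> \<partial>M)" for y :: "'a CX"
    using integral_distr[OF m, of "apply_bcontfun y"]
        borel_measurable_continuous_onI[OF continuous_on_apply_bcontfun, of y]
    by simp
  show ?thesis
  proof (induction n arbitrary: x)
    case (Suc n)
    show ?case using one[of "koop n x"] Suc[of x] by (simp add: koop_fun funpow_swap1)
  qed (simp add: koop_fun)
qed

lemma hull_orb_integral:
  assumes M: "invariant_prob_on \<phi> K M" and h: "h \<in> convex hull (orb x)"
  shows "(\<integral>\<omega>. apply_bcontfun h \<omega> \<partial>M) = (\<integral>\<omega>. apply_bcontfun x \<omega> \<partial>M)"
proof -
  interpret finite_borel_measure M using invariant_prob_onD[OF M] by blast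
  let ?S = "{h. (\<integral>\<omega>. apply_bcontfun h \<omega> \<partial>M) = (\<integral>\<omega>. apply_bcontfun x \<omega> \<partial>M)}"
  have "convex ?S"
  proof (rule convexI)
    fix g h :: "'a CX" and u v :: real assume gh: "g \<in> ?S" "h \<in> ?S" and uv: "u + v = 1"
    have "(\<integral>\<omega>. apply_bcontfun (u *\<^sub>R g + v *\<^sub>R h) \<omega> \<partial>M) = (u + v) * (\<integral>\<omega>. apply_bcontfun x \<omega> \<partial>M)"
      using gh by (simp add: distrib_right)
    then show "u *\<^sub>R g + v *\<^sub>R h \<in> ?S" using uv by simp
  qed
  moreover have "orb x \<subseteq> ?S"
  proof
    fix y assume "y \<in> orb x"
    then obtain n where "y = koop n x" unfolding orb_def by blast
    then show "y \<in> ?S" using invariant_prob_integral[OF M, of n x] by blast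
  qed
  ultimately show ?thesis using h hull_minimal[of "orb x" ?S convex] by blast
qed

text \<open>Bounds along the orbit of one point pass to the hull at that point. They yield
  positivity of the means and, with a = b = 0, concentration of their limits on the orbit
  closure.\<close>

lemma hull_orb_between:
  assumes h: "h \<in> convex hull (orb x)"
    and ab: "\<And>n. a \<le> apply_bcontfun x ((\<phi> ^^ n) \<omega>)" "\<And>n. apply_bcontfun x ((\<phi> ^^ n) \<omega>) \<le> b"
  shows "a \<le> apply_bcontfun h \<omega>" "apply_bcontfun h \<omega> \<le> b"
proof -
  let ?S = "{h :: 'a CX. a \<le> apply_bcontfun h \<omega> \<and> apply_bcontfun h \<omega> \<le> b}"
  have "convex ?S"
  proof (rule convexI)
    fix g h :: "'a CX" and u v :: real assume "g \<in> ?S" "h \<in> ?S" and uv: "0 \<le> u" "0 \<le> v" "u + v = 1"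
    then show "u *\<^sub>R g + v *\<^sub>R h \<in> ?S"
      using convex_bound_le[of "apply_bcontfun g \<omega>" b "apply_bcontfun h \<omega>" u v]
        convex_bound_le[of "- apply_bcontfun g \<omega>" "- a" "- apply_bcontfun h \<omega>" u v] by simp
  qed
  moreover have "orb x \<subseteq> ?S" unfolding orb_def using ab by auto
  ultimately have "h \<in> ?S" using h hull_minimal[of "orb x" ?S convex] by blast
  then show "a \<le> apply_bcontfun h \<omega>" "apply_bcontfun h \<omega> \<le> b" by auto
qed

lemma coV_dirac_between:
  assumes T: "T \<in> coV \<phi>"
    and ab: "\<And>n. a \<le> apply_bcontfun x ((\<phi> ^^ n) \<omega>)" "\<And>n. apply_bcontfun x ((\<phi> ^^ n) \<omega>) \<le> b"
  shows "a \<le> blinfun_apply (blinfun_apply T (dirac \<omega>)) x"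
      "blinfun_apply (blinfun_apply T (dirac \<omega>)) x \<le> b"
proof -
  obtain h where h: "h \<in> convex hull (orb x)"
      "\<And>\<mu>. blinfun_apply (blinfun_apply T \<mu>) x = blinfun_apply \<mu> h"
    by (rule coV_pairing[OF T, of x], rule that)
  show "a \<le> blinfun_apply (blinfun_apply T (dirac \<omega>)) x"
      "blinfun_apply (blinfun_apply T (dirac \<omega>)) x \<le> b"
    using hull_orb_between[where x = x and a = a and b = b and \<omega> = \<omega>, OF h(1) ab] h(2) by simp_all
qed

lemma coV_state:
  assumes T: "T \<in> coV \<phi>"
  shows "state (\<lambda>x. blinfun_apply (blinfun_apply T (dirac \<omega>)) x)"
  unfolding state_def
proof (intro conjI allI impI)
  show "linear (blinfun_apply (blinfun_apply T (dirac \<omega>)))"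
    using blinfun.bounded_linear_right bounded_linear.linear by blast
  show "blinfun_apply (blinfun_apply T (dirac \<omega>)) (const_bcontfun 1) = 1"
    using coV_dirac_between[OF T, where x = "const_bcontfun 1" and a = 1 and b = 1 and \<omega> = \<omega>]
      by simp
  fix x :: "'a CX" assume "\<forall>\<omega>. 0 \<le> apply_bcontfun x \<omega>"
  then show "0 \<le> blinfun_apply (blinfun_apply T (dirac \<omega>)) x"
    using coV_dirac_between(1)[OF T, where x = x and a = 0 and b = "norm x" and \<omega> = \<omega>]
      abs_le_norm_bcontfun[of x] by (simp add: abs_le_iff)
qed

lemma coV_commutes:
  assumes "T \<in> coV \<phi>"
  shows "blinfun_apply T (koopV \<phi> \<mu>) = koopV \<phi> (blinfun_apply T \<mu>)"
proof -
  let ?S = "{T :: 'a LXd. \<forall>\<mu>. blinfun_apply T (koopV \<phi> \<mu>) = koopV \<phi> (blinfun_apply T \<mu>)}"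
  have "range (Vpow \<phi>) \<subseteq> ?S"
    by (auto intro!: blinfun_eqI simp: Vpow_apply koopV_apply koop_koop)
  moreover have "convex ?S"
    by (rule convexI) (simp add: blinfun.add_left blinfun.scaleR_left blinfun.add_right
        blinfun.scaleR_right)
  ultimately have "coV \<phi> \<subseteq> ?S" unfolding coV_def by (rule hull_minimal)
  then show ?thesis using assms by blast
qed

lemma koopV_dirac: "koopV \<phi> (dirac \<omega>) = dirac (\<phi> \<omega>)"
  by (rule blinfun_eqI) (simp add: koopV_apply)

lemma orbit_closure_closed: "closed (orbit_closure \<phi> \<omega>)"
  by (simp add: orbit_closure_def)

lemma orbit_in_orbit_closure: "(\<phi> ^^ n) \<omega> \<in> orbit_closure \<phi> \<omega>"
  unfolding orbit_closure_def using closure_subset[of "range (\<lambda>n. (\<phi> ^^ n) \<omega>)"] by auto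

lemma orbit_closure_nonempty: "orbit_closure \<phi> \<omega> \<noteq> {}"
  using orbit_in_orbit_closure by blast

lemma orbit_closure_invariant: "\<phi> ` orbit_closure \<phi> \<omega> \<subseteq> orbit_closure \<phi> \<omega>"
  unfolding orbit_closure_def
proof (rule image_closure_subset)
  show "continuous_on (closure (range (\<lambda>n. (\<phi> ^^ n) \<omega>))) \<phi>" using continuous continuous_on_subset
    by blast
  have "\<phi> ((\<phi> ^^ n) \<omega>) \<in> range (\<lambda>n. (\<phi> ^^ n) \<omega>)" for n
    by (rule range_eqI[where x = "Suc n"]) simp
  then show "\<phi> ` range (\<lambda>n. (\<phi> ^^ n) \<omega>) \<subseteq> closure (range (\<lambda>n. (\<phi> ^^ n) \<omega>))"
    using closure_subset[of "range (\<lambda>n. (\<phi> ^^ n) \<omega>)"] by blast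
qed simp

lemma invariant_funpow: "\<phi> ` K \<subseteq> K \<Longrightarrow> \<omega> \<in> K \<Longrightarrow> (\<phi> ^^ n) \<omega> \<in> K"
  by (induction n) auto

lemma orbit_closure_subset:
  "closed K \<Longrightarrow> \<phi> ` K \<subseteq> K \<Longrightarrow> \<omega> \<in> K \<Longrightarrow> orbit_closure \<phi> \<omega> \<subseteq> K"
  unfolding orbit_closure_def using invariant_funpow by (intro closure_minimal) auto

definition distf :: "'a set \<Rightarrow> 'a CX" where
  "distf Y = Bcontfun (\<lambda>\<omega>. infdist \<omega> Y)"

lemma distf_apply [simp]: "apply_bcontfun (distf Y) \<omega> = infdist \<omega> Y"
  unfolding distf_def by (subst apply_Bcontfun[OF compact_UNIV]) (auto intro!: continuous_intros)

text \<open>The assumption \<open>van\<close> expresses concentration on K in terms of functions and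
  is applied to the distance from K. Invariance passes from functions to Borel sets since integrals
  of continuous functions determine a finite measure.\<close>

lemma invariant_state_measure:
  assumes L: "state L" and inv: "\<And>x. L (koop 1 x) = L x"
    and K: "closed K" "K \<noteq> {}" and van: "\<And>x. (\<And>\<omega>. \<omega> \<in> K \<Longrightarrow> apply_bcontfun x \<omega> = 0) \<Longrightarrow> L x = 0"
  obtains M where "invariant_prob_on \<phi> K M" "\<And>x. L x = (\<integral>\<omega>. apply_bcontfun x \<omega> \<partial>M)"
proof -
  obtain M where M: "prob_space M" "sets M = sets borel" "\<And>x. L x = (\<integral>\<omega>. apply_bcontfun x \<omega> \<partial>M)"
    by (rule state_measure[OF compact_UNIV L], rule that)
  interpret finite_borel_measure M
    using M prob_space.finite_measure by (simp add: finite_borel_measure_def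
        finite_borel_measure_axioms_def)
  have m: "\<phi> \<in> measurable M borel" using measurable_phi measurable_cong_sets[OF M(2) refl] by blast
  have "distr M borel \<phi> = M"
  proof (rule measure_eq_continuousI)
    show "finite_measure (distr M borel \<phi>)" by (rule finite_measure_distr[OF m])
    show "finite_measure M" by (rule finite_measure_axioms)
    fix f :: "'a \<Rightarrow> real" assume f: "continuous_on UNIV f"
    have a: "apply_bcontfun (Bcontfun f) = f" by (rule apply_Bcontfun[OF compact_UNIV f])
    have "(\<integral>x. f x \<partial>distr M borel \<phi>) = (\<integral>x. f (\<phi> x) \<partial>M)"
      by (rule integral_distr[OF m borel_measurable_continuous_onI[OF f]])
    also have "\<dots> = L (koop 1 (Bcontfun f))" unfolding M(3) koop_fun by (simp add: a)
    also have "\<dots> = L (Bcontfun f)" by (rule inv)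
    also have "\<dots> = (\<integral>x. f x \<partial>M)" unfolding M(3) a ..
    finally show "(\<integral>x. f x \<partial>distr M borel \<phi>) = (\<integral>x. f x \<partial>M)" .
  qed (simp_all add: M(2))
  then have "emeasure M (\<phi> -` A) = emeasure M A" if "A \<in> sets borel" for A
    using emeasure_distr[OF m that] space_M by simp
  moreover have "(\<integral>\<omega>. infdist \<omega> K \<partial>M) = 0"
    using van[of "distf K"] M(3)[of "distf K"] by simp
  then have "emeasure M (UNIV - K) = 0" by (rule concentrated_of_integral_infdist[OF compact_UNIV
      K])
  ultimately have "invariant_prob_on \<phi> K M" using M unfolding invariant_prob_on_def by blast
  then show ?thesis using that M(3) by blast
qed

text \<open>Krylov-Bogoliubov for arbitrary means. Asymptotic invariance is asked on a dense
  sequence Z, since a sequence drawn from a net can be made to meet countably many conditions; the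
  limit state is a contraction, which extends invariance to all x.\<close>

lemma almost_invariant_cluster_measure:
  assumes T: "\<And>n. T n \<in> coV \<phi>"
    and Z: "\<And>x e. 0 < e \<Longrightarrow> \<exists>i. norm (x - Z i) < e"
    and ai: "\<And>i. (\<lambda>n. blinfun_apply (blinfun_apply (id_blinfun - koopV \<phi>)
        (blinfun_apply (T n) (dirac \<omega>))) (Z i :: 'a CX)) \<longlonglongrightarrow> 0"
  obtains \<sigma> :: "nat \<Rightarrow> nat" and M where "strict_mono \<sigma>" "invariant_prob_on \<phi> (orbit_closure \<phi> \<omega>) M"
    "\<And>x. (\<lambda>k. blinfun_apply (blinfun_apply (T (\<sigma> k)) (dirac \<omega>)) x) \<longlonglongrightarrow> (\<integral>\<omega>. apply_bcontfun x \<omega> \<partial>M)"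
proof -
  obtain \<sigma> :: "nat \<Rightarrow> nat" and L where \<sigma>: "strict_mono \<sigma>" and L: "state L"
    and lim: "\<And>x. (\<lambda>k. blinfun_apply (blinfun_apply (T (\<sigma> k)) (dirac \<omega>)) x) \<longlonglongrightarrow> L x"
    by (rule states_subsequence[OF compact_UNIV coV_state[OF T]], rule that)
  have lin: "linear L" using L unfolding state_def by blast
  have invZ: "L (koop 1 (Z i)) = L (Z i)" for i
  proof -
    have "(\<lambda>k. blinfun_apply (blinfun_apply (T (\<sigma> k)) (dirac \<omega>)) (Z i)
        - blinfun_apply (blinfun_apply (T (\<sigma> k)) (dirac \<omega>)) (koop 1 (Z i))) \<longlonglongrightarrow> L (Z i) -
            L (koop 1 (Z i))"
      by (intro tendsto_diff lim)
    moreover have "(\<lambda>k. blinfun_apply (blinfun_apply (T (\<sigma> k)) (dirac \<omega>)) (Z i)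
        - blinfun_apply (blinfun_apply (T (\<sigma> k)) (dirac \<omega>)) (koop 1 (Z i))) \<longlonglongrightarrow> 0"
      using LIMSEQ_subseq_LIMSEQ[OF ai[of i] \<sigma>] unfolding ergodic_apply by (simp add: o_def)
    ultimately have "L (Z i) - L (koop 1 (Z i)) = 0" using LIMSEQ_unique by blast
    then show ?thesis by simp
  qed
  have inv: "L (koop 1 x) = L x" for x
  proof -
    have "\<bar>L (koop 1 x) - L x\<bar> \<le> 0 + e" if e: "0 < e" for e
    proof -
      obtain i where i: "norm (x - Z i) < e / 2" using Z[of "e / 2" x] e by auto
      have "koop 1 x - koop 1 (Z i) = koop 1 (x - Z i)" by (rule bcontfun_eqI) simp
      then have "\<bar>L (koop 1 x) - L (koop 1 (Z i))\<bar> \<le> norm (x - Z i)"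
        using state_abs_le[OF L, of "koop 1 (x - Z i)"] norm_koop_le[of 1 "x - Z i"]
        by (simp flip: linear_diff[OF lin])
      moreover have "\<bar>L x - L (Z i)\<bar> \<le> norm (x - Z i)"
        using state_abs_le[OF L, of "x - Z i"] by (simp add: linear_diff[OF lin])
      ultimately show ?thesis using invZ[of i] i by linarith
    qed
    then have "\<bar>L (koop 1 x) - L x\<bar> \<le> 0" by (rule field_le_epsilon)
    then show ?thesis by simp
  qed
  have van: "L x = 0" if x0: "\<And>\<omega>'. \<omega>' \<in> orbit_closure \<phi> \<omega> \<Longrightarrow> apply_bcontfun x \<omega>' = 0" for x
  proof -
    have "blinfun_apply (blinfun_apply (T n) (dirac \<omega>)) x = 0" for n
      using coV_dirac_between[OF T, where x = x and a = 0 and b = 0 and \<omega> = \<omega>]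
        x0[OF orbit_in_orbit_closure] by (simp add: antisym)
    then show ?thesis using lim[of x] LIMSEQ_unique[OF _ tendsto_const] by simp
  qed
  obtain M where M: "invariant_prob_on \<phi> (orbit_closure \<phi> \<omega>) M"
      "\<And>x. L x = (\<integral>\<omega>. apply_bcontfun x \<omega> \<partial>M)"
    by (rule invariant_state_measure[OF L inv orbit_closure_closed orbit_closure_nonempty van],
        assumption, rule that)
  show ?thesis using that[OF \<sigma> M(1)] lim unfolding M(2) by blast
qed

lemma invariant_prob_exists:
  obtains M where "invariant_prob_on \<phi> (orbit_closure \<phi> \<omega>) M"
proof -
  obtain Z :: "nat \<Rightarrow> 'a CX" where Z: "\<And>x e. 0 < e \<Longrightarrow> \<exists>n. norm (x - Z n) < e"
    by (rule separable_bcontfun[OF compact_UNIV], rule that)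
  have "ergodic_seq \<phi> (\<lambda>k. ces 0 k)" by (rule ergodic_seq_ces[OF filterlim_ident])
  then have ai: "(\<lambda>n. blinfun_apply (blinfun_apply (id_blinfun - koopV \<phi>)
      (blinfun_apply (ces 0 n) (dirac \<omega>))) (Z i)) \<longlonglongrightarrow> 0" for i
    unfolding ergodic_seq_def by blast
  show ?thesis
    by (rule almost_invariant_cluster_measure[OF ces_in_coV Z ai], assumption, rule that)
qed

text \<open>If convergence failed, the net would contain a sequence that stays away from the
  expected value and is asymptotically invariant on a dense set of functions; its cluster measure
  would be an invariant measure other than M.\<close>

lemma uniquely_ergodic_imp_tendsto:
  assumes ue: "uniquely_ergodic_on \<phi> (orbit_closure \<phi> \<omega>)"
      and M: "invariant_prob_on \<phi> (orbit_closure \<phi> \<omega>) M"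
    and F: "ergodic_net \<phi> F"
  shows "((\<lambda>T. blinfun_apply (blinfun_apply T (dirac \<omega>)) x) \<longlongrightarrow> (\<integral>\<omega>. apply_bcontfun x \<omega> \<partial>M)) F"
proof (rule ccontr)
  define l where "l = (\<integral>\<omega>. apply_bcontfun x \<omega> \<partial>M)"
  assume "\<not> ?thesis"
  then obtain e where e: "0 < e" "\<not> (\<forall>\<^sub>F T in F. dist
      (blinfun_apply (blinfun_apply T (dirac \<omega>)) x) l < e)"
    unfolding tendsto_iff l_def by blast
  obtain Z :: "nat \<Rightarrow> 'a CX" where Z: "\<And>x e. 0 < e \<Longrightarrow> \<exists>n. norm (x - Z n) < e"
    by (rule separable_bcontfun[OF compact_UNIV], rule that)
  let ?E = "\<lambda>T i. blinfun_apply (blinfun_apply (id_blinfun - koopV \<phi>) (blinfun_apply T (dirac \<omega>)))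
      (Z i)"
  have "\<exists>T. T \<in> coV \<phi> \<and> e \<le> dist (blinfun_apply (blinfun_apply T (dirac \<omega>)) x) l
      \<and> (\<forall>i\<in>{..n}. dist (?E T i) 0 < 1 / Suc n)" for n
  proof -
    have "\<forall>\<^sub>F T in F. \<forall>i\<in>{..n}. dist (?E T i) 0 < 1 / Suc n"
      using F unfolding ergodic_net_def ergodic_filter_def
        by (intro eventually_ball_finite ballI tendstoD) auto
    moreover have "\<forall>\<^sub>F T in F. T \<in> coV \<phi>" using F unfolding ergodic_net_def by blast
    ultimately have "\<forall>\<^sub>F T in F. T \<in> coV \<phi> \<and> (\<forall>i\<in>{..n}. dist (?E T i) 0 < 1 / Suc n)"
      by eventually_elim blast
    moreover have "\<exists>\<^sub>F T in F. e \<le> dist (blinfun_apply (blinfun_apply T (dirac \<omega>)) x) l"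
      using e(2) by (simp add: not_eventually not_less)
    ultimately show ?thesis
      using frequently_ex[OF frequently_eventually_frequently] by blast
  qed
  then obtain T where T: "\<And>n. T n \<in> coV \<phi>" "\<And>n. e
      \<le> dist (blinfun_apply (blinfun_apply (T n) (dirac \<omega>)) x) l"
    "\<And>n i. i \<le> n \<Longrightarrow> dist (?E (T n) i) 0 < 1 / Suc n" by (metis atMost_iff)
  have ai: "(\<lambda>n. ?E (T n) i) \<longlonglongrightarrow> 0" for i
  proof (rule Lim_null_comparison)
    show "\<forall>\<^sub>F n in sequentially. norm (?E (T n) i) \<le> 1 / Suc n"
      unfolding eventually_sequentially using T(3)[of i] by (auto intro!: exI[of _ i] less_imp_le)
    show "(\<lambda>n. 1 / real (Suc n)) \<longlonglongrightarrow> 0" by (rule LIMSEQ_Suc[OF lim_1_over_n])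
  qed
  obtain \<sigma> :: "nat \<Rightarrow> nat" and M' where "strict_mono \<sigma>"
      and M': "invariant_prob_on \<phi> (orbit_closure \<phi> \<omega>) M'"
    and lim: "\<And>x. (\<lambda>k. blinfun_apply (blinfun_apply (T (\<sigma> k)) (dirac \<omega>)) x)
        \<longlonglongrightarrow> (\<integral>\<omega>. apply_bcontfun x \<omega> \<partial>M')"
    by (rule almost_invariant_cluster_measure[OF T(1) Z ai], assumption, rule that)
  have "M' = M" using ue M M' unfolding uniquely_ergodic_on_def by blast
  then have "(\<lambda>k. blinfun_apply (blinfun_apply (T (\<sigma> k)) (dirac \<omega>)) x) \<longlonglongrightarrow> l" using lim
    unfolding l_def by blast
  then have "\<forall>\<^sub>F k in sequentially. dist (blinfun_apply (blinfun_apply (T (\<sigma> k)) (dirac \<omega>)) x) l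
      < e"
    using e(1) by (rule tendstoD)
  then obtain k where "dist (blinfun_apply (blinfun_apply (T (\<sigma> k)) (dirac \<omega>)) x) l < e"
    unfolding eventually_sequentially by blast
  then show False using T(2)[of "\<sigma> k"] by simp
qed

theorem uniquely_ergodic_imp_nets_converge:
  assumes tame: "tame \<phi>" and ue: "\<And>\<omega>. uniquely_ergodic_on \<phi> (orbit_closure \<phi> \<omega>)"
      and F: "ergodic_net \<phi> F"
  shows "WsO_converges F"
proof (rule WsO_convergesI)
  show nb: "F \<noteq> bot" and evF: "\<forall>\<^sub>F T in F. T \<in> coV \<phi>" using F unfolding ergodic_net_def by auto
  fix x :: "'a CX" and \<mu> :: "'a CXd"
  have "\<forall>\<omega>. \<exists>M. invariant_prob_on \<phi> (orbit_closure \<phi> \<omega>) M" using ue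
    unfolding uniquely_ergodic_on_def by blast
  then obtain N where N: "\<And>\<omega>. invariant_prob_on \<phi> (orbit_closure \<phi> \<omega>) (N \<omega>)" by metis
  define f where "f \<omega> = (\<integral>\<omega>'. apply_bcontfun x \<omega>' \<partial>N \<omega>)" for \<omega>
  obtain Vs where Vs: "ergodic_seq \<phi> Vs" by (rule tame_exists_convergent_ergodic_seq[OF tame],
      rule that)
  have VcoV: "Vs n \<in> coV \<phi>" for n using Vs unfolding ergodic_seq_def by blast
  \<comment> \<open>A representative of T at x in the hull of the orbit; its value outside
    \<open>coV \<phi>\<close> is arbitrary, and F is eventually inside.\<close>
  define h where "h T = (SOME h. h \<in> convex hull (orb x)
      \<and> (\<forall>\<mu>. blinfun_apply (blinfun_apply T \<mu>) x = blinfun_apply \<mu> h))" for T :: "'a LXd"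
  have h: "h T \<in> convex hull (orb x) \<and> (\<forall>\<mu>. blinfun_apply (blinfun_apply T \<mu>) x
      = blinfun_apply \<mu> (h T))" if "T \<in> coV \<phi>" for T
    unfolding h_def by (rule someI_ex) (use coV_pairing[OF that, of x] in blast)
  have hd: "apply_bcontfun (h T) \<omega> = blinfun_apply (blinfun_apply T (dirac \<omega>)) x" if "T \<in> coV \<phi>"
      for T \<omega>
    using h[OF that] by simp
  \<comment> \<open>An ergodic sequence has the same pointwise limit f, which exhibits f as a
    function of the first Baire class.\<close>
  define u where "u n = h (Vs n)" for n
  have uf: "(\<lambda>n. apply_bcontfun (u n) \<omega>) \<longlonglongrightarrow> f \<omega>" for \<omega>
    using uniquely_ergodic_imp_tendsto[OF ue N ergodic_seq_net[OF Vs], of \<omega> x]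
    unfolding f_def u_def by (simp add: hd[OF VcoV] filterlim_filtermap)
  have ub: "norm (u n) \<le> norm x" for n unfolding u_def using hull_orb_norm_le h[OF VcoV] by blast
  have hf: "((\<lambda>T. apply_bcontfun (h T) \<omega>) \<longlongrightarrow> f \<omega>) F" for \<omega>
  proof (rule Lim_transform_eventually)
    show "((\<lambda>T. blinfun_apply (blinfun_apply T (dirac \<omega>)) x) \<longlongrightarrow> f \<omega>) F"
      unfolding f_def by (rule uniquely_ergodic_imp_tendsto[OF ue N F])
    show "\<forall>\<^sub>F T in F. blinfun_apply (blinfun_apply T (dirac \<omega>)) x = apply_bcontfun (h T) \<omega>"
      using evF by eventually_elim (simp add: hd)
  qed
  obtain M where M: "finite_measure M" "sets M = sets borel"
    and dom: "\<And>x. \<bar>blinfun_apply \<mu> x\<bar> \<le> (\<integral>\<omega>. \<bar>apply_bcontfun x \<omega>\<bar> \<partial>M)"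
    by (rule dual_dominating_measure[OF compact_UNIV, of \<mu>], rule that)
  interpret finite_borel_measure M
    using M by (simp add: finite_borel_measure_def finite_borel_measure_axioms_def)
  have hL: "((\<lambda>T. L1dist (apply_bcontfun (h T)) f) \<longlongrightarrow> 0) F"
  proof (rule L1_convergence_along_filter[OF compact_UNIV tame_hull_ptwise_precompact[OF tame]])
    show "\<forall>\<^sub>F T in F. h T \<in> convex hull (orb x)" using evF by eventually_elim (use h in blast)
    show "closed (UNIV :: 'a set)" "emeasure M (UNIV - UNIV) = 0" by simp_all
  qed (rule hull_orb_norm_le hf ub uf; assumption?)+
  have fi: "integrable M f" using ptwise_limit_bounded(3)[OF ub uf] .
  have uL: "(\<lambda>n. L1dist (apply_bcontfun (u n)) f) \<longlonglongrightarrow> 0" using L1dist_ptwise[OF ub uf] .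
  have "convergent (\<lambda>n. apply_bcontfun (u n) \<omega>)" for \<omega> using uf unfolding convergent_def by blast
  then obtain l where l: "(\<lambda>n. blinfun_apply \<mu> (u n)) \<longlonglongrightarrow> l"
    using dual_convergent_of_ptwise[where y = u and \<mu> = \<mu>, OF ub] unfolding convergent_def by blast
  \<comment> \<open>The candidate l comes from the sequence u; the L^1 distance from f controls how
    far the net is from it.\<close>
  have bound: "\<bar>blinfun_apply \<mu> (h T) - l\<bar> \<le> L1dist (apply_bcontfun (h T)) f" for T
  proof (rule LIMSEQ_le)
    show "(\<lambda>n. \<bar>blinfun_apply \<mu> (h T) - blinfun_apply \<mu> (u n)\<bar>) \<longlonglongrightarrow> \<bar>blinfun_apply \<mu> (h T) - l\<bar>"
      by (intro tendsto_intros l)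
    show "(\<lambda>n. L1dist (apply_bcontfun (h T)) f + L1dist (apply_bcontfun (u n)) f)
        \<longlonglongrightarrow> L1dist (apply_bcontfun (h T)) f"
      using tendsto_add[OF tendsto_const uL] by simp
    have "\<bar>blinfun_apply \<mu> (h T) - blinfun_apply \<mu> (u n)\<bar> \<le> L1dist (apply_bcontfun (h T)) f
        + L1dist (apply_bcontfun (u n)) f" for n
    proof -
      have "\<bar>blinfun_apply \<mu> (h T) - blinfun_apply \<mu> (u n)\<bar>
          \<le> L1dist (apply_bcontfun (h T)) (apply_bcontfun (u n))"
        using dom[of "h T - u n"] unfolding L1dist_def by (simp add: blinfun.diff_right)
      also have "\<dots> \<le> L1dist (apply_bcontfun (h T)) f + L1dist f (apply_bcontfun (u n))"
        using fi by (intro L1dist_triangle) simp_all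
      finally show ?thesis using L1dist_commute[of f] by simp
    qed
    then show "\<exists>N. \<forall>n\<ge>N. \<bar>blinfun_apply \<mu> (h T) - blinfun_apply \<mu> (u n)\<bar>
        \<le> L1dist (apply_bcontfun (h T)) f + L1dist (apply_bcontfun (u n)) f"
      by blast
  qed
  have "((\<lambda>T. blinfun_apply (blinfun_apply T \<mu>) x) \<longlongrightarrow> l) F"
  proof (rule LIM_zero_cancel, rule Lim_null_comparison[OF _ hL])
    show "\<forall>\<^sub>F T in F. norm (blinfun_apply (blinfun_apply T \<mu>) x - l)
        \<le> L1dist (apply_bcontfun (h T)) f"
      using evF by eventually_elim (use h bound in auto)
  qed
  then show "\<exists>l. ((\<lambda>T. blinfun_apply (blinfun_apply T \<mu>) x) \<longlongrightarrow> l) F" by blast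
qed

section \<open>Minimal sets and divergent block averages\<close>

lemma minimal_subset_exists:
  assumes K: "closed K" "K \<noteq> {}" "\<phi> ` K \<subseteq> K"
  obtains Y where "Y \<subseteq> K" "minimal_set \<phi> Y"
proof -
  \<comment> \<open>Complements of the nonempty closed invariant subsets of K, so that Zorn's lemma
    applies to unions of chains; compactness prevents such a union from being the whole
    space.\<close>
  define \<A> where "\<A> = {U. open U \<and> U \<noteq> UNIV \<and> - K \<subseteq> U \<and> \<phi> ` (- U) \<subseteq> - U}"
  have "- K \<in> \<A>" unfolding \<A>_def using K by auto
  then have "\<A> \<noteq> {}" by blast
  then have "\<exists>U\<in>\<A>. \<forall>X\<in>\<A>. U \<subseteq> X \<longrightarrow> X = U"
  proof (rule subset_Zorn_nonempty)
    fix \<C> assume C: "\<C> \<noteq> {}" "subset.chain \<A> \<C>"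
    then have CA: "\<C> \<subseteq> \<A>" by (simp add: subset_chain_def)
    have "\<Union>\<C> \<noteq> UNIV"
    proof
      assume "\<Union>\<C> = UNIV"
      then obtain \<D> where D: "\<D> \<subseteq> \<C>" "finite \<D>" "UNIV \<subseteq> \<Union>\<D>"
        using compactE[OF compact_UNIV, of \<C>] CA unfolding \<A>_def
          by (metis (no_types, lifting) mem_Collect_eq subsetD top_greatest)
      then have "\<D> \<noteq> {}" by auto
      moreover have "subset.chain \<A> \<D>"
        unfolding subset_chain_def
      proof (intro conjI ballI)
        show "\<D> \<subseteq> \<A>" using D(1) CA by (rule subset_trans)
        fix X Y assume "X \<in> \<D>" "Y \<in> \<D>"
        then have "X \<in> \<C>" "Y \<in> \<C>" using D(1) by (auto dest: subsetD)
        then show "X \<subseteq> Y \<or> Y \<subseteq> X" using C(2) by (simp add: subset_chain_def)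
      qed
      ultimately have "\<Union>\<D> \<in> \<D>" using D(2) by (intro Union_in_chain)
      then have "UNIV \<in> \<A>" using D CA by (metis subsetD top.extremum_uniqueI)
      then show False unfolding \<A>_def by blast
    qed
    have mem: "open U" "- K \<subseteq> U" "\<phi> ` (- U) \<subseteq> - U" if "U \<in> \<C>" for U
      using subsetD[OF CA that] unfolding \<A>_def by simp_all
    have "open (\<Union>\<C>)" using mem(1) by blast
    moreover have "- K \<subseteq> \<Union>\<C>" using C(1) mem(2) by blast
    moreover have "\<phi> ` (- \<Union>\<C>) \<subseteq> - \<Union>\<C>" using mem(3) by blast
    ultimately show "\<Union>\<C> \<in> \<A>" using \<open>\<Union>\<C> \<noteq> UNIV\<close> unfolding \<A>_def by simp
  qed
  then obtain U where U: "U \<in> \<A>" "\<And>X. X \<in> \<A> \<Longrightarrow> U \<subseteq> X \<Longrightarrow> X = U" by blast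
  have "minimal_set \<phi> (- U)"
    unfolding minimal_set_def
  proof (intro conjI allI impI)
    show "- U \<noteq> {}" "closed (- U)" "\<phi> ` (- U) \<subseteq> - U" using U(1) unfolding \<A>_def by auto
    fix N assume N: "N \<noteq> {} \<and> closed N \<and> \<phi> ` N \<subseteq> N \<and> N \<subseteq> - U"
    then have "- N \<in> \<A>" using U(1) unfolding \<A>_def by auto
    then have "- N = U" using U(2) N by blast
    then show "N = - U" by blast
  qed
  moreover have "- U \<subseteq> K" using U(1) unfolding \<A>_def by blast
  ultimately show ?thesis using that by blast
qed

text \<open>That the first k + 1 iterates are near Y is an open condition satisfied on Y, and the
  orbit of \<omega> comes arbitrarily close to each point of Y.\<close>

lemma orbit_stays_near:
  assumes Y: "closed Y" "Y \<noteq> {}" "\<phi> ` Y \<subseteq> Y" "Y \<subseteq> orbit_closure \<phi> \<omega>" and e: "0 < e"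
  obtains n where "\<And>j. j \<le> k \<Longrightarrow> infdist ((\<phi> ^^ (n + j)) \<omega>) Y < e"
proof -
  obtain p where p: "p \<in> Y" using Y(2) by blast
  define W where "W = (\<Inter>j\<in>{..k}. {\<omega>. infdist ((\<phi> ^^ j) \<omega>) Y < e})"
  have "open W" unfolding W_def
    by (intro open_INT ballI open_Collect_less continuous_on_infdist continuous_funpow) simp_all
  moreover have "p \<in> W" unfolding W_def using invariant_funpow[OF Y(3) p] e by simp
  moreover have "p \<in> closure (range (\<lambda>n. (\<phi> ^^ n) \<omega>))" using p Y(4) unfolding orbit_closure_def
    by blast
  ultimately have "W \<inter> range (\<lambda>n. (\<phi> ^^ n) \<omega>) \<noteq> {}" using open_Int_closure_eq_empty[of W] by blast
  then obtain n where "(\<phi> ^^ n) \<omega> \<in> W" by blast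
  then have "infdist ((\<phi> ^^ (n + j)) \<omega>) Y < e" if "j \<le> k" for j
    using that unfolding W_def by (simp add: funpow_add add.commute[of n])
  then show ?thesis using that by blast
qed

theorem seqs_converge_imp_unique_minimal:
  assumes conv: "\<And>Vs. ergodic_seq \<phi> Vs \<Longrightarrow> WsO_converges_seq Vs"
  shows "\<exists>!M. M \<subseteq> orbit_closure \<phi> \<omega> \<and> minimal_set \<phi> M"
proof -
  let ?K = "orbit_closure \<phi> \<omega>"
  obtain Y where Y: "Y \<subseteq> ?K" "minimal_set \<phi> Y"
    by (rule minimal_subset_exists[OF orbit_closure_closed orbit_closure_nonempty
        orbit_closure_invariant], rule that)
  have "Y1 = Y2" if Y1: "Y1 \<subseteq> ?K" "minimal_set \<phi> Y1" and Y2: "Y2 \<subseteq> ?K" "minimal_set \<phi> Y2" for Y1 Y2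
  proof (rule ccontr)
    assume ne: "Y1 \<noteq> Y2"
    have p1: "closed Y1" "Y1 \<noteq> {}" "\<phi> ` Y1 \<subseteq> Y1" and p2: "closed Y2" "Y2 \<noteq> {}" "\<phi> ` Y2 \<subseteq> Y2"
      using Y1 Y2 unfolding minimal_set_def by auto
    have disj: "Y1 \<inter> Y2 = {}"
    proof (rule ccontr)
      assume "Y1 \<inter> Y2 \<noteq> {}"
      moreover have "closed (Y1 \<inter> Y2)" "\<phi> ` (Y1 \<inter> Y2) \<subseteq> Y1 \<inter> Y2" using p1 p2 by auto
      ultimately have "Y1 \<inter> Y2 = Y1" "Y1 \<inter> Y2 = Y2" using Y1(2) Y2(2) unfolding minimal_set_def
        by auto
      then show False using ne by simp
    qed
    have "compact Y2" using compact_UNIV p2(1) by (metis compact_Int_closed inf_top_left)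
    moreover have "continuous_on Y2 (\<lambda>p. infdist p Y1)" by (intro continuous_intros)
    ultimately have "\<exists>x\<in>Y2. \<forall>y\<in>Y2. infdist x Y1 \<le> infdist y Y1"
      using p2(2) by (intro continuous_attains_inf)
    then obtain p0 where p0: "p0 \<in> Y2" "\<And>p. p \<in> Y2 \<Longrightarrow> infdist p0 Y1 \<le> infdist p Y1" by blast
    \<comment> \<open>The distance between the disjoint compact sets Y1 and Y2; it will keep two
      subsequences of means apart.\<close>
    define c where "c = infdist p0 Y1"
    have c: "0 < c"
      using in_closed_iff_infdist_zero[OF p1(1,2), of p0] disj p0(1) infdist_nonneg[of p0 Y1]
        unfolding c_def
      by (auto simp: less_le)
    have "\<exists>n. \<forall>j\<le>k. infdist ((\<phi> ^^ (n + j)) \<omega>) Y1 < 1 / Suc k" for k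
      by (rule orbit_stays_near[OF p1 Y1(1), of "1 / Suc k" k]) (simp, blast)
    then obtain m1 where m1: "\<And>k j. j \<le> k \<Longrightarrow> infdist ((\<phi> ^^ (m1 k + j)) \<omega>) Y1 < 1 / Suc k" by metis
    have "\<exists>n. \<forall>j\<le>k. infdist ((\<phi> ^^ (n + j)) \<omega>) Y2 < 1 / Suc k" for k
      by (rule orbit_stays_near[OF p2 Y2(1), of "1 / Suc k" k]) (simp, blast)
    then obtain m2 where m2: "\<And>k j. j \<le> k \<Longrightarrow> infdist ((\<phi> ^^ (m2 k + j)) \<omega>) Y2 < 1 / Suc k" by metis
    \<comment> \<open>Block k has k + 1 times, all spent within 1 / (k + 1) of Y1 for even k and of
      Y2 for odd k. Tested with the distance from Y1, the even means tend to 0 while the odd ones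
      are at least c - 1 / (k + 1).\<close>
    define W where "W k = ces (if even k then m1 k else m2 k) k" for k
    have "ergodic_seq \<phi> W" unfolding W_def by (rule ergodic_seq_ces[OF filterlim_ident])
    then have "WsO_converges_seq W" by (rule conv)
    then obtain l where l: "(\<lambda>k. blinfun_apply (blinfun_apply (W k) (dirac \<omega>)) (distf Y1)) \<longlonglongrightarrow> l"
      unfolding WsO_converges_seq_def by blast
    have val: "blinfun_apply (blinfun_apply (ces m k) (dirac \<omega>)) (distf Y1)
      = (\<Sum>j\<le>k. infdist ((\<phi> ^^ (m + j)) \<omega>) Y1) / real (Suc k)" for m k
      by (simp add: ces_apply)
    have tend0: "(\<lambda>k. 1 / real (Suc k)) \<longlonglongrightarrow> 0" by (rule LIMSEQ_Suc[OF lim_1_over_n])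
    have even: "blinfun_apply (blinfun_apply (W (2 * k)) (dirac \<omega>)) (distf Y1) \<le> 1 / Suc (2 * k)"
        for k
    proof -
      have "(\<Sum>j\<le>2 * k. infdist ((\<phi> ^^ (m1 (2 * k) + j)) \<omega>) Y1) \<le> (\<Sum>j\<le>2 * k. 1 / Suc (2 * k))"
      proof (rule sum_mono)
        fix j assume "j \<in> {..2 * k}"
        then have "j \<le> 2 * k" by simp
        from m1[OF this] show "infdist ((\<phi> ^^ (m1 (2 * k) + j)) \<omega>) Y1 \<le> 1 / Suc (2 * k)" by simp
      qed
      also have "\<dots> = 1" by simp
      finally show ?thesis unfolding W_def by (simp add: val divide_right_mono)
    qed
    have s2: "strict_mono (\<lambda>k::nat. 2 * k)" "strict_mono (\<lambda>k::nat. Suc (2 * k))"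
      by (simp_all add: strict_mono_def)
    have "l \<le> 0"
      using LIMSEQ_le[OF LIMSEQ_subseq_LIMSEQ[OF l s2(1)] LIMSEQ_subseq_LIMSEQ[OF tend0 s2(1)]]
          even by (simp add: o_def)
    have odd: "c - 1 / Suc (Suc (2 * k)) \<le> blinfun_apply
        (blinfun_apply (W (Suc (2 * k))) (dirac \<omega>)) (distf Y1)" for k
    proof -
      let ?n = "Suc (2 * k)"
      have "real (Suc ?n) * (c - 1 / Suc ?n) = (\<Sum>j\<le>?n. c - 1 / Suc ?n)" by simp
      also have "\<dots> \<le> (\<Sum>j\<le>?n. infdist ((\<phi> ^^ (m2 ?n + j)) \<omega>) Y1)"
      proof (rule sum_mono)
        fix j assume "j \<in> {..?n}"
        then have "infdist ((\<phi> ^^ (m2 ?n + j)) \<omega>) Y2 < 1 / Suc ?n" by (intro m2) simp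
        then have "Inf (dist ((\<phi> ^^ (m2 ?n + j)) \<omega>) ` Y2) < 1 / Suc ?n"
          using p2(2) by (simp add: infdist_notempty)
        from cInf_lessD[OF _ this] p2(2)
        obtain p where p: "p \<in> Y2" "dist ((\<phi> ^^ (m2 ?n + j)) \<omega>) p < 1 / Suc ?n" by auto
        have "c \<le> infdist p Y1" using p0(2)[OF p(1)] unfolding c_def .
        also have "\<dots> \<le> infdist ((\<phi> ^^ (m2 ?n + j)) \<omega>) Y1 + dist p ((\<phi> ^^ (m2 ?n + j)) \<omega>)"
          by (rule infdist_triangle)
        finally show "c - 1 / Suc ?n \<le> infdist ((\<phi> ^^ (m2 ?n + j)) \<omega>) Y1" using p(2)
          by (simp add: dist_commute)
      qed
      finally show ?thesis unfolding W_def by (simp add: val pos_le_divide_eq mult.commute)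
    qed
    have "(\<lambda>k. c - 1 / real (Suc (Suc (2 * k)))) \<longlonglongrightarrow> c - 0"
      using LIMSEQ_subseq_LIMSEQ[OF tend0 s2(2)]
        by (intro tendsto_diff tendsto_const) (simp add: o_def)
    then have "c \<le> l"
      using LIMSEQ_le[OF _ LIMSEQ_subseq_LIMSEQ[OF l s2(2)]] odd by (simp add: o_def)
    then show False using \<open>l \<le> 0\<close> c by simp
  qed
  then show ?thesis using Y by blast
qed

end

section \<open>From a single minimal set to unique ergodicity\<close>

context dynamical_system
begin

text \<open>Y lies in the closure of each orbit, so every orbit enters the open neighbourhood;
  compactness of K bounds the waiting time uniformly.\<close>

lemma orbit_visits:
  assumes K: "closed K" "\<phi> ` K \<subseteq> K"
    and Y: "Y \<noteq> {}" "\<And>\<omega>. \<omega> \<in> K \<Longrightarrow> Y \<subseteq> orbit_closure \<phi> \<omega>" and e: "0 < e"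
  obtains N where "\<And>\<omega>. \<omega> \<in> K \<Longrightarrow> \<exists>j\<le>N. infdist ((\<phi> ^^ j) \<omega>) Y < e"
proof -
  define G where "G j = {\<omega>. infdist ((\<phi> ^^ j) \<omega>) Y < e}" for j
  have G: "open (G j)" for j unfolding G_def
    by (intro open_Collect_less continuous_on_infdist continuous_funpow) simp_all
  have "K \<subseteq> (\<Union>j\<in>UNIV. G j)"
  proof
    fix \<omega> assume "\<omega> \<in> K"
    obtain p where "p \<in> Y" using Y(1) by blast
    then have "p \<in> closure (range (\<lambda>n. (\<phi> ^^ n) \<omega>))" using Y(2)[OF \<open>\<omega> \<in> K\<close>]
      unfolding orbit_closure_def by blast
    then obtain y where y: "y \<in> range (\<lambda>n. (\<phi> ^^ n) \<omega>)" "dist y p < e"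
      using e closure_approachable by blast
    then obtain n where "dist ((\<phi> ^^ n) \<omega>) p < e" by blast
    then have "infdist ((\<phi> ^^ n) \<omega>) Y < e" using infdist_le[OF \<open>p \<in> Y\<close>, of "(\<phi> ^^ n) \<omega>"] by simp
    then show "\<omega> \<in> (\<Union>j\<in>UNIV. G j)" unfolding G_def by blast
  qed
  moreover have "compact K" using compact_UNIV K(1) by (metis compact_Int_closed inf_top_left)
  ultimately obtain J where J: "finite J" "K \<subseteq> (\<Union>j\<in>J. G j)"
    using compactE_image[of K UNIV G] G by auto
  obtain N where N: "\<And>j. j \<in> J \<Longrightarrow> j \<le> N" using J(1) by (meson finite_nat_set_iff_bounded_le)
  have "\<exists>j\<le>N. infdist ((\<phi> ^^ j) \<omega>) Y < e" if "\<omega> \<in> K" for \<omega>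
    using that J(2) N unfolding G_def by blast
  then show ?thesis using that by blast
qed

text \<open>The points whose iterates up to N are near Y form an open set containing Y, and its
  compact complement, if nonempty, has positive distance from Y.\<close>

lemma near_invariant_stays:
  assumes Y: "closed Y" "Y \<noteq> {}" "\<phi> ` Y \<subseteq> Y" and e: "0 < e"
  obtains \<delta> where "0 < \<delta>" "\<And>p j. infdist p Y < \<delta> \<Longrightarrow> j \<le> N \<Longrightarrow> infdist ((\<phi> ^^ j) p) Y < e"
proof -
  define W where "W = (\<Inter>j\<in>{..N}. {p. infdist ((\<phi> ^^ j) p) Y < e})"
  have "open W" unfolding W_def
    by (intro open_INT ballI open_Collect_less continuous_on_infdist continuous_funpow) simp_all
  then have cW: "compact (- W)" using compact_UNIV
    by (metis closed_Compl compact_Int_closed inf_top_left)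
  have YW: "Y \<subseteq> W" unfolding W_def using invariant_funpow[OF Y(3)] e by auto
  have "\<exists>\<delta>>0. \<forall>p\<in>- W. \<delta> \<le> infdist p Y"
  proof (cases "- W = {}")
    case True
    then show ?thesis by (intro exI[of _ 1]) auto
  next
    case False
    have "continuous_on (- W) (\<lambda>p. infdist p Y)" by (intro continuous_intros)
    then have "\<exists>x\<in>- W. \<forall>y\<in>- W. infdist x Y \<le> infdist y Y"
      by (rule continuous_attains_inf[OF cW False])
    then obtain x where x: "x \<in> - W" "\<forall>y\<in>- W. infdist x Y \<le> infdist y Y" by blast
    then have "x \<notin> Y" using YW by blast
    then have "0 < infdist x Y" using in_closed_iff_infdist_zero[OF Y(1,2), of x]
        infdist_nonneg[of x Y] by simp
    then show ?thesis using x(2) by blast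
  qed
  then obtain \<delta> where \<delta>: "0 < \<delta>" "\<forall>p\<in>- W. \<delta> \<le> infdist p Y" by blast
  have "infdist ((\<phi> ^^ j) p) Y < e" if "infdist p Y < \<delta>" "j \<le> N" for p j
  proof -
    have "p \<in> W" using \<delta>(2) that(1) by (meson ComplI not_less)
    then show ?thesis using that(2) unfolding W_def by auto
  qed
  then show ?thesis using that \<delta>(1) by blast
qed

text \<open>All orbits return to a neighbourhood of \<open>Y\<close> within bounded time, while a point close
  enough to \<open>Y\<close> stays near \<open>Y\<close> for that long; hence finitely many points can be brought near
  \<open>Y\<close> simultaneously.\<close>

lemma simultaneous_approach:
  assumes K: "closed K" "\<phi> ` K \<subseteq> K"
    and Y: "closed Y" "Y \<noteq> {}" "\<phi> ` Y \<subseteq> Y" "\<And>\<omega>. \<omega> \<in> K \<Longrightarrow> Y \<subseteq> orbit_closure \<phi> \<omega>"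
    and S: "finite S" "S \<subseteq> K" and e: "0 < e"
  shows "\<exists>n. \<forall>\<omega>\<in>S. infdist ((\<phi> ^^ n) \<omega>) Y < e"
  using S e
proof (induction S arbitrary: e rule: finite_induct)
  case (insert \<omega> S)
  obtain N where N: "\<And>\<omega>. \<omega> \<in> K \<Longrightarrow> \<exists>j\<le>N. infdist ((\<phi> ^^ j) \<omega>) Y < e"
    by (rule orbit_visits[OF K Y(2,4) insert.prems(2)], assumption, rule that)
  \<comment> \<open>The tolerance for S is fixed after the waiting time N of the new point: the
    points of S may then move on for up to N steps and still be within e.\<close>
  obtain \<delta> where \<delta>: "0 < \<delta>" "\<And>p j. infdist p Y < \<delta> \<Longrightarrow> j \<le> N \<Longrightarrow> infdist ((\<phi> ^^ j) p) Y < e"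
    by (rule near_invariant_stays[OF Y(1-3) insert.prems(2)], rule that)
  obtain n where n: "\<forall>\<omega>\<in>S. infdist ((\<phi> ^^ n) \<omega>) Y < \<delta>" using insert.IH[OF _ \<delta>(1)] insert.prems(1)
    by blast
  have "(\<phi> ^^ n) \<omega> \<in> K" using invariant_funpow[OF K(2)] insert.prems(1) by blast
  then obtain j where j: "j \<le> N" "infdist ((\<phi> ^^ j) ((\<phi> ^^ n) \<omega>)) Y < e" using N by blast
  have "\<forall>\<omega>\<in>insert \<omega> S. infdist ((\<phi> ^^ (j + n)) \<omega>) Y < e"
    using j n \<delta>(2) by (auto simp: funpow_add)
  then show ?case by blast
qed simp

text \<open>Iterates of the distance from Y tend to 0 at every point of K along a suitable filter,
  and by invariance they all have the same integral. The filter theorem, with the zero function as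
  limit, makes this integral 0.\<close>

lemma tame_invariant_prob_concentrated:
  assumes tame: "tame \<phi>" and K: "closed K" "\<phi> ` K \<subseteq> K"
    and Y: "closed Y" "Y \<noteq> {}" "\<phi> ` Y \<subseteq> Y" "\<And>\<omega>. \<omega> \<in> K \<Longrightarrow> Y \<subseteq> orbit_closure \<phi> \<omega>"
    and M: "invariant_prob_on \<phi> K M"
  shows "emeasure M (UNIV - Y) = 0"
proof -
  interpret finite_borel_measure M using invariant_prob_onD[OF M] by blast
  define n where "n i = (SOME n. \<forall>\<omega>\<in>fst i. infdist ((\<phi> ^^ n) \<omega>) Y < 1 / Suc (snd i))"
      for i :: "'a set \<times> nat"
  have n: "\<forall>\<omega>\<in>S. infdist ((\<phi> ^^ n (S, k)) \<omega>) Y < 1 / Suc k" if "finite S" "S \<subseteq> K" for S k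
  proof -
    have "\<exists>n. \<forall>\<omega>\<in>S. infdist ((\<phi> ^^ n) \<omega>) Y < 1 / Suc k"
      by (rule simultaneous_approach[OF K Y that]) simp_all
    then show ?thesis unfolding n_def fst_conv snd_conv by (rule someI_ex)
  qed
  \<comment> \<open>Pairs of a finite subset of K and a tolerance: K may be uncountable, whereas a
    sequence of iterates could be steered at countably many points only.\<close>
  define F where "F = finite_subsets_at_top K \<times>\<^sub>F sequentially"
  have F: "F \<noteq> bot" unfolding F_def by (simp add: prod_filter_eq_bot)
  define h where "h i = koop (n i) (distf Y)" for i
  have lim: "((\<lambda>i. apply_bcontfun (h i) \<omega>) \<longlongrightarrow> 0) F" if "\<omega> \<in> K" for \<omega>
  proof (rule tendstoI)
    fix e :: real assume "0 < e"
    then obtain k0 where k0: "1 / real (Suc k0) < e" using nat_approx_posE by blast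
    have "\<forall>\<^sub>F S in finite_subsets_at_top K. finite S \<and> S \<subseteq> K \<and> \<omega> \<in> S"
      unfolding eventually_finite_subsets_at_top using that by (intro exI[of _ "{\<omega>}"]) auto
    moreover have "\<forall>\<^sub>F k in sequentially. k0 \<le> k" by (rule eventually_ge_at_top)
    ultimately have "\<forall>\<^sub>F i in F. (finite (fst i) \<and> fst i \<subseteq> K \<and> \<omega> \<in> fst i) \<and> k0 \<le> snd i"
      unfolding F_def by (rule eventually_prodI)
    then show "\<forall>\<^sub>F i in F. dist (apply_bcontfun (h i) \<omega>) 0 < e"
    proof eventually_elim
      case (elim i)
      have "infdist ((\<phi> ^^ n (fst i, snd i)) \<omega>) Y < 1 / Suc (snd i)" using n elim by blast
      also have "\<dots> \<le> 1 / Suc k0" using elim by (simp add: frac_le)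
      finally show ?case using k0 unfolding h_def by (simp add: infdist_nonneg)
    qed
  qed
  have "((\<lambda>i. L1dist (apply_bcontfun (h i)) (\<lambda>_. 0)) \<longlongrightarrow> 0) F"
  proof (rule L1_convergence_along_filter[OF compact_UNIV
      tame_orb_ptwise_precompact[OF tame, of "distf Y"] _ K(1)])
    show "\<forall>\<^sub>F i in F. h i \<in> orb (distf Y)" by (simp add: h_def orb_def)
    show "norm x \<le> norm (distf Y)" if "x \<in> orb (distf Y)" for x using that norm_koop_le
      unfolding orb_def by auto
    show "emeasure M (UNIV - K) = 0" using invariant_prob_onD[OF M] by blast
    show "norm (0 :: 'a CX) \<le> norm (distf Y)" by simp
    show "(\<lambda>n. apply_bcontfun (0 :: 'a CX) \<omega>) \<longlonglongrightarrow> 0" for \<omega> by simp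
  qed (rule lim)
  moreover have "L1dist (apply_bcontfun (h i)) (\<lambda>_. 0) = (\<integral>\<omega>. infdist \<omega> Y \<partial>M)" for i
    using invariant_prob_integral[OF M, of "n i" "distf Y"]
    unfolding L1dist_def h_def by (simp add: infdist_nonneg)
  ultimately have "(\<integral>\<omega>. infdist \<omega> Y \<partial>M) = 0" using tendsto_unique[OF F tendsto_const] by simp
  then show ?thesis by (rule concentrated_of_integral_infdist[OF compact_UNIV Y(1,2)])
qed

text \<open>The limit of an ergodic sequence is an invariant function of the first Baire class, hence
  constant on a minimal set.\<close>

lemma ergodic_limit_constant_on_minimal:
  assumes Y: "minimal_set \<phi> Y" and Vs: "ergodic_seq \<phi> Vs"
    and f: "\<And>\<omega>. (\<lambda>n. blinfun_apply (blinfun_apply (Vs n) (dirac \<omega>)) x) \<longlonglongrightarrow> f \<omega>"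
    and p: "p \<in> Y" "p' \<in> Y"
  shows "f p' \<le> f p"
proof -
  have V: "Vs n \<in> coV \<phi>" for n using Vs unfolding ergodic_seq_def by blast
  have Yc: "closed Y" "\<phi> ` Y \<subseteq> Y" using Y unfolding minimal_set_def by auto
  have "\<forall>n. \<exists>h. \<forall>\<mu>. blinfun_apply (blinfun_apply (Vs n) \<mu>) x = blinfun_apply \<mu> h"
    using coV_pairing[OF V] by metis
  then obtain u where u: "\<And>n \<mu>. blinfun_apply (blinfun_apply (Vs n) \<mu>) x = blinfun_apply \<mu> (u n)"
    by metis
  have uf: "(\<lambda>n. apply_bcontfun (u n) \<omega>) \<longlonglongrightarrow> f \<omega>" for \<omega> using f[of \<omega>] unfolding u by simp
  \<comment> \<open>The means commute with V, so moving the point by \<phi> amounts to testing with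
    \<open>koop 1 x\<close>, and ergodicity equates the two limits.\<close>
  have inv1: "f (\<phi> \<omega>) = f \<omega>" for \<omega>
  proof -
    have "(\<lambda>n. blinfun_apply (blinfun_apply (Vs n) (dirac \<omega>)) x
        - blinfun_apply (blinfun_apply (Vs n) (dirac (\<phi> \<omega>))) x) \<longlonglongrightarrow> f \<omega> - f (\<phi> \<omega>)"
      by (intro tendsto_diff f)
    moreover have "blinfun_apply (blinfun_apply (Vs n) (dirac (\<phi> \<omega>))) x
        = blinfun_apply (blinfun_apply (Vs n) (dirac \<omega>)) (koop 1 x)" for n
      unfolding koopV_dirac[symmetric] coV_commutes[OF V] koopV_apply ..
    then have "(\<lambda>n. blinfun_apply (blinfun_apply (Vs n) (dirac \<omega>)) x
        - blinfun_apply (blinfun_apply (Vs n) (dirac (\<phi> \<omega>))) x) \<longlonglongrightarrow> 0"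
      using Vs unfolding ergodic_seq_def ergodic_apply by simp
    ultimately have "f \<omega> - f (\<phi> \<omega>) = 0" by (rule LIMSEQ_unique)
    then show ?thesis by simp
  qed
  have inv: "f ((\<phi> ^^ n) \<omega>) = f \<omega>" for n \<omega> by (induction n) (simp_all add: inv1)
  \<comment> \<open>The orbit of p is dense in Y and f is constant along it, so the value f p occurs
    in every relatively open part of Y. Two different values would make f oscillate everywhere on
    Y.\<close>
  have dense: "\<exists>q\<in>U \<inter> Y. f q = f p" if U: "open U" "U \<inter> Y \<noteq> {}" and p: "p \<in> Y" for U p
  proof -
    have least: "N = Y" if "N \<noteq> {}" "closed N" "\<phi> ` N \<subseteq> N" "N \<subseteq> Y" for N
      using Y that unfolding minimal_set_def by simp
    have "orbit_closure \<phi> p = Y"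
      by (rule least[OF orbit_closure_nonempty orbit_closure_closed orbit_closure_invariant
          orbit_closure_subset[OF Yc p]])
    then obtain y where y: "y \<in> U" "y \<in> closure (range (\<lambda>n. (\<phi> ^^ n) p))" using U(2)
      unfolding orbit_closure_def by blast
    then have "U \<inter> range (\<lambda>n. (\<phi> ^^ n) p) \<noteq> {}" using open_Int_closure_eq_empty[OF U(1)] by blast
    then obtain n where "(\<phi> ^^ n) p \<in> U" by blast
    then show ?thesis using invariant_funpow[OF Yc(2) p] inv by blast
  qed
  obtain B :: "nat \<Rightarrow> 'a set" where B: "\<And>n. open (B n)"
      "\<And>U x. open U \<Longrightarrow> x \<in> U \<Longrightarrow> \<exists>n. x \<in> B n \<and> B n \<subseteq> U"
    by (rule compact_countable_basis[OF compact_UNIV], rule that)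
  show ?thesis
  proof (rule no_oscillation_on_closed[OF compact_UNIV Yc(1) _ uf B(2)])
    show "Y \<noteq> {}" using p by blast
    fix n assume "B n \<inter> Y \<noteq> {}"
    then show "\<exists>q\<in>B n \<inter> Y. f p' \<le> f q" "\<exists>q\<in>B n \<inter> Y. f q \<le> f p"
      using dense[OF B(1)] p by (metis order_refl)+
  qed
qed

theorem unique_minimal_imp_uniquely_ergodic:
  assumes tame: "tame \<phi>" and um: "\<exists>!Y. Y \<subseteq> orbit_closure \<phi> \<omega> \<and> minimal_set \<phi> Y"
  shows "uniquely_ergodic_on \<phi> (orbit_closure \<phi> \<omega>)"
proof -
  let ?K = "orbit_closure \<phi> \<omega>"
  obtain Y where Y: "Y \<subseteq> ?K" "minimal_set \<phi> Y" using um by blast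
  have Yc: "closed Y" "Y \<noteq> {}" "\<phi> ` Y \<subseteq> Y" using Y unfolding minimal_set_def by auto
  \<comment> \<open>Every orbit closure inside \<open>?K\<close> contains a minimal set, which by
    uniqueness is Y.\<close>
  have YK: "Y \<subseteq> orbit_closure \<phi> \<omega>'" if "\<omega>' \<in> ?K" for \<omega>'
  proof -
    obtain Y' where Y': "Y' \<subseteq> orbit_closure \<phi> \<omega>'" "minimal_set \<phi> Y'"
      by (rule minimal_subset_exists[OF orbit_closure_closed orbit_closure_nonempty
          orbit_closure_invariant], rule that)
    then have "Y' \<subseteq> ?K" using orbit_closure_subset[OF orbit_closure_closed orbit_closure_invariant
        that] by blast
    then have "Y' = Y" using um Y Y' by blast
    then show ?thesis using Y' by simp
  qed
  obtain Vs where Vs: "ergodic_seq \<phi> Vs" "WsO_converges_seq Vs"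
    by (rule tame_exists_convergent_ergodic_seq[OF tame], rule that)
  have V: "Vs n \<in> coV \<phi>" for n using Vs unfolding ergodic_seq_def by blast
  obtain T where T: "\<And>x \<mu>. (\<lambda>n. blinfun_apply (blinfun_apply (Vs n) \<mu>) x)
      \<longlonglongrightarrow> blinfun_apply (blinfun_apply T \<mu>) x"
    using Vs(2) unfolding WsO_converges_seq_def by blast
  obtain y where y: "y \<in> Y" using Yc by blast
  define f where "f x \<omega> = blinfun_apply (blinfun_apply T (dirac \<omega>)) x" for x \<omega>
  \<comment> \<open>The approximants u n have the same integral as x, hence so does their limit,
    which equals the constant \<open>f x y\<close> on Y, where M lives. So all invariant measures
    integrate x to the same number.\<close>
  have integral: "(\<integral>\<omega>. apply_bcontfun x \<omega> \<partial>M) = f x y" if M: "invariant_prob_on \<phi> ?K M" for M x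
  proof -
    interpret prob_space M using invariant_prob_onD[OF M] by blast
    interpret finite_borel_measure M using invariant_prob_onD[OF M] by blast
    have "\<forall>n. \<exists>h. h \<in> convex hull (orb x) \<and> (\<forall>\<mu>. blinfun_apply (blinfun_apply (Vs n) \<mu>) x
        = blinfun_apply \<mu> h)"
      using coV_pairing[OF V] by metis
    then obtain u where u: "\<And>n. u n \<in> convex hull (orb x)"
      "\<And>n \<mu>. blinfun_apply (blinfun_apply (Vs n) \<mu>) x = blinfun_apply \<mu> (u n)" by metis
    have uf: "(\<lambda>n. apply_bcontfun (u n) \<omega>) \<longlonglongrightarrow> f x \<omega>" for \<omega> using T[of "dirac \<omega>" x]
      unfolding u(2) f_def by simp
    have ub: "norm (u n) \<le> norm x" for n by (rule hull_orb_norm_le[OF u(1)])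
    have fi: "integrable M (f x)" using ptwise_limit_bounded(3)[OF ub uf] .
    have L: "(\<lambda>n. L1dist (apply_bcontfun (u n)) (f x)) \<longlonglongrightarrow> 0" using L1dist_ptwise[OF ub uf] .
    have "emeasure M (UNIV - Y) = 0"
      by (rule tame_invariant_prob_concentrated[OF tame orbit_closure_closed
          orbit_closure_invariant Yc YK M])
    then have "UNIV - Y \<in> null_sets M"
      using open_Diff[OF open_UNIV Yc(1)] by (simp add: null_sets_def sets_M borel_open)
    then have "AE \<omega> in M. \<omega> \<in> Y" by (rule AE_I') (auto simp: space_M)
    moreover have "f x \<omega> = f x y" if "\<omega> \<in> Y" for \<omega>
      using ergodic_limit_constant_on_minimal[OF Y(2) Vs(1), of x "f x"] T that y unfolding f_def
        by (meson antisym)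
    ultimately have "AE \<omega> in M. f x \<omega> = f x y" by (auto elim: eventually_mono)
    then have "(\<integral>\<omega>. f x \<omega> \<partial>M) = (\<integral>\<omega>. f x y \<partial>M)" using fi by (intro integral_cong_AE) auto
    then have fint: "(\<integral>\<omega>. f x \<omega> \<partial>M) = f x y" using prob_space by simp
    have "\<bar>(\<integral>\<omega>. apply_bcontfun x \<omega> \<partial>M) - (\<integral>\<omega>. f x \<omega> \<partial>M)\<bar> \<le> L1dist (apply_bcontfun (u n)) (f x)"
        for n
    proof -
      have "(\<integral>\<omega>. apply_bcontfun x \<omega> \<partial>M) = (\<integral>\<omega>. apply_bcontfun (u n) \<omega> \<partial>M)"
        using hull_orb_integral[OF M u(1)] by simp
      then have "(\<integral>\<omega>. apply_bcontfun x \<omega> \<partial>M) - (\<integral>\<omega>. f x \<omega> \<partial>M)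
          = (\<integral>\<omega>. apply_bcontfun (u n) \<omega> - f x \<omega> \<partial>M)"
        using fi by simp
      also have "\<bar>\<dots>\<bar> \<le> (\<integral>\<omega>. \<bar>apply_bcontfun (u n) \<omega> - f x \<omega>\<bar> \<partial>M)" by (rule integral_abs_bound)
      finally show ?thesis unfolding L1dist_def .
    qed
    then have "\<bar>(\<integral>\<omega>. apply_bcontfun x \<omega> \<partial>M) - (\<integral>\<omega>. f x \<omega> \<partial>M)\<bar> \<le> 0" using LIMSEQ_le_const[OF L]
      by blast
    then show ?thesis using fint by simp
  qed
  have "M1 = M2" if M: "invariant_prob_on \<phi> ?K M1" "invariant_prob_on \<phi> ?K M2" for M1 M2
  proof (rule measure_eq_continuousI)
    show "finite_measure M1" "finite_measure M2" "sets M1 = sets borel" "sets M2 = sets borel"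
      using invariant_prob_onD(2)[OF M(1)] invariant_prob_onD(2)[OF M(2)]
      by (auto simp: finite_borel_measure_def finite_borel_measure_axioms_def)
    fix g :: "'a \<Rightarrow> real" assume "continuous_on UNIV g"
    then have "apply_bcontfun (Bcontfun g) = g" by (rule apply_Bcontfun[OF compact_UNIV])
    then show "(\<integral>x. g x \<partial>M1) = (\<integral>x. g x \<partial>M2)"
      using integral[OF M(1), of "Bcontfun g"] integral[OF M(2), of "Bcontfun g"] by simp
  qed
  moreover obtain M where "invariant_prob_on \<phi> ?K M" by (rule invariant_prob_exists, rule that)
  ultimately show ?thesis unfolding uniquely_ergodic_on_def by blast
qed

theorem nets_converge_imp_seqs_converge:
  assumes "\<And>F. ergodic_net \<phi> F \<Longrightarrow> WsO_converges F" "ergodic_seq \<phi> Vs"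
  shows "WsO_converges_seq Vs"
  using assms(1)[OF ergodic_seq_net[OF assms(2)]] by (simp add: WsO_converges_seq_iff)

end

theorem theorem3p4:
  fixes \<phi> :: "'a::metric_space \<Rightarrow> 'a"
  assumes "compact (UNIV :: 'a set)"
    and "continuous_on UNIV \<phi>"
    and "tame \<phi>"
  shows "(\<exists>Vs. ergodic_seq \<phi> Vs \<and> WsO_converges_seq Vs)
    \<and> ((\<forall>F. ergodic_net \<phi> F \<longrightarrow> WsO_converges F) \<longleftrightarrow> (\<forall>\<omega>. uniquely_ergodic_on \<phi> (orbit_closure \<phi> \<omega>)))
    \<and> ((\<forall>\<omega>. uniquely_ergodic_on \<phi> (orbit_closure \<phi> \<omega>))
        \<longleftrightarrow> (\<forall>Vs. ergodic_seq \<phi> Vs \<longrightarrow> WsO_converges_seq Vs))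
    \<and> ((\<forall>Vs. ergodic_seq \<phi> Vs \<longrightarrow> WsO_converges_seq Vs) \<longleftrightarrow>
        (\<forall>\<omega>. \<exists>!M. M \<subseteq> orbit_closure \<phi> \<omega> \<and> minimal_set \<phi> M))"
proof -
  interpret dynamical_system \<phi> by standard fact+
  have ex: "\<exists>Vs. ergodic_seq \<phi> Vs \<and> WsO_converges_seq Vs"
    by (rule tame_exists_convergent_ergodic_seq[OF assms(3)]) blast
  have ba: "(\<forall>\<omega>. uniquely_ergodic_on \<phi> (orbit_closure \<phi> \<omega>)) \<Longrightarrow> \<forall>F. ergodic_net \<phi> F \<longrightarrow> WsO_converges F"
    using uniquely_ergodic_imp_nets_converge[OF assms(3)] by simp
  have ac: "(\<forall>F. ergodic_net \<phi> F \<longrightarrow> WsO_converges F) \<Longrightarrow> \<forall>Vs. ergodic_seq \<phi> Vs \<longrightarrow> WsO_converges_seq Vs"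
    using nets_converge_imp_seqs_converge by simp
  have cd: "(\<forall>Vs. ergodic_seq \<phi> Vs \<longrightarrow> WsO_converges_seq Vs) \<Longrightarrow>
      \<forall>\<omega>. \<exists>!M. M \<subseteq> orbit_closure \<phi> \<omega> \<and> minimal_set \<phi> M"
    using seqs_converge_imp_unique_minimal by simp
  have db: "(\<forall>\<omega>. \<exists>!M. M \<subseteq> orbit_closure \<phi> \<omega> \<and> minimal_set \<phi> M) \<Longrightarrow>
      \<forall>\<omega>. uniquely_ergodic_on \<phi> (orbit_closure \<phi> \<omega>)"
    using unique_minimal_imp_uniquely_ergodic[OF assms(3)] by simp
  show ?thesis using ex ba ac cd db by argo
qed

end
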